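(* There are exactly $183$ standard division sudokus of rank $3$ up to isotopism. Moreover, among representatives of the $186$ ds-isotopism classes of standard division sudokus of rank $3$, the only pairs of distinct classes whose members are isotopic are the classes of: $DS(9,18)$ and $DS(9,19)$; $DS(9,21)$ and $DS(9,60)$; $DS(9,33)$ and $DS(9,117)$. (That is, two standard division sudokus of rank $3$ that are not ds-isotopic are isotopic if and only if, for one of these three pairs, one of them is ds-isotopic to the first member of the pair and the other is ds-isotopic to the second member.)
   Context: A latin square on a finite set $X$ is an array $L=(L(x,y))_{x,y\in X}$ with entries in $X$ such that every row and every column contains all symbols. Its orthogonal array is $O(L)=\{(x,y,L(x,y)):x,y\in X\}$. The standard sudoku partition of $X=\{1,\dots,9\}$ has blocks $X_1=\{1,2,3\}$, $X_2=\{4,5,6\}$, $X_3=\{7,8,9\}$. Bands, stacks and piles of $L$ are $B_i=\{(x,y,z)\in O(L):x\in X_i\}$, $S_i=\{(x,y,z)\in O(L):y\in X_i\}$, $P_i=\{(x,y,z)\in O(L):z\in X_i\}$. A standard division sudoku of rank $3$ is a latin square $L$ on $\{1,\dots,9\}$ such that for all $i,j$: every $z\in X$ occurs as a third coordinate in $B_i\cap S_j$, every $y\in X$ occurs as a second coordinate in $B_i\cap P_j$, and every $x\in X$ occurs as a first coordinate in $S_i\cap P_j$. An isotopism from $L_1$ to $L_2$ is a triple $(\alpha,\beta,\gamma)$ of permutations of $X$ with $L_2(\alpha(x),\beta(y))=\gamma(L_1(x,y))$ for all $x,y$; $L_1,L_2$ are then isotopic. They are ds-isotopic if there is an isotopism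 in which each of $\alpha,\beta,\gamma$ maps every block to a block. There are $186$ ds-isotopism classes of standard division sudokus of rank $3$. The squares named in the claim are the following (rows $1,\dots,9$ in order, each row written as a string of the entries in columns $1,\dots,9$): $DS(9,18)$: 147258369, 825936714, 693471582, 258369147, 936714825, 471582693, 369825471, 714693258, 582147936. $DS(9,19)$: 147258369, 825936714, 693471582, 258369147, 936714825, 471582693, 384195276, 519627438, 762843951. $DS(9,21)$: 147258369, 825936714, 693471582, 258369471, 936714258, 471582936, 369147825, 714825693, 582693147. $DS(9,60)$: 147258396, 825936417, 693471852, 258369174, 936714528, 471582963, 369147285, 714825639, 582693741. $DS(9,33)$: 147258369, 825936714, 693471582, 259367148, 736814925, 481592673, 368149257, 914725836, 572683491. $DS(9,117)$: 147259368, 825736914, 693481572, 258367149, 936814725, 471592683, 369148257, 714925836, 582673491. *)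

theory Defs
  imports "HOL-Library.FuncSet" "HOL-Combinatorics.Permutations"
begin

text \<open>
  An array over \<open>X\<close> is a curried function which is \<open>undefined\<close> outside of \<open>X\<close>, so that
  two arrays are equal as functions iff all their entries indexed by \<open>X\<close> agree.
\<close>

definition latin_square :: "'a set \<Rightarrow> ('a \<Rightarrow> 'a \<Rightarrow> 'a) \<Rightarrow> bool" where
  "latin_square X L \<longleftrightarrow>
     finite X \<and> L \<in> X \<rightarrow>\<^sub>E X \<rightarrow>\<^sub>E X \<and>
     (\<forall>x\<in>X. \<forall>z\<in>X. \<exists>y\<in>X. L x y = z) \<and>
     (\<forall>y\<in>X. \<forall>z\<in>X. \<exists>x\<in>X. L x y = z)"

definition orthogonal_array :: "'a set \<Rightarrow> ('a \<Rightarrow> 'a \<Rightarrow> 'a) \<Rightarrow> ('a \<times> 'a \<times> 'a) set" where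
  "orthogonal_array X L = {(x, y, L x y) |x y. x \<in> X \<and> y \<in> X}"

abbreviation symbols9 :: "nat set" where
  "symbols9 \<equiv> {1..9}"

definition sudoku_partition :: "nat set set" where
  "sudoku_partition = {{1, 2, 3}, {4, 5, 6}, {7, 8, 9}}"

text \<open>Bands, stacks and piles are indexed by the blocks themselves instead of by their numbers.\<close>

definition band :: "(nat \<Rightarrow> nat \<Rightarrow> nat) \<Rightarrow> nat set \<Rightarrow> (nat \<times> nat \<times> nat) set" where
  "band L A = {(x, y, z) \<in> orthogonal_array symbols9 L. x \<in> A}"

definition stack :: "(nat \<Rightarrow> nat \<Rightarrow> nat) \<Rightarrow> nat set \<Rightarrow> (nat \<times> nat \<times> nat) set" where
  "stack L A = {(x, y, z) \<in> orthogonal_array symbols9 L. y \<in> A}"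

definition pile :: "(nat \<Rightarrow> nat \<Rightarrow> nat) \<Rightarrow> nat set \<Rightarrow> (nat \<times> nat \<times> nat) set" where
  "pile L A = {(x, y, z) \<in> orthogonal_array symbols9 L. z \<in> A}"

definition standard_division_sudoku :: "(nat \<Rightarrow> nat \<Rightarrow> nat) \<Rightarrow> bool" where
  "standard_division_sudoku L \<longleftrightarrow>
     latin_square symbols9 L \<and>
     (\<forall>A\<in>sudoku_partition. \<forall>B\<in>sudoku_partition.
        (\<forall>z\<in>symbols9. \<exists>x y. (x, y, z) \<in> band L A \<inter> stack L B) \<and>
        (\<forall>y\<in>symbols9. \<exists>x z. (x, y, z) \<in> band L A \<inter> pile L B) \<and>
        (\<forall>x\<in>symbols9. \<exists>y z. (x, y, z) \<in> stack L A \<inter> pile L B))"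

definition isotopism ::
  "'a set \<Rightarrow> ('a \<Rightarrow> 'a \<Rightarrow> 'a) \<Rightarrow> ('a \<Rightarrow> 'a \<Rightarrow> 'a) \<Rightarrow> ('a \<Rightarrow> 'a) \<Rightarrow> ('a \<Rightarrow> 'a) \<Rightarrow> ('a \<Rightarrow> 'a) \<Rightarrow> bool"
where
  "isotopism X L\<^sub>1 L\<^sub>2 \<alpha> \<beta> \<gamma> \<longleftrightarrow>
     \<alpha> permutes X \<and> \<beta> permutes X \<and> \<gamma> permutes X \<and>
     (\<forall>x\<in>X. \<forall>y\<in>X. L\<^sub>2 (\<alpha> x) (\<beta> y) = \<gamma> (L\<^sub>1 x y))"

definition isotopic :: "(nat \<Rightarrow> nat \<Rightarrow> nat) \<Rightarrow> (nat \<Rightarrow> nat \<Rightarrow> nat) \<Rightarrow> bool" where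
  "isotopic L\<^sub>1 L\<^sub>2 \<longleftrightarrow> (\<exists>\<alpha> \<beta> \<gamma>. isotopism symbols9 L\<^sub>1 L\<^sub>2 \<alpha> \<beta> \<gamma>)"

definition maps_blocks :: "(nat \<Rightarrow> nat) \<Rightarrow> bool" where
  "maps_blocks \<pi> \<longleftrightarrow> (\<forall>A\<in>sudoku_partition. \<pi> ` A \<in> sudoku_partition)"

definition ds_isotopic :: "(nat \<Rightarrow> nat \<Rightarrow> nat) \<Rightarrow> (nat \<Rightarrow> nat \<Rightarrow> nat) \<Rightarrow> bool" where
  "ds_isotopic L\<^sub>1 L\<^sub>2 \<longleftrightarrow>
     (\<exists>\<alpha> \<beta> \<gamma>. isotopism symbols9 L\<^sub>1 L\<^sub>2 \<alpha> \<beta> \<gamma> \<and> maps_blocks \<alpha> \<and> maps_blocks \<beta> \<and> maps_blocks \<gamma>)"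

definition standard_division_sudokus :: "(nat \<Rightarrow> nat \<Rightarrow> nat) set" where
  "standard_division_sudokus = {L. standard_division_sudoku L}"

definition isotopism_classes :: "(nat \<Rightarrow> nat \<Rightarrow> nat) set set" where
  "isotopism_classes = standard_division_sudokus //
     {(L, M). L \<in> standard_division_sudokus \<and> M \<in> standard_division_sudokus \<and> isotopic L M}"

definition ds_class :: "(nat \<Rightarrow> nat \<Rightarrow> nat) \<Rightarrow> (nat \<Rightarrow> nat \<Rightarrow> nat) set" where
  "ds_class L = {M \<in> standard_division_sudokus. ds_isotopic L M}"

definition ds_isotopism_classes :: "(nat \<Rightarrow> nat \<Rightarrow> nat) set set" where
  "ds_isotopism_classes = standard_division_sudokus //
     {(L, M). L \<in> standard_division_sudokus \<and> M \<in> standard_division_sudokus \<and> ds_isotopic L M}"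

definition square_of_rows :: "nat list list \<Rightarrow> nat \<Rightarrow> nat \<Rightarrow> nat" where
  "square_of_rows rows = (\<lambda>x\<in>symbols9. \<lambda>y\<in>symbols9. rows ! (x - 1) ! (y - 1))"

definition DS_9_18 :: "nat \<Rightarrow> nat \<Rightarrow> nat" where
  "DS_9_18 = square_of_rows
    [[1, 4, 7, 2, 5, 8, 3, 6, 9],
     [8, 2, 5, 9, 3, 6, 7, 1, 4],
     [6, 9, 3, 4, 7, 1, 5, 8, 2],
     [2, 5, 8, 3, 6, 9, 1, 4, 7],
     [9, 3, 6, 7, 1, 4, 8, 2, 5],
     [4, 7, 1, 5, 8, 2, 6, 9, 3],
     [3, 6, 9, 8, 2, 5, 4, 7, 1],
     [7, 1, 4, 6, 9, 3, 2, 5, 8],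
     [5, 8, 2, 1, 4, 7, 9, 3, 6]]"

definition DS_9_19 :: "nat \<Rightarrow> nat \<Rightarrow> nat" where
  "DS_9_19 = square_of_rows
    [[1, 4, 7, 2, 5, 8, 3, 6, 9],
     [8, 2, 5, 9, 3, 6, 7, 1, 4],
     [6, 9, 3, 4, 7, 1, 5, 8, 2],
     [2, 5, 8, 3, 6, 9, 1, 4, 7],
     [9, 3, 6, 7, 1, 4, 8, 2, 5],
     [4, 7, 1, 5, 8, 2, 6, 9, 3],
     [3, 8, 4, 1, 9, 5, 2, 7, 6],
     [5, 1, 9, 6, 2, 7, 4, 3, 8],
     [7, 6, 2, 8, 4, 3, 9, 5, 1]]"

definition DS_9_21 :: "nat \<Rightarrow> nat \<Rightarrow> nat" where
  "DS_9_21 = square_of_rows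
    [[1, 4, 7, 2, 5, 8, 3, 6, 9],
     [8, 2, 5, 9, 3, 6, 7, 1, 4],
     [6, 9, 3, 4, 7, 1, 5, 8, 2],
     [2, 5, 8, 3, 6, 9, 4, 7, 1],
     [9, 3, 6, 7, 1, 4, 2, 5, 8],
     [4, 7, 1, 5, 8, 2, 9, 3, 6],
     [3, 6, 9, 1, 4, 7, 8, 2, 5],
     [7, 1, 4, 8, 2, 5, 6, 9, 3],
     [5, 8, 2, 6, 9, 3, 1, 4, 7]]"

definition DS_9_60 :: "nat \<Rightarrow> nat \<Rightarrow> nat" where
  "DS_9_60 = square_of_rows
    [[1, 4, 7, 2, 5, 8, 3, 9, 6],
     [8, 2, 5, 9, 3, 6, 4, 1, 7],
     [6, 9, 3, 4, 7, 1, 8, 5, 2],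
     [2, 5, 8, 3, 6, 9, 1, 7, 4],
     [9, 3, 6, 7, 1, 4, 5, 2, 8],
     [4, 7, 1, 5, 8, 2, 9, 6, 3],
     [3, 6, 9, 1, 4, 7, 2, 8, 5],
     [7, 1, 4, 8, 2, 5, 6, 3, 9],
     [5, 8, 2, 6, 9, 3, 7, 4, 1]]"

definition DS_9_33 :: "nat \<Rightarrow> nat \<Rightarrow> nat" where
  "DS_9_33 = square_of_rows
    [[1, 4, 7, 2, 5, 8, 3, 6, 9],
     [8, 2, 5, 9, 3, 6, 7, 1, 4],
     [6, 9, 3, 4, 7, 1, 5, 8, 2],
     [2, 5, 9, 3, 6, 7, 1, 4, 8],
     [7, 3, 6, 8, 1, 4, 9, 2, 5],
     [4, 8, 1, 5, 9, 2, 6, 7, 3],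
     [3, 6, 8, 1, 4, 9, 2, 5, 7],
     [9, 1, 4, 7, 2, 5, 8, 3, 6],
     [5, 7, 2, 6, 8, 3, 4, 9, 1]]"

definition DS_9_117 :: "nat \<Rightarrow> nat \<Rightarrow> nat" where
  "DS_9_117 = square_of_rows
    [[1, 4, 7, 2, 5, 9, 3, 6, 8],
     [8, 2, 5, 7, 3, 6, 9, 1, 4],
     [6, 9, 3, 4, 8, 1, 5, 7, 2],
     [2, 5, 8, 3, 6, 7, 1, 4, 9],
     [9, 3, 6, 8, 1, 4, 7, 2, 5],
     [4, 7, 1, 5, 9, 2, 6, 8, 3],
     [3, 6, 9, 1, 4, 8, 2, 5, 7],
     [7, 1, 4, 9, 2, 5, 8, 3, 6],
     [5, 8, 2, 6, 7, 3, 4, 9, 1]]"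

definition exceptional_pairs :: "((nat \<Rightarrow> nat \<Rightarrow> nat) \<times> (nat \<Rightarrow> nat \<Rightarrow> nat)) set" where
  "exceptional_pairs = {(DS_9_18, DS_9_19), (DS_9_21, DS_9_60), (DS_9_33, DS_9_117)}"

end

theory Submission
  imports Defs
begin

text \<open>
  Each block has three elements, and every permutation of a three-element set is, once the set is
  identified with the field \<open>z3\<close> of order \<open>3\<close>, an affine map \<open>x \<mapsto> s x + t\<close> with \<open>s = \<plusminus>1\<close>. Label the nine
  rows, columns and symbols by pairs (block, position in the block). In a standard division sudoku the
  three triples with given blocks \<open>i\<close>, \<open>j\<close>, \<open>k\<close> form a perfect matching between the positions, so each
  block triple yields two affine maps. Two permutations of \<open>z3\<close> that agree nowhere have the same sign, and
  this forces the signs to factor as (sign of the row block)(sign of the column block). Reflecting blocks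
  makes all signs positive, and the square becomes
  \<open>y = x + P i j k\<close>, \<open>z = x + Q i j k\<close>, where \<open>P\<close> is injective in \<open>k\<close>, \<open>Q\<close> in \<open>j\<close>
  and \<open>Q - P\<close> in \<open>i\<close>. Injective again means affine:
  \<open>P = e i j * k + p i j\<close>, \<open>Q = f i k * j + q i k\<close> and \<open>Q - P = g j k * i + r j k\<close> with \<open>3 \<times> 3\<close> sign matrices
  \<open>e\<close>, \<open>f\<close>, \<open>g\<close> (lemma \<open>division_sys_affine\<close>). The solutions \<open>(p, q, r)\<close> for given signs differ only by
  translations of the blocks (lemma \<open>coherent_unique_up_to_shift\<close>), so up to ds-isotopism a square is a
  triple of sign matrices subject to a linear condition over \<open>z3\<close> (lemma \<open>admissible_signs_iff\<close>). Permuting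
  blocks and reflecting everything acts on these triples as a group of order \<open>6^3 * 2 = 432\<close>.

  That every admissible triple lies in the orbit of one of \<open>186\<close> listed triples is a finite search made
  small by proceeding in stages: \<open>e\<close> is brought to one of \<open>7\<close> matrices, then \<open>(e, f)\<close> to one of \<open>50\<close>
  pairs, then \<open>g\<close> to a listed matrix, each time by relabellings that fix what is already normalised
  (lemma \<open>admissible_signs_classified\<close>).

  Isotopism classes are separated by numbers that are obviously invariant because they count
  configurations in the orthogonal array. For rows \<open>a\<close>, \<open>b\<close>, \<open>d\<close> count the columns \<open>y\<close> for which there is a
  column \<open>v\<close> with \<open>L a v = L b y\<close> and \<open>L d v = L a y\<close>, and sum the fourth powers of these counts over all
  \<open>(a, b, d)\<close>. This sum and its analogues for columns and for symbols take \<open>180\<close> different values on the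
  \<open>186\<close> squares; a second count of short cycles separates two further groups of squares and gives \<open>183\<close>
  values (lemma \<open>distinct_keys_principal\<close>). The remaining three coincidences are genuine: explicit
  isotopisms are given (lemmas \<open>iso_sys_18_19\<close>, \<open>iso_sys_21_60\<close>, \<open>iso_sys_33_117\<close>). These pairs are not
  ds-isotopic: restricting the three sums to \<open>a\<close>, \<open>b\<close> in a common block gives numbers that ds-isotopisms
  preserve and that tell the two squares apart (lemma \<open>block_energies_exceptional\<close>).

  The finite computations are rewriting with explicit equations. They stay feasible because every term
  that is rewritten repeatedly is small: coefficients are looked up in tables that are premises of the
  goal, and conditionals are evaluated lazily through the congruence rule \<open>if_weak_cong\<close>.
\<close>

section \<open>Division sudokus as affine systems over the field of order three\<close>

datatype z3 = Z0 | Z1 | Z2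

instantiation z3 :: comm_ring_1
begin

definition zero_z3 :: z3 where "0 = Z0"

definition one_z3 :: z3 where "1 = Z1"

fun plus_z3 :: "z3 \<Rightarrow> z3 \<Rightarrow> z3" where
  "Z0 + Z0 = Z0" | "Z0 + Z1 = Z1" | "Z0 + Z2 = Z2"
| "Z1 + Z0 = Z1" | "Z1 + Z1 = Z2" | "Z1 + Z2 = Z0"
| "Z2 + Z0 = Z2" | "Z2 + Z1 = Z0" | "Z2 + Z2 = Z1"

fun uminus_z3 :: "z3 \<Rightarrow> z3" where
  "- Z0 = Z0" | "- Z1 = Z2" | "- Z2 = Z1"

fun minus_z3 :: "z3 \<Rightarrow> z3 \<Rightarrow> z3" where
  "Z0 - Z0 = Z0" | "Z0 - Z1 = Z2" | "Z0 - Z2 = Z1"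
| "Z1 - Z0 = Z1" | "Z1 - Z1 = Z0" | "Z1 - Z2 = Z2"
| "Z2 - Z0 = Z2" | "Z2 - Z1 = Z1" | "Z2 - Z2 = Z0"

fun times_z3 :: "z3 \<Rightarrow> z3 \<Rightarrow> z3" where
  "Z0 * Z0 = Z0" | "Z0 * Z1 = Z0" | "Z0 * Z2 = Z0"
| "Z1 * Z0 = Z0" | "Z1 * Z1 = Z1" | "Z1 * Z2 = Z2"
| "Z2 * Z0 = Z0" | "Z2 * Z1 = Z2" | "Z2 * Z2 = Z1"

instance
proof
  fix a b c :: z3
  show "a + b + c = a + (b + c)" by (cases a; cases b; cases c; simp)
  show "a + b = b + a" by (cases a; cases b; simp)
  show "0 + a = a" by (cases a; simp add: zero_z3_def)
  show "- a + a = 0" by (cases a; simp add: zero_z3_def)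
  show "a - b = a + - b" by (cases a; cases b; simp)
  show "a * b * c = a * (b * c)" by (cases a; cases b; cases c; simp)
  show "a * b = b * a" by (cases a; cases b; simp)
  show "1 * a = a" by (cases a; simp add: one_z3_def)
  show "(a + b) * c = a * c + b * c" by (cases a; cases b; cases c; simp)
  show "(0::z3) \<noteq> 1" by (simp add: zero_z3_def one_z3_def)
qed

end

lemma UNIV_z3: "UNIV = {Z0, Z1, Z2}"
proof (intro equalityI subsetI)
  fix x :: z3 show "x \<in> {Z0, Z1, Z2}" by (cases x) simp_all
qed simp

instance z3 :: finite
proof
  show "finite (UNIV :: z3 set)" unfolding UNIV_z3 by simp
qed

lemmas z3_arith = plus_z3.simps minus_z3.simps times_z3.simps uminus_z3.simps

lemma all_z3: "(\<forall>x. P x) \<longleftrightarrow> P Z0 \<and> P Z1 \<and> P Z2"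
  using z3.induct[of P] by blast

lemma sign_square: "s \<noteq> 0 \<Longrightarrow> s * s = (1::z3)"
  by (cases s) (simp_all add: zero_z3_def one_z3_def)

lemma sign_mult_cancel [simp]: "s \<noteq> 0 \<Longrightarrow> s * (s * x) = (x::z3)"
  by (metis mult.assoc mult_1 sign_square)

lemma sign_mult_eq_iff: "s \<noteq> 0 \<Longrightarrow> s * x = y \<longleftrightarrow> x = s * (y::z3)"
  by (metis sign_mult_cancel)

lemma sign_mult_eq_0: "s * t = (0::z3) \<longleftrightarrow> s = 0 \<or> t = 0"
  by (cases s; cases t; simp add: zero_z3_def)

text \<open>
  A counting fact: \<open>z3\<close> has \<open>6\<close> permutations, and there are \<open>6\<close> affine maps with nonzero slope.
\<close>

lemma inj_z3_affine:
  fixes h :: "z3 \<Rightarrow> z3"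
  assumes "inj h"
  shows "h (1::z3) - h 0 \<noteq> 0" and "h x = (h 1 - h 0) * x + h 0"
proof -
  have ne: "h Z0 \<noteq> h Z1" "h Z0 \<noteq> h Z2" "h Z1 \<noteq> h Z2"
    using assms by (auto dest: injD)
  then show "h 1 - h 0 \<noteq> 0" by (metis right_minus_eq zero_z3_def one_z3_def)
  have "c = (b - a) * Z2 + a" if "a \<noteq> b" "a \<noteq> c" "b \<noteq> c" for a b c
    using that by (cases a; cases b; cases c; simp)
  then have "h Z2 = (h 1 - h 0) * Z2 + h 0"
    using ne by (simp add: zero_z3_def one_z3_def)
  then show "h x = (h 1 - h 0) * x + h 0"
    by (cases x) (simp_all flip: zero_z3_def one_z3_def)
qed

type_synonym point = "z3 \<times> z3"
text \<open>
  A square is handled as the ternary relation \<open>L x y = z\<close>, which treats rows, columns and symbols alike.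
\<close>

type_synonym system = "point \<Rightarrow> point \<Rightarrow> point \<Rightarrow> bool"

definition iso_sys :: "system \<Rightarrow> system \<Rightarrow> bool" where
  "iso_sys S T \<longleftrightarrow> (\<exists>\<alpha> \<beta> \<gamma>. bij \<alpha> \<and> bij \<beta> \<and> bij \<gamma> \<and>
     (\<forall>x y z. T (\<alpha> x) (\<beta> y) (\<gamma> z) \<longleftrightarrow> S x y z))"

text \<open>
  The second conjunct expresses that blocks go to blocks.
\<close>

definition blockwise :: "(point \<Rightarrow> point) \<Rightarrow> bool" where
  "blockwise \<alpha> \<longleftrightarrow> bij \<alpha> \<and> (\<forall>x y. fst (\<alpha> x) = fst (\<alpha> y) \<longleftrightarrow> fst x = fst y)"

definition ds_iso_sys :: "system \<Rightarrow> system \<Rightarrow> bool" where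
  "ds_iso_sys S T \<longleftrightarrow> (\<exists>\<alpha> \<beta> \<gamma>. blockwise \<alpha> \<and> blockwise \<beta> \<and> blockwise \<gamma> \<and>
     (\<forall>x y z. T (\<alpha> x) (\<beta> y) (\<gamma> z) \<longleftrightarrow> S x y z))"

lemma blockwise_comp: "blockwise \<alpha> \<Longrightarrow> blockwise \<beta> \<Longrightarrow> blockwise (\<beta> \<circ> \<alpha>)"
  by (simp add: blockwise_def bij_comp del: split_paired_All)

lemma blockwise_inv:
  assumes "blockwise \<alpha>"
  shows "blockwise (inv \<alpha>)"
proof -
  have "bij \<alpha>" and *: "fst (\<alpha> x) = fst (\<alpha> y) \<longleftrightarrow> fst x = fst y" for x y
    using assms unfolding blockwise_def by blast+
  then have "bij (inv \<alpha>)" and "\<alpha> (inv \<alpha> x) = x" for x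
    by (simp_all add: bij_imp_bij_inv bij_is_surj surj_f_inv_f)
  then show ?thesis using * unfolding blockwise_def by metis
qed

lemma iso_sys_sym:
  assumes "iso_sys S T"
  shows "iso_sys T S"
proof -
  obtain \<alpha> \<beta> \<gamma> where *: "bij \<alpha>" "bij \<beta>" "bij \<gamma>"
    and h: "\<And>x y z. T (\<alpha> x) (\<beta> y) (\<gamma> z) = S x y z"
    using assms unfolding iso_sys_def by blast
  have "S (inv \<alpha> x) (inv \<beta> y) (inv \<gamma> z) = T x y z" for x y z
    using h[of "inv \<alpha> x" "inv \<beta> y" "inv \<gamma> z"] * by (simp add: bij_is_surj surj_f_inv_f)
  then show ?thesis
    unfolding iso_sys_def using * bij_imp_bij_inv by blast
qed

lemma iso_sys_trans:
  assumes "iso_sys S T" and "iso_sys T U"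
  shows "iso_sys S U"
proof -
  obtain \<alpha> \<beta> \<gamma> where *: "bij \<alpha>" "bij \<beta>" "bij \<gamma>"
    and h: "\<And>x y z. T (\<alpha> x) (\<beta> y) (\<gamma> z) = S x y z"
    using assms(1) unfolding iso_sys_def by blast
  obtain \<alpha>' \<beta>' \<gamma>' where bij': "bij \<alpha>'" "bij \<beta>'" "bij \<gamma>'"
    and h': "\<And>x y z. U (\<alpha>' x) (\<beta>' y) (\<gamma>' z) = T x y z"
    using assms(2) unfolding iso_sys_def by blast
  show ?thesis
    unfolding iso_sys_def
    by (intro exI[of _ "\<alpha>' \<circ> \<alpha>"] exI[of _ "\<beta>' \<circ> \<beta>"] exI[of _ "\<gamma>' \<circ> \<gamma>"])
      (simp add: * bij' h h' bij_comp)
qed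

lemma ds_iso_sys_sym:
  assumes "ds_iso_sys S T"
  shows "ds_iso_sys T S"
proof -
  obtain \<alpha> \<beta> \<gamma> where *: "blockwise \<alpha>" "blockwise \<beta>" "blockwise \<gamma>"
    and h: "\<And>x y z. T (\<alpha> x) (\<beta> y) (\<gamma> z) = S x y z"
    using assms unfolding ds_iso_sys_def by blast
  have "S (inv \<alpha> x) (inv \<beta> y) (inv \<gamma> z) = T x y z" for x y z
    using h[of "inv \<alpha> x" "inv \<beta> y" "inv \<gamma> z"] *
    by (simp add: blockwise_def bij_is_surj surj_f_inv_f)
  then show ?thesis
    unfolding ds_iso_sys_def using * blockwise_inv by blast
qed

lemma ds_iso_sys_trans:
  assumes "ds_iso_sys S T" and "ds_iso_sys T U"
  shows "ds_iso_sys S U"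
proof -
  obtain \<alpha> \<beta> \<gamma> where *: "blockwise \<alpha>" "blockwise \<beta>" "blockwise \<gamma>"
    and h: "\<And>x y z. T (\<alpha> x) (\<beta> y) (\<gamma> z) = S x y z"
    using assms(1) unfolding ds_iso_sys_def by blast
  obtain \<alpha>' \<beta>' \<gamma>' where bij': "blockwise \<alpha>'" "blockwise \<beta>'" "blockwise \<gamma>'"
    and h': "\<And>x y z. U (\<alpha>' x) (\<beta>' y) (\<gamma>' z) = T x y z"
    using assms(2) unfolding ds_iso_sys_def by blast
  show ?thesis
    unfolding ds_iso_sys_def
    by (intro exI[of _ "\<alpha>' \<circ> \<alpha>"] exI[of _ "\<beta>' \<circ> \<beta>"] exI[of _ "\<gamma>' \<circ> \<gamma>"])
      (simp add: * bij' h h' blockwise_comp)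
qed

lemma ds_iso_sys_imp_iso_sys: "ds_iso_sys S T \<Longrightarrow> iso_sys S T"
  unfolding ds_iso_sys_def iso_sys_def blockwise_def by blast

definition latin_sys :: "system \<Rightarrow> bool" where
  "latin_sys T \<longleftrightarrow> (\<forall>x y. \<exists>!z. T x y z) \<and> (\<forall>x z. \<exists>!y. T x y z) \<and> (\<forall>y z. \<exists>!x. T x y z)"

definition division_sys :: "system \<Rightarrow> bool" where
  "division_sys T \<longleftrightarrow> latin_sys T \<and>
     (\<forall>i j z. \<exists>x y. T (i, x) (j, y) z) \<and>
     (\<forall>i y k. \<exists>x z. T (i, x) y (k, z)) \<and>
     (\<forall>x j k. \<exists>y z. T x (j, y) (k, z))"

text \<open>
  Two transpositions of the three coordinates. They transport statements about rows to columns and to symbols.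
\<close>

definition conj_yx :: "system \<Rightarrow> system" where "conj_yx T x y z = T y x z"
definition conj_zy :: "system \<Rightarrow> system" where "conj_zy T x y z = T z y x"

type_synonym table = "z3 \<Rightarrow> z3 \<Rightarrow> z3"

text \<open>
  The parameters are the slopes \<open>e\<close>, \<open>f\<close> and the intercepts \<open>p\<close>, \<open>q\<close> of \<open>P\<close> and \<open>Q\<close>.
\<close>

definition affine_sys :: "table \<Rightarrow> table \<Rightarrow> table \<Rightarrow> table \<Rightarrow> system" where
  "affine_sys e f p q = (\<lambda>(i, x) (j, y) (k, z).
     y = x + (e i j * k + p i j) \<and> z = x + (f i k * j + q i k))"

text \<open>
  The equation says that \<open>Q - P\<close> is affine in \<open>i\<close>, with slope \<open>g\<close> and intercept \<open>r\<close>.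
\<close>

definition coherent :: "table \<Rightarrow> table \<Rightarrow> table \<Rightarrow> table \<Rightarrow> table \<Rightarrow> table \<Rightarrow> bool" where
  "coherent e f g p q r \<longleftrightarrow>
     (\<forall>i j. e i j \<noteq> 0) \<and> (\<forall>i k. f i k \<noteq> 0) \<and> (\<forall>j k. g j k \<noteq> 0) \<and>
     (\<forall>i j k. f i k * j + q i k = (e i j * k + p i j) + (g j k * i + r j k))"

lemma latin_sys_unique:
  assumes "latin_sys T"
  shows "T x y z \<Longrightarrow> T x y z' \<Longrightarrow> z = z'"
    and "T x y z \<Longrightarrow> T x y' z \<Longrightarrow> y = y'"
    and "T x y z \<Longrightarrow> T x' y z \<Longrightarrow> x = x'"
proof -
  have "\<exists>!z. T x y z" "\<exists>!y. T x y z" "\<exists>!x. T x y z"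
    using assms by (simp_all only: latin_sys_def)
  then show "T x y z \<Longrightarrow> T x y z' \<Longrightarrow> z = z'"
    and "T x y z \<Longrightarrow> T x y' z \<Longrightarrow> y = y'"
    and "T x y z \<Longrightarrow> T x' y z \<Longrightarrow> x = x'"
    by (metis)+
qed

text \<open>
  For a fixed row \<open>x\<close> and stack \<open>j\<close>, the three piles \<open>k\<close> are met in three different columns of the
  stack, hence each in exactly one.
\<close>

lemma matching_inj:
  assumes "latin_sys T" and "\<forall>x j k. \<exists>y z. T x (j, y) (k, z)"
  assumes "T x (j, y) (k, z)" "T x (j, y') (k, z')"
  shows "y = y'" and "z = z'"
proof -
  have "\<forall>k. \<exists>v w. T x (j, v) (k, w)"
    using assms(2) by blast
  then obtain Y Z where YZ: "\<And>k. T x (j, Y k) (k, Z k)"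
    by metis
  have "inj Y"
  proof
    fix k k' assume "Y k = Y k'"
    then have "T x (j, Y k) (k', Z k')" using YZ[of k'] by simp
    from latin_sys_unique(1)[OF assms(1) YZ[of k] this] show "k = k'" by simp
  qed
  then have "surj Y" by (simp add: finite_UNIV_inj_surj)
  have *: "v = Y k" if "T x (j, v) (k, w)" for v w
  proof -
    obtain l where l: "v = Y l" using \<open>surj Y\<close> by (meson surjE)
    have "T x (j, v) (l, Z l)" using YZ[of l] l by simp
    from latin_sys_unique(1)[OF assms(1) that this] l show ?thesis by simp
  qed
  show "y = y'" using *[OF assms(3)] *[OF assms(4)] by simp
  with assms(3,4) show "z = z'"
    using latin_sys_unique(1)[OF assms(1), of x "(j, y)" "(k, z)" "(k, z')"] by simp
qed

lemma latin_conj: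
  assumes "latin_sys T"
  shows "latin_sys (conj_yx T)" and "latin_sys (conj_zy T)"
proof -
  have "\<exists>!z. T x y z" "\<exists>!y. T x y z" "\<exists>!x. T x y z" for x y z
    using assms by (simp_all only: latin_sys_def)
  then show "latin_sys (conj_yx T)" and "latin_sys (conj_zy T)"
    by (simp_all only: latin_sys_def conj_yx_def conj_zy_def) simp_all
qed

text \<open>
  The triples with block triple \<open>(i, j, k)\<close> form a matching: \<open>Y\<close> and \<open>Z\<close> give the column and the symbol
  positions in terms of the row position.
\<close>

lemma division_sys_functions:
  assumes "division_sys T"
  obtains Y Z where
    "\<And>i x j y k z. T (i, x) (j, y) (k, z) \<longleftrightarrow> y = Y i j k x \<and> z = Z i j k x"
    and "\<And>i j k. inj (Y i j k)" and "\<And>i j k. inj (Z i j k)"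
    and "\<And>i j x. inj (\<lambda>k. Y i j k x)" and "\<And>i k x. inj (\<lambda>j. Z i j k x)"
    and "\<And>i i' j k x x'. Y i j k x = Y i' j k x' \<Longrightarrow> Z i j k x = Z i' j k x' \<Longrightarrow> i = i'"
proof -
  have L: "latin_sys T" and dx: "\<forall>x j k. \<exists>y z. T x (j, y) (k, z)"
    and dy: "\<forall>y i k. \<exists>x z. T (i, x) y (k, z)" and dz: "\<forall>z j i. \<exists>y x. T (i, x) (j, y) z"
    using assms unfolding division_sys_def by blast+
  define Y where "Y i j k x = (SOME y. \<exists>z. T (i, x) (j, y) (k, z))" for i j k x
  define Z where "Z i j k x = (SOME z. T (i, x) (j, Y i j k x) (k, z))" for i j k x
  have "\<exists>z. T (i, x) (j, Y i j k x) (k, z)" for i x j k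
    unfolding Y_def by (rule someI_ex) (use dx in blast)
  then have YZ: "T (i, x) (j, Y i j k x) (k, Z i j k x)" for i x j k
    unfolding Z_def by (rule someI_ex)
  have 1: "T (i, x) (j, y) (k, z) \<longleftrightarrow> y = Y i j k x \<and> z = Z i j k x" for i x j y k z
    using YZ[of i x j k] matching_inj[OF L dx, of "(i, x)" j y k z "Y i j k x" "Z i j k x"] by blast
  have 2: "inj (Y i j k)" for i j k
  proof
    fix x x' assume *: "Y i j k x = Y i j k x'"
    show "x = x'"
      by (rule matching_inj(1)[OF latin_conj(1)[OF L], of "(j, Y i j k x)" i x k "Z i j k x" x' "Z i j k x'"])
        (use dy YZ[of i x j k] YZ[of i x' j k] * in \<open>auto simp: conj_yx_def\<close>)
  qed
  have 3: "inj (Z i j k)" for i j k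
  proof
    fix x x' assume *: "Z i j k x = Z i j k x'"
    show "x = x'"
      by (rule matching_inj(2)[OF latin_conj(2)[OF L], of "(k, Z i j k x)" j "Y i j k x" i x "Y i j k x'" x'])
        (use dz YZ[of i x j k] YZ[of i x' j k] * in \<open>auto simp: conj_zy_def\<close>)
  qed
  have 4: "inj (\<lambda>k. Y i j k x)" for i j x
  proof
    fix k k' assume "Y i j k x = Y i j k' x"
    then have "T (i, x) (j, Y i j k x) (k', Z i j k' x)" using YZ[of i x j k'] by simp
    from latin_sys_unique(1)[OF L YZ[of i x j k] this] show "k = k'" by simp
  qed
  have 5: "inj (\<lambda>j. Z i j k x)" for i k x
  proof
    fix j j' assume "Z i j k x = Z i j' k x"
    then have "T (i, x) (j', Y i j' k x) (k, Z i j k x)" using YZ[of i x j' k] by simp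
    from latin_sys_unique(2)[OF L YZ[of i x j k] this] show "j = j'" by simp
  qed
  have 6: "i = i'" if "Y i j k x = Y i' j k x'" "Z i j k x = Z i' j k x'" for i i' j k x x'
  proof -
    have "T (i', x') (j, Y i j k x) (k, Z i j k x)" using YZ[of i' x' j k] that by simp
    from latin_sys_unique(3)[OF L YZ[of i x j k] this] show ?thesis by simp
  qed
  show thesis using that[OF 1 2 3 4 5 6] .
qed

text \<open>
  Two affine maps with different slopes agree somewhere, because the difference of the slopes is
  invertible.
\<close>

lemma sign_eq_of_no_solution:
  fixes s t :: z3
  assumes "\<And>x. s * x + a \<noteq> t * x + b"
  shows "s = t"
proof (rule ccontr)
  assume "s \<noteq> t"
  then have "(s - t) * (s - t) = 1" by (intro sign_square) simp
  then have "(s - t) * ((s - t) * (b - a)) = b - a" by (metis mult.assoc mult_1)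
  then have "s * ((s - t) * (b - a)) + a = t * ((s - t) * (b - a)) + b"
    by (simp add: algebra_simps)
  with assms show False by blast
qed

lemma blockwise_block_affine:
  assumes "bij \<sigma>" and "\<And>i. s i \<noteq> 0"
  shows "blockwise (\<lambda>(i, x). (\<sigma> i, s i * x + t i))"
proof -
  have "inj (\<lambda>(i, x). (\<sigma> i, s i * x + t i))"
  proof (intro injI, clarsimp, intro conjI)
    fix i x j y
    assume "\<sigma> i = \<sigma> j" and e: "s i * x + t i = s j * y + t j"
    then show "i = j" using assms(1) by (meson bij_def injD)
    with e have "s i * (s i * x) = s i * (s i * y)" by simp
    then show "x = y" using assms(2) by simp
  qed
  then have "bij (\<lambda>(i, x). (\<sigma> i, s i * x + t i))"
    by (simp add: bij_def finite_UNIV_inj_surj)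
  then show ?thesis
    using assms(1) by (auto simp: blockwise_def bij_def dest: injD)
qed

text \<open>
  The normal form. Since the maps for different piles never agree, the sign \<open>S i j\<close> of the map from rows
  to columns does not depend on \<open>k\<close>; likewise \<open>U i k\<close> does not depend on \<open>j\<close>, and the product
  \<open>U i k * S i j\<close>, the sign of the map from columns to symbols, does not depend on \<open>i\<close>. Consequently
  \<open>S i j = a i * b j\<close> and \<open>U i k = a i * c k\<close>, and reflecting the blocks by \<open>a\<close>, \<open>b\<close>, \<open>c\<close> removes all signs.
\<close>

lemma division_sys_affine:
  assumes "division_sys T"
  obtains e f g p q r where "coherent e f g p q r" "ds_iso_sys T (affine_sys e f p q)"
using assms
proof (rule division_sys_functions)
  fix Y Z
  assume T: "\<And>i x j y k z. T (i, x) (j, y) (k, z) \<longleftrightarrow> y = Y i j k x \<and> z = Z i j k x"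
    and iY: "\<And>i j k. inj (Y i j k)" and iZ: "\<And>i j k. inj (Z i j k)"
    and kY: "\<And>i j x. inj (\<lambda>k. Y i j k x)" and jZ: "\<And>i k x. inj (\<lambda>j. Z i j k x)"
    and iYZ: "\<And>i i' j k x x'. Y i j k x = Y i' j k x' \<Longrightarrow> Z i j k x = Z i' j k x' \<Longrightarrow> i = i'"
  define S where "S i j = Y i j 0 1 - Y i j 0 0" for i j
  define P where "P i j k = Y i j k 0" for i j k
  define U where "U i k = Z i 0 k 1 - Z i 0 k 0" for i k
  define Q where "Q i j k = Z i j k 0" for i j k
  have S0: "S i j \<noteq> 0" for i j unfolding S_def using inj_z3_affine(1)[OF iY] .
  have U0: "U i k \<noteq> 0" for i k unfolding U_def using inj_z3_affine(1)[OF iZ] .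
  have Y: "Y i j k x = S i j * x + P i j k" for i j k x
  proof -
    have "Y i j k 1 - Y i j k 0 = S i j"
    proof (cases "k = 0")
      case False
      show ?thesis unfolding S_def
      proof (rule sign_eq_of_no_solution)
        fix x
        have "Y i j k x \<noteq> Y i j 0 x" using kY[of i j x] False by (auto dest: injD)
        then show "(Y i j k 1 - Y i j k 0) * x + Y i j k 0 \<noteq> (Y i j 0 1 - Y i j 0 0) * x + Y i j 0 0"
          using inj_z3_affine(2)[OF iY] by metis
      qed
    qed (simp add: S_def)
    then show ?thesis using inj_z3_affine(2)[OF iY, of i j k x] by (simp add: P_def)
  qed
  have Z: "Z i j k x = U i k * x + Q i j k" for i j k x
  proof -
    have "Z i j k 1 - Z i j k 0 = U i k"
    proof (cases "j = 0")
      case False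
      show ?thesis unfolding U_def
      proof (rule sign_eq_of_no_solution)
        fix x
        have "Z i j k x \<noteq> Z i 0 k x" using jZ[of i k x] False by (auto dest: injD)
        then show "(Z i j k 1 - Z i j k 0) * x + Z i j k 0 \<noteq> (Z i 0 k 1 - Z i 0 k 0) * x + Z i 0 k 0"
          using inj_z3_affine(2)[OF iZ] by metis
      qed
    qed (simp add: U_def)
    then show ?thesis using inj_z3_affine(2)[OF iZ, of i j k x] by (simp add: Q_def)
  qed
  have US: "U i k * S i j = U 0 k * S 0 j" for i j k
  proof (cases "i = 0")
    case False
    show ?thesis
    proof (rule sign_eq_of_no_solution)
      fix y
      have Yx: "Y l j k (S l j * (y - P l j k)) = y" for l using S0 by (simp add: Y)
      have "Z i j k (S i j * (y - P i j k)) \<noteq> Z 0 j k (S 0 j * (y - P 0 j k))"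
        using iYZ[of i j k _ 0] Yx False by metis
      then show "U i k * S i j * y + (Q i j k - U i k * S i j * P i j k)
        \<noteq> U 0 k * S 0 j * y + (Q 0 j k - U 0 k * S 0 j * P 0 j k)"
        by (simp add: Z algebra_simps)
    qed
  qed simp
  \<comment> \<open>the signs of the bands, stacks and piles\<close>
  define a where "a i = S i 0" for i
  define b where "b j = S 0 j * S 0 0" for j
  define c where "c k = S 0 0 * U 0 k" for k
  have abc0: "a i \<noteq> 0" "b i \<noteq> 0" "c i \<noteq> 0" for i
    using S0 U0 by (simp_all add: a_def b_def c_def sign_mult_eq_0)
  have UU: "U i k = a i * c k" for i k
  proof -
    have "U i k = S i 0 * (U i k * S i 0)" using S0[of i 0] by (metis mult.commute sign_mult_cancel)
    also have "\<dots> = a i * c k" using US[of i k 0] by (simp add: a_def c_def mult_ac)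
    finally show ?thesis .
  qed
  have SS: "S i j = a i * b j" for i j
  proof -
    have "S i j = U i 0 * (U i 0 * S i j)" using U0[of i 0] by simp
    also have "\<dots> = (a i * c 0) * (U 0 0 * S 0 j)"
      by (simp only: US[of i 0 j]) (simp only: UU[of i 0])
    also have "\<dots> = a i * (S 0 0 * (U 0 0 * (U 0 0 * S 0 j)))"
      by (simp only: c_def mult_ac)
    also have "\<dots> = a i * b j"
      by (simp only: sign_mult_cancel[OF U0]) (simp only: b_def mult.commute)
    finally show ?thesis .
  qed
  define \<alpha> where "\<alpha> = (\<lambda>(i, x). (i, a i * x + 0))"
  define \<beta> where "\<beta> = (\<lambda>(i, x). (i, b i * x + 0))"
  define \<gamma> where "\<gamma> = (\<lambda>(i, x). (i, c i * x + 0))"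
  have "bij (\<lambda>i :: z3. i)" by (simp add: bij_def)
  then have "blockwise (\<lambda>(i, x). (i, s i * x + 0))" if "\<And>i. s i \<noteq> 0" for s
    by (rule blockwise_block_affine[where t = "\<lambda>_. 0"]) (rule that)
  then have bl: "blockwise \<alpha>" "blockwise \<beta>" "blockwise \<gamma>"
    unfolding \<alpha>_def \<beta>_def \<gamma>_def using abc0 by simp_all
  define P' where "P' i j k = b j * P i j k" for i j k
  define Q' where "Q' i j k = c k * Q i j k" for i j k
  have kP: "inj (\<lambda>k. P' i j k)" for i j
    using kY[of i j 0] abc0(2)[of j] unfolding inj_def P'_def P_def
    by (metis sign_mult_cancel)
  have jQ: "inj (\<lambda>j. Q' i j k)" for i k
    using jZ[of i k 0] abc0(3)[of k] unfolding inj_def Q'_def Q_def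
    by (metis sign_mult_cancel)
  have Ya: "Y i j k (a i * v) = b j * (v + P' i j k)" for i j k v
  proof -
    have "Y i j k (a i * v) = a i * (a i * (b j * v)) + P i j k"
      by (simp only: Y SS mult_ac)
    also have "\<dots> = b j * v + b j * (b j * P i j k)"
      by (simp only: sign_mult_cancel[OF abc0(1)] sign_mult_cancel[OF abc0(2)])
    finally show ?thesis by (simp only: P'_def distrib_left)
  qed
  have Za: "Z i j k (a i * v) = c k * (v + Q' i j k)" for i j k v
  proof -
    have "Z i j k (a i * v) = a i * (a i * (c k * v)) + Q i j k"
      by (simp only: Z UU mult_ac)
    also have "\<dots> = c k * v + c k * (c k * Q i j k)"
      by (simp only: sign_mult_cancel[OF abc0(1)] sign_mult_cancel[OF abc0(3)])
    finally show ?thesis by (simp only: Q'_def distrib_left)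
  qed
  have iR: "inj (\<lambda>i. Q' i j k - P' i j k)" for j k
  proof
    fix i i' assume "Q' i j k - P' i j k = Q' i' j k - P' i' j k"
    then have "Z i j k (a i * - P' i j k) = Z i' j k (a i' * - P' i' j k)"
      by (simp only: Za) simp
    moreover have "Y i j k (a i * - P' i j k) = Y i' j k (a i' * - P' i' j k)"
      by (simp only: Ya) simp
    ultimately show "i = i'" using iYZ by blast
  qed
  define e where "e i j = P' i j 1 - P' i j 0" for i j
  define f where "f i k = Q' i 1 k - Q' i 0 k" for i k
  define g where "g j k = (Q' 1 j k - P' 1 j k) - (Q' 0 j k - P' 0 j k)" for j k
  define p where "p i j = P' i j 0" for i j
  define q where "q i k = Q' i 0 k" for i k
  define r where "r j k = Q' 0 j k - P' 0 j k" for j k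
  have Pe: "P' i j k = e i j * k + p i j" for i j k
    using inj_z3_affine(2)[OF kP[of i j], of k] by (simp add: e_def p_def)
  have Qe: "Q' i j k = f i k * j + q i k" for i j k
    using inj_z3_affine(2)[OF jQ[of i k], of j] by (simp add: f_def q_def)
  have Re: "Q' i j k - P' i j k = g j k * i + r j k" for i j k
    using inj_z3_affine(2)[OF iR[of j k], of i] by (simp add: g_def r_def)
  have "coherent e f g p q r"
    unfolding coherent_def
  proof (intro conjI allI)
    show "e i j \<noteq> 0" for i j unfolding e_def using inj_z3_affine(1)[OF kP] .
    show "f i j \<noteq> 0" for i j unfolding f_def using inj_z3_affine(1)[OF jQ] .
    show "g i j \<noteq> 0" for i j unfolding g_def using inj_z3_affine(1)[OF iR] .
    show "f i k * j + q i k = (e i j * k + p i j) + (g j k * i + r j k)" for i j k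
      using Re[of i j k] unfolding Pe Qe by (simp add: algebra_simps)
  qed
  moreover have "ds_iso_sys T (affine_sys e f p q)"
    unfolding ds_iso_sys_def
  proof (intro exI conjI allI)
    fix u v w :: point
    obtain i x j y k z where uvw: "u = (i, x)" "v = (j, y)" "w = (k, z)" by (metis surj_pair)
    define x' where "x' = a i * x"
    have x: "x = a i * x'" using abc0 by (simp add: x'_def)
    have 1: "b j * y = x' + P' i j k \<longleftrightarrow> y = Y i j k x"
      by (simp only: x Ya sign_mult_eq_iff[OF abc0(2)])
    have 2: "c k * z = x' + Q' i j k \<longleftrightarrow> z = Z i j k x"
      by (simp only: x Za sign_mult_eq_iff[OF abc0(3)])
    show "affine_sys e f p q (\<alpha> u) (\<beta> v) (\<gamma> w) \<longleftrightarrow> T u v w"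
      by (simp add: uvw \<alpha>_def \<beta>_def \<gamma>_def affine_sys_def T flip: Pe Qe 1 2 x'_def)
  qed (use bl in auto)
  ultimately show thesis by (rule that)
qed

section \<open>Sign matrices and their relabellings\<close>

text \<open>
  The intercepts that are normalised by \<open>p 0 j = 0\<close>, \<open>p i 0 = 0\<close> and \<open>q 0 k = 0\<close>; setting one index to
  \<open>0\<close> in the coherence equation then determines them from the signs.
\<close>

definition canon_p :: "table \<Rightarrow> table \<Rightarrow> table" where
  "canon_p f g i j = (f i 0 - f 0 0) * j + (g 0 0 - g j 0) * i"

definition canon_q :: "table \<Rightarrow> table \<Rightarrow> table" where
  "canon_q e g i k = (e i 0 - e 0 0) * k + g 0 k * i"

definition canon_r :: "table \<Rightarrow> table \<Rightarrow> table" where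
  "canon_r e f j k = f 0 k * j - e 0 j * k"

definition admissible :: "table \<Rightarrow> table \<Rightarrow> table \<Rightarrow> bool" where
  "admissible e f g \<longleftrightarrow> coherent e f g (canon_p f g) (canon_q e g) (canon_r e f)"

text \<open>
  The coherence defect \<open>d\<close> of the canonical intercepts is an alternating sum of defects of the given
  ones at the eight index triples obtained by replacing indices by \<open>0\<close>.
\<close>

lemma coherent_imp_admissible:
  assumes "coherent e f g p q r"
  shows "admissible e f g"
proof -
  \<comment> \<open>the defect of the coherence equation\<close>
  define d where "d i j k = f i k * j + q i k - (e i j * k + p i j) - (g j k * i + r j k)" for i j k
  have d0: "d i j k = 0" for i j k
    using assms unfolding coherent_def d_def by simp
  have "f i k * j + canon_q e g i k
      = (e i j * k + canon_p f g i j) + (g j k * i + canon_r e f j k)" for i j k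
  proof -
    have "f i k * j + canon_q e g i k
      - ((e i j * k + canon_p f g i j) + (g j k * i + canon_r e f j k))
      = d i j k - (d i 0 k - d 0 0 k) - (d i j 0 - d i 0 0 - d 0 j 0 + d 0 0 0) - d 0 j k"
      by (simp add: d_def canon_p_def canon_q_def canon_r_def algebra_simps)
    then show ?thesis by (simp add: d0)
  qed
  then show ?thesis
    using assms unfolding admissible_def coherent_def by blast
qed

text \<open>
  The differences of the intercepts satisfy \<open>w i k = u i j + v j k\<close>, so \<open>u\<close>, \<open>v\<close>, \<open>w\<close> split into
  functions of one index each, and these are the translations of the blocks.
\<close>

lemma coherent_unique_up_to_shift:
  assumes "coherent e f g p q r" and "coherent e f g p' q' r'"
  shows "ds_iso_sys (affine_sys e f p q) (affine_sys e f p' q')"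
proof -
  define u where "u i j = p' i j - p i j" for i j
  define w where "w i k = q' i k - q i k" for i k
  define v where "v j k = r' j k - r j k" for j k
  \<comment> \<open>subtract the two coherence equations\<close>
  have wuv: "w i k = u i j + v j k" for i j k
  proof -
    have "f i k * j + q i k = (e i j * k + p i j) + (g j k * i + r j k)"
      and "f i k * j + q' i k = (e i j * k + p' i j) + (g j k * i + r' j k)"
      using assms unfolding coherent_def by blast+
    then have "(f i k * j + q' i k) - (f i k * j + q i k)
      = (e i j * k + p' i j) + (g j k * i + r' j k) - ((e i j * k + p i j) + (g j k * i + r j k))"
      by (simp only:)
    then show ?thesis by (simp add: u_def w_def v_def algebra_simps)
  qed
  define a where "a i = - w i 0" for i
  define b where "b j = - v j 0" for j
  define c where "c k = v 0 k - v 0 0" for k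
  have pu: "p' i j = p i j + b j - a i" for i j
    using wuv[of i 0 j] by (simp add: u_def a_def b_def)
  have qw: "q' i k = q i k + c k - a i" for i k
    using wuv[of i k 0] wuv[of i 0 0] by (simp add: a_def c_def w_def[of i k] algebra_simps)
  have bl: "blockwise (\<lambda>(i, x). (i, 1 * x + t i))" for t :: "z3 \<Rightarrow> z3"
    by (rule blockwise_block_affine) (simp_all add: bij_def)
  show ?thesis
    unfolding ds_iso_sys_def
  proof (intro exI conjI allI)
    show "affine_sys e f p' q' ((\<lambda>(i, x). (i, 1 * x + a i)) X) ((\<lambda>(j, y). (j, 1 * y + b j)) Y)
      ((\<lambda>(k, z). (k, 1 * z + c k)) Z) \<longleftrightarrow> affine_sys e f p q X Y Z" for X Y Z
      by (cases X; cases Y; cases Z) (simp add: affine_sys_def pu qw algebra_simps)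
  qed (rule bl)+
qed

type_synonym relabelling = "z3 \<times> (z3 \<times> z3) \<times> (z3 \<times> z3) \<times> (z3 \<times> z3)"

text \<open>
  Permuting the bands, stacks and piles by affine maps of the block indices and scaling all positions by
  \<open>s\<^sub>0\<close> keeps the affine shape. A reflection \<open>s\<^sub>3\<close> of \<open>k\<close> changes the slope \<open>e\<close> of \<open>k \<mapsto> P i j k\<close>, and
  similarly for the other slopes.
\<close>

lemma affine_sys_relabel:
  fixes s\<^sub>0 s\<^sub>1 s\<^sub>2 s\<^sub>3 t\<^sub>1 t\<^sub>2 t\<^sub>3 :: z3
  assumes "coherent e f g p q r"
    and s: "s\<^sub>0 \<noteq> 0" "s\<^sub>1 \<noteq> 0" "s\<^sub>2 \<noteq> 0" "s\<^sub>3 \<noteq> 0"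
  defines "e' \<equiv> \<lambda>i j. s\<^sub>0 * s\<^sub>3 * e (s\<^sub>1 * i + t\<^sub>1) (s\<^sub>2 * j + t\<^sub>2)"
    and "f' \<equiv> \<lambda>i k. s\<^sub>0 * s\<^sub>2 * f (s\<^sub>1 * i + t\<^sub>1) (s\<^sub>3 * k + t\<^sub>3)"
    and "g' \<equiv> \<lambda>j k. s\<^sub>0 * s\<^sub>1 * g (s\<^sub>2 * j + t\<^sub>2) (s\<^sub>3 * k + t\<^sub>3)"
  obtains p' q' r' where "coherent e' f' g' p' q' r'"
    and "ds_iso_sys (affine_sys e f p q) (affine_sys e' f' p' q')"
proof -
  define p' where "p' i j = s\<^sub>0 * (e (s\<^sub>1 * i + t\<^sub>1) (s\<^sub>2 * j + t\<^sub>2) * t\<^sub>3 + p (s\<^sub>1 * i + t\<^sub>1) (s\<^sub>2 * j + t\<^sub>2))" for i j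
  define q' where "q' i k = s\<^sub>0 * (f (s\<^sub>1 * i + t\<^sub>1) (s\<^sub>3 * k + t\<^sub>3) * t\<^sub>2 + q (s\<^sub>1 * i + t\<^sub>1) (s\<^sub>3 * k + t\<^sub>3))" for i k
  define r' where "r' j k = s\<^sub>0 * (g (s\<^sub>2 * j + t\<^sub>2) (s\<^sub>3 * k + t\<^sub>3) * t\<^sub>1 + r (s\<^sub>2 * j + t\<^sub>2) (s\<^sub>3 * k + t\<^sub>3))" for j k
  have P: "e' i j * k + p' i j = s\<^sub>0 * (e (s\<^sub>1 * i + t\<^sub>1) (s\<^sub>2 * j + t\<^sub>2) * (s\<^sub>3 * k + t\<^sub>3)
      + p (s\<^sub>1 * i + t\<^sub>1) (s\<^sub>2 * j + t\<^sub>2))" for i j k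
    by (simp add: e'_def p'_def algebra_simps)
  have Q: "f' i k * j + q' i k = s\<^sub>0 * (f (s\<^sub>1 * i + t\<^sub>1) (s\<^sub>3 * k + t\<^sub>3) * (s\<^sub>2 * j + t\<^sub>2)
      + q (s\<^sub>1 * i + t\<^sub>1) (s\<^sub>3 * k + t\<^sub>3))" for i j k
    by (simp add: f'_def q'_def algebra_simps)
  have R: "g' j k * i + r' j k = s\<^sub>0 * (g (s\<^sub>2 * j + t\<^sub>2) (s\<^sub>3 * k + t\<^sub>3) * (s\<^sub>1 * i + t\<^sub>1)
      + r (s\<^sub>2 * j + t\<^sub>2) (s\<^sub>3 * k + t\<^sub>3))" for i j k
    by (simp add: g'_def r'_def algebra_simps)
  have "coherent e' f' g' p' q' r'"
    unfolding coherent_def P Q R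
  proof (intro conjI allI)
    have nz: "e i j \<noteq> 0" "f i j \<noteq> 0" "g i j \<noteq> 0"
      and coh: "f i k * j + q i k = (e i j * k + p i j) + (g j k * i + r j k)" for i j k
      using assms(1) unfolding coherent_def by blast+
    show "e' i j \<noteq> 0" "f' i j \<noteq> 0" "g' i j \<noteq> 0" for i j
      by (simp_all add: e'_def f'_def g'_def sign_mult_eq_0 s nz)
    show "s\<^sub>0 * (f (s\<^sub>1 * i + t\<^sub>1) (s\<^sub>3 * k + t\<^sub>3) * (s\<^sub>2 * j + t\<^sub>2) + q (s\<^sub>1 * i + t\<^sub>1) (s\<^sub>3 * k + t\<^sub>3))
      = s\<^sub>0 * (e (s\<^sub>1 * i + t\<^sub>1) (s\<^sub>2 * j + t\<^sub>2) * (s\<^sub>3 * k + t\<^sub>3) + p (s\<^sub>1 * i + t\<^sub>1) (s\<^sub>2 * j + t\<^sub>2))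
      + s\<^sub>0 * (g (s\<^sub>2 * j + t\<^sub>2) (s\<^sub>3 * k + t\<^sub>3) * (s\<^sub>1 * i + t\<^sub>1) + r (s\<^sub>2 * j + t\<^sub>2) (s\<^sub>3 * k + t\<^sub>3))"
      for i j k by (simp only: coh distrib_left[of s\<^sub>0, symmetric])
  qed
  moreover have "ds_iso_sys (affine_sys e' f' p' q') (affine_sys e f p q)"
    unfolding ds_iso_sys_def
  proof (intro exI conjI allI)
    have "bij (\<lambda>i. s * i + t)" if "s \<noteq> 0" for s t :: z3
    proof -
      have "inj (\<lambda>i. s * i + t)"
      proof
        fix i j assume "s * i + t = s * j + t"
        then have "s * (s * i) = s * (s * j)" by simp
        then show "i = j" by (simp only: sign_mult_cancel[OF that])
      qed
      then show ?thesis by (simp add: bij_def finite_UNIV_inj_surj)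
    qed
    then show "blockwise (\<lambda>(i, x). (s\<^sub>1 * i + t\<^sub>1, s\<^sub>0 * x + 0))"
      "blockwise (\<lambda>(i, x). (s\<^sub>2 * i + t\<^sub>2, s\<^sub>0 * x + 0))"
      "blockwise (\<lambda>(i, x). (s\<^sub>3 * i + t\<^sub>3, s\<^sub>0 * x + 0))"
      by (rule blockwise_block_affine[where s = "\<lambda>_. s\<^sub>0" and t = "\<lambda>_. 0"]; simp add: s)+
    have *: "s\<^sub>0 * y = s\<^sub>0 * x + w \<longleftrightarrow> y = x + s\<^sub>0 * w" for x y w
      by (simp only: sign_mult_eq_iff[OF s(1)] distrib_left sign_mult_cancel[OF s(1)])
    show "affine_sys e f p q ((\<lambda>(i, x). (s\<^sub>1 * i + t\<^sub>1, s\<^sub>0 * x + 0)) X)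
       ((\<lambda>(i, x). (s\<^sub>2 * i + t\<^sub>2, s\<^sub>0 * x + 0)) Y) ((\<lambda>(i, x). (s\<^sub>3 * i + t\<^sub>3, s\<^sub>0 * x + 0)) Z)
       \<longleftrightarrow> affine_sys e' f' p' q' X Y Z" for X Y Z
      by (cases X; cases Y; cases Z)
        (simp only: affine_sys_def prod.case P Q * add_0_right)
  qed
  ultimately show thesis using that ds_iso_sys_sym by blast
qed

text \<open>
  Sign matrices get a representation of their own, so that they are small terms with decidable
  equality; \<open>P\<close> is \<open>+1 = Z1\<close> and \<open>M\<close> is \<open>-1 = Z2\<close>.
\<close>

datatype sign_row = PPP | PPM | PMP | PMM | MPP | MPM | MMP | MMM

fun row_entry :: "sign_row \<Rightarrow> z3 \<Rightarrow> z3" where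
  "row_entry PPP Z0 = Z1" | "row_entry PPP Z1 = Z1" | "row_entry PPP Z2 = Z1"
| "row_entry PPM Z0 = Z1" | "row_entry PPM Z1 = Z1" | "row_entry PPM Z2 = Z2"
| "row_entry PMP Z0 = Z1" | "row_entry PMP Z1 = Z2" | "row_entry PMP Z2 = Z1"
| "row_entry PMM Z0 = Z1" | "row_entry PMM Z1 = Z2" | "row_entry PMM Z2 = Z2"
| "row_entry MPP Z0 = Z2" | "row_entry MPP Z1 = Z1" | "row_entry MPP Z2 = Z1"
| "row_entry MPM Z0 = Z2" | "row_entry MPM Z1 = Z1" | "row_entry MPM Z2 = Z2"
| "row_entry MMP Z0 = Z2" | "row_entry MMP Z1 = Z2" | "row_entry MMP Z2 = Z1"
| "row_entry MMM Z0 = Z2" | "row_entry MMM Z1 = Z2" | "row_entry MMM Z2 = Z2"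

fun row_of :: "z3 \<Rightarrow> z3 \<Rightarrow> z3 \<Rightarrow> sign_row" where
  "row_of Z1 Z1 Z1 = PPP" | "row_of Z1 Z1 Z2 = PPM" | "row_of Z1 Z2 Z1 = PMP" | "row_of Z1 Z2 Z2 = PMM"
| "row_of Z2 Z1 Z1 = MPP" | "row_of Z2 Z1 Z2 = MPM" | "row_of Z2 Z2 Z1 = MMP" | "row_of Z2 Z2 Z2 = MMM"
| "row_of _ _ _ = PPP"

datatype sign_mat = Mat sign_row sign_row sign_row

fun entry :: "sign_mat \<Rightarrow> z3 \<Rightarrow> z3 \<Rightarrow> z3" where
  "entry (Mat a b c) Z0 j = row_entry a j" | "entry (Mat a b c) Z1 j = row_entry b j" | "entry (Mat a b c) Z2 j = row_entry c j"

definition mat_of :: "table \<Rightarrow> sign_mat" where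
  "mat_of t = Mat (row_of (t Z0 Z0) (t Z0 Z1) (t Z0 Z2))
    (row_of (t Z1 Z0) (t Z1 Z1) (t Z1 Z2)) (row_of (t Z2 Z0) (t Z2 Z1) (t Z2 Z2))"

lemma row_entry_row_of:
  assumes "a \<noteq> 0" "b \<noteq> 0" "c \<noteq> 0"
  shows "row_entry (row_of a b c) Z0 = a" "row_entry (row_of a b c) Z1 = b" "row_entry (row_of a b c) Z2 = c"
  using assms by (cases a; cases b; cases c; simp add: zero_z3_def)+

lemma entry_mat_of:
  assumes "\<And>i j. t i j \<noteq> 0"
  shows "entry (mat_of t) = t"
proof (intro ext)
  show "entry (mat_of t) i j = t i j" for i j
    by (cases i; cases j; simp add: mat_of_def row_entry_row_of assms)
qed

lemma entry_nonzero: "entry m i j \<noteq> 0"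
proof -
  have "row_entry r j \<noteq> 0" for r by (cases r; cases j; simp add: zero_z3_def)
  then show ?thesis by (cases m; cases i; simp)
qed

type_synonym signs = "sign_mat \<times> sign_mat \<times> sign_mat"

definition admissible_signs :: "signs \<Rightarrow> bool" where
  "admissible_signs = (\<lambda>(e, f, g). admissible (entry e) (entry f) (entry g))"

definition sys :: "signs \<Rightarrow> system" where
  "sys = (\<lambda>(e, f, g). affine_sys (entry e) (entry f) (canon_p (entry f) (entry g)) (canon_q (entry e) (entry g)))"

text \<open>
  Up to ds-isotopism a division sudoku is determined by its three sign matrices.
\<close>

lemma division_sys_classified:
  assumes "division_sys T"
  obtains s where "admissible_signs s" "ds_iso_sys T (sys s)"
  using assms
proof (rule division_sys_affine)
  fix e f g p q r
  assume *: "coherent e f g p q r" and T: "ds_iso_sys T (affine_sys e f p q)"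
  then have nz: "e i j \<noteq> 0" "f i j \<noteq> 0" "g i j \<noteq> 0" for i j
    unfolding coherent_def by blast+
  define s where "s = (mat_of e, mat_of f, mat_of g)"
  have "admissible_signs s" using coherent_imp_admissible[OF *] by (simp add: admissible_signs_def s_def entry_mat_of nz)
  moreover have "ds_iso_sys T (sys s)"
    using ds_iso_sys_trans[OF T coherent_unique_up_to_shift[OF *]] coherent_imp_admissible[OF *]
    by (simp add: sys_def s_def entry_mat_of nz admissible_def)
  ultimately show thesis by (rule that)
qed

text \<open>
  The action of a relabelling on a single sign matrix; the index maps are \<open>i \<mapsto> s1 * i + t1\<close> and
  \<open>j \<mapsto> s2 * j + t2\<close>.
\<close>

fun twist :: "z3 \<Rightarrow> z3 \<times> z3 \<Rightarrow> z3 \<times> z3 \<Rightarrow> sign_mat \<Rightarrow> sign_mat" where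
  "twist s (s1, t1) (s2, t2) m = mat_of (\<lambda>i j. s * entry m (s1 * i + t1) (s2 * j + t2))"

fun relabel :: "relabelling \<Rightarrow> signs \<Rightarrow> signs" where
  "relabel (s, (s1, t1), (s2, t2), (s3, t3)) (e, f, g) =
     (twist (s * s3) (s1, t1) (s2, t2) e, twist (s * s2) (s1, t1) (s3, t3) f,
      twist (s * s1) (s2, t2) (s3, t3) g)"

fun proper :: "relabelling \<Rightarrow> bool" where
  "proper (s, (s1, t1), (s2, t2), (s3, t3)) \<longleftrightarrow> s \<noteq> 0 \<and> s1 \<noteq> 0 \<and> s2 \<noteq> 0 \<and> s3 \<noteq> 0"

lemma relabel_ds_iso:
  assumes "admissible_signs s" and "proper h"
  shows "admissible_signs (relabel h s)" and "ds_iso_sys (sys s) (sys (relabel h s))"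
proof -
  obtain e f g where s: "s = (e, f, g)" by (cases s)
  obtain s0 s1 t1 s2 t2 s3 t3 where h: "h = (s0, (s1, t1), (s2, t2), (s3, t3))" by (metis surj_pair)
  have nz: "s0 \<noteq> 0" "s1 \<noteq> 0" "s2 \<noteq> 0" "s3 \<noteq> 0" using assms(2) by (simp_all add: h)
  let ?p = "canon_p (entry f) (entry g)" and ?q = "canon_q (entry e) (entry g)"
  define e' where "e' i j = s0 * s3 * entry e (s1 * i + t1) (s2 * j + t2)" for i j
  define f' where "f' i k = s0 * s2 * entry f (s1 * i + t1) (s3 * k + t3)" for i k
  define g' where "g' j k = s0 * s1 * entry g (s2 * j + t2) (s3 * k + t3)" for j k
  have "coherent (entry e) (entry f) (entry g) ?p ?q (canon_r (entry e) (entry f))"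
    using assms(1) by (simp add: admissible_signs_def admissible_def s)
  then obtain p' q' r' where c: "coherent e' f' g' p' q' r'"
    and i: "ds_iso_sys (sys s) (affine_sys e' f' p' q')"
    using affine_sys_relabel[OF _ nz, of "entry e" "entry f" "entry g" ?p ?q "canon_r (entry e) (entry f)" t1 t2 t3]
    unfolding e'_def f'_def g'_def sys_def s by auto
  have "e' i j \<noteq> 0" "f' i j \<noteq> 0" "g' i j \<noteq> 0" for i j
    using c unfolding coherent_def by blast+
  then have eq: "relabel h s = (mat_of e', mat_of f', mat_of g')" "entry (mat_of e') = e'"
    "entry (mat_of f') = f'" "entry (mat_of g') = g'"
    by (simp_all add: h s e'_def[abs_def] f'_def[abs_def] g'_def[abs_def] entry_mat_of)
  show "admissible_signs (relabel h s)"
    using coherent_imp_admissible[OF c] by (simp add: eq admissible_signs_def)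
  show "ds_iso_sys (sys s) (sys (relabel h s))"
    using ds_iso_sys_trans[OF i coherent_unique_up_to_shift[OF c]] coherent_imp_admissible[OF c]
    by (simp add: sys_def admissible_def eq)
qed

section \<open>Counts that are invariant under isotopism\<close>

text \<open>
  Cells \<open>(a, y)\<close> and \<open>(d, v)\<close> share a symbol, and so do \<open>(b, y)\<close> and \<open>(a, v)\<close>.
\<close>

definition linked :: "system \<Rightarrow> point \<Rightarrow> point \<Rightarrow> point \<Rightarrow> point \<Rightarrow> bool" where
  "linked T a b y d \<longleftrightarrow> (\<exists>v s t. T a y t \<and> T b y s \<and> T a v s \<and> T d v t)"

definition weight :: "(point \<Rightarrow> point \<Rightarrow> bool) \<Rightarrow> system \<Rightarrow> point \<Rightarrow> nat" where
  "weight R T a = (\<Sum>b\<in>UNIV. if R a b then \<Sum>d\<in>UNIV. card {y. linked T a b y d} ^ 4 else 0)"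

text \<open>
  The relation \<open>R\<close> restricts the pairs \<open>(a, b)\<close>: all pairs give an isotopism invariant, pairs in a common
  block an invariant of ds-isotopism. The fourth power is used because lower powers separate fewer of the
  squares below.
\<close>

definition energy :: "(point \<Rightarrow> point \<Rightarrow> bool) \<Rightarrow> system \<Rightarrow> nat" where
  "energy R T = (\<Sum>a\<in>UNIV. weight R T a)"

abbreviation anyrel :: "point \<Rightarrow> point \<Rightarrow> bool" where "anyrel a b \<equiv> True"
abbreviation sameblock :: "point \<Rightarrow> point \<Rightarrow> bool" where "sameblock a b \<equiv> fst a = fst b"

text \<open>
  In a latin square this is the graph of the permutation of the columns that carries row \<open>b\<close> to row \<open>a\<close>.
\<close>

definition shift :: "system \<Rightarrow> point \<Rightarrow> point \<Rightarrow> point \<Rightarrow> point \<Rightarrow> bool" where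
  "shift T a b y v \<longleftrightarrow> (\<exists>s. T b y s \<and> T a v s)"

text \<open>
  The number of rows \<open>b\<close> for which the cycle of this permutation through \<open>y\<close> has a length dividing \<open>m\<close>.
\<close>

definition recur :: "nat \<Rightarrow> system \<Rightarrow> point \<Rightarrow> point \<Rightarrow> nat" where
  "recur m T a y = card {b. (shift T a b ^^ m) y y}"

text \<open>
  Squaring only one of the two factors makes the sum distinguish rows from columns. For \<open>m = 5\<close> the
  symmetric product takes the same value on the two squares that it has to separate.
\<close>

definition twisted_recur :: "nat \<Rightarrow> system \<Rightarrow> point \<Rightarrow> nat" where
  "twisted_recur m T a = (\<Sum>y\<in>UNIV. recur m T a y ^ 2 * recur m (conj_yx T) y a)"

definition chirality :: "nat \<Rightarrow> system \<Rightarrow> nat" where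
  "chirality m T = (\<Sum>a\<in>UNIV. twisted_recur m T a)"

lemma sum_bij: "bij \<alpha> \<Longrightarrow> (\<Sum>x\<in>UNIV. f (\<alpha> x)) = (\<Sum>x\<in>UNIV. f x)"
  by (rule sum.reindex_bij_betw) simp

lemma card_bij:
  assumes "bij \<beta>"
  shows "card {y. P (\<beta> y)} = card {y. P y}"
proof -
  have "\<beta> ` (\<beta> -` {y. P y}) = {y. P y}"
    by (rule surj_image_vimage_eq[OF bij_is_surj[OF assms]])
  moreover have "card (\<beta> ` (\<beta> -` {y. P y})) = card (\<beta> -` {y. P y})"
    by (rule card_image) (rule inj_on_subset[OF bij_is_inj[OF assms] subset_UNIV])
  ultimately show ?thesis by (simp add: vimage_def)
qed

lemma bij_obtain:
  assumes "bij \<beta>"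
  obtains y where "x = \<beta> y"
  using bij_is_surj[OF assms] by (rule surjE)

lemma linked_iso:
  assumes "bij \<alpha>" "bij \<beta>" "bij \<gamma>" and T: "\<And>x y z. T (\<alpha> x) (\<beta> y) (\<gamma> z) = S x y z"
  shows "linked T (\<alpha> a) (\<alpha> b) (\<beta> y) (\<alpha> d) = linked S a b y d"
proof
  assume "linked T (\<alpha> a) (\<alpha> b) (\<beta> y) (\<alpha> d)"
  then obtain v s t where *: "T (\<alpha> a) (\<beta> y) t" "T (\<alpha> b) (\<beta> y) s" "T (\<alpha> a) v s" "T (\<alpha> d) v t"
    unfolding linked_def by blast
  obtain v' where v': "v = \<beta> v'" by (rule bij_obtain[OF assms(2)])
  obtain s' where s': "s = \<gamma> s'" by (rule bij_obtain[OF assms(3)])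
  obtain t' where t': "t = \<gamma> t'" by (rule bij_obtain[OF assms(3)])
  have "S a y t'" "S b y s'" "S a v' s'" "S d v' t'"
    using * by (simp_all only: v' s' t' T)
  then show "linked S a b y d" unfolding linked_def by blast
next
  assume "linked S a b y d"
  then obtain v s t where "S a y t" "S b y s" "S a v s" "S d v t"
    unfolding linked_def by blast
  then have "T (\<alpha> a) (\<beta> y) (\<gamma> t)" "T (\<alpha> b) (\<beta> y) (\<gamma> s)" "T (\<alpha> a) (\<beta> v) (\<gamma> s)" "T (\<alpha> d) (\<beta> v) (\<gamma> t)"
    by (simp_all only: T)
  then show "linked T (\<alpha> a) (\<alpha> b) (\<beta> y) (\<alpha> d)" unfolding linked_def by blast
qed

lemma weight_iso:
  assumes "bij \<alpha>" "bij \<beta>" "bij \<gamma>" and T: "\<And>x y z. T (\<alpha> x) (\<beta> y) (\<gamma> z) = S x y z"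
    and R: "\<And>a b. R (\<alpha> a) (\<alpha> b) = R a b"
  shows "weight R T (\<alpha> a) = weight R S a"
proof -
  have "card {y. linked T (\<alpha> a) (\<alpha> b) y (\<alpha> d)} = card {y. linked S a b y d}" for b d
    using card_bij[OF assms(2), of "\<lambda>y. linked T (\<alpha> a) (\<alpha> b) y (\<alpha> d)"]
    by (simp only: linked_iso[OF assms(1-3), where T = T and S = S, OF T])
  then have "(\<Sum>d\<in>UNIV. card {y. linked T (\<alpha> a) (\<alpha> b) y d} ^ 4)
      = (\<Sum>d\<in>UNIV. card {y. linked S a b y d} ^ 4)" for b
    using sum_bij[OF assms(1), of "\<lambda>d. card {y. linked T (\<alpha> a) (\<alpha> b) y d} ^ 4"] by simp
  then show ?thesis
    unfolding weight_def
    using sum_bij[OF assms(1), of "\<lambda>b. if R (\<alpha> a) b then \<Sum>d\<in>UNIV. card {y. linked T (\<alpha> a) b y d} ^ 4 else 0"]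
    by (simp only: R)
qed

lemma energy_iso:
  assumes "bij \<alpha>" "bij \<beta>" "bij \<gamma>" and "\<And>x y z. T (\<alpha> x) (\<beta> y) (\<gamma> z) = S x y z"
    and "\<And>a b. R (\<alpha> a) (\<alpha> b) = R a b"
  shows "energy R T = energy R S"
  using sum_bij[OF assms(1), of "weight R T"]
  by (simp only: energy_def weight_iso[OF assms(1-3), where T = T and S = S and R = R, OF assms(4,5)])

lemma recur_iso:
  assumes "bij \<alpha>" "bij \<beta>" "bij \<gamma>" and T: "\<And>x y z. T (\<alpha> x) (\<beta> y) (\<gamma> z) = S x y z"
  shows "recur m T (\<alpha> a) (\<beta> y) = recur m S a y"
proof -
  have s: "shift T (\<alpha> a) (\<alpha> b) (\<beta> y) (\<beta> v) = shift S a b y v" for b y v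
    unfolding shift_def using bij_obtain[OF assms(3)] T by metis
  have "(shift T (\<alpha> a) (\<alpha> b) ^^ m) (\<beta> y) (\<beta> v) = (shift S a b ^^ m) y v" for b v
  proof (induction m arbitrary: v)
    case 0
    then show ?case using assms(2) by (simp add: bij_def inj_eq)
  next
    case (Suc m)
    show ?case
    proof
      assume "(shift T (\<alpha> a) (\<alpha> b) ^^ Suc m) (\<beta> y) (\<beta> v)"
      then obtain u where u: "(shift T (\<alpha> a) (\<alpha> b) ^^ m) (\<beta> y) u" "shift T (\<alpha> a) (\<alpha> b) u (\<beta> v)"
        by auto
      obtain u' where "u = \<beta> u'" by (rule bij_obtain[OF assms(2)])
      with u have "(shift S a b ^^ m) y u'" "shift S a b u' v"
        by (simp_all only: Suc s)
      then show "(shift S a b ^^ Suc m) y v" by auto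
    next
      assume "(shift S a b ^^ Suc m) y v"
      then obtain u where "(shift S a b ^^ m) y u" "shift S a b u v" by auto
      then have "(shift T (\<alpha> a) (\<alpha> b) ^^ m) (\<beta> y) (\<beta> u)" "shift T (\<alpha> a) (\<alpha> b) (\<beta> u) (\<beta> v)"
        by (simp_all only: Suc s)
      then show "(shift T (\<alpha> a) (\<alpha> b) ^^ Suc m) (\<beta> y) (\<beta> v)" by auto
    qed
  qed
  then show ?thesis
    using card_bij[OF assms(1), of "\<lambda>b. (shift T (\<alpha> a) b ^^ m) (\<beta> y) (\<beta> y)"]
    by (simp only: recur_def)
qed

lemma twisted_recur_iso:
  assumes "bij \<alpha>" "bij \<beta>" "bij \<gamma>" and T: "\<And>x y z. T (\<alpha> x) (\<beta> y) (\<gamma> z) = S x y z"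
  shows "twisted_recur m T (\<alpha> a) = twisted_recur m S a"
proof -
  have "recur m (conj_yx T) (\<beta> y) (\<alpha> a) = recur m (conj_yx S) y a" for y
    by (rule recur_iso[OF assms(2,1,3)]) (simp add: conj_yx_def T)
  then show ?thesis
    unfolding twisted_recur_def
    using sum_bij[OF assms(2), of "\<lambda>y. recur m T (\<alpha> a) y ^ 2 * recur m (conj_yx T) y (\<alpha> a)"]
    by (simp only: recur_iso[OF assms(1-3), where T = T and S = S, OF T])
qed

lemma chirality_iso:
  assumes "bij \<alpha>" "bij \<beta>" "bij \<gamma>" and "\<And>x y z. T (\<alpha> x) (\<beta> y) (\<gamma> z) = S x y z"
  shows "chirality m T = chirality m S"
  unfolding chirality_def
  using sum_bij[OF assms(1), of "twisted_recur m T"]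
  by (simp only: twisted_recur_iso[OF assms(1-3), where T = T and S = S, OF assms(4)])

text \<open>
  The same count for rows, columns and symbols.
\<close>

definition energies :: "system \<Rightarrow> nat \<times> nat \<times> nat" where
  "energies T = (energy anyrel T, energy anyrel (conj_yx T), energy anyrel (conj_zy T))"

definition block_energies :: "system \<Rightarrow> nat \<times> nat \<times> nat" where
  "block_energies T = (energy sameblock T, energy sameblock (conj_yx T), energy sameblock (conj_zy T))"

lemma energies_invariant:
  assumes "iso_sys S T"
  shows "energies S = energies T"
proof -
  obtain \<alpha> \<beta> \<gamma> where *: "bij \<alpha>" "bij \<beta>" "bij \<gamma>"
    and T: "\<And>x y z. T (\<alpha> x) (\<beta> y) (\<gamma> z) = S x y z"
    using assms unfolding iso_sys_def by blast
  have "energy anyrel T = energy anyrel S"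
    by (rule energy_iso[OF *]) (simp_all only: T)
  moreover have "energy anyrel (conj_yx T) = energy anyrel (conj_yx S)"
    by (rule energy_iso[OF *(2,1,3)]) (simp_all only: conj_yx_def T)
  moreover have "energy anyrel (conj_zy T) = energy anyrel (conj_zy S)"
    by (rule energy_iso[OF *(3,2,1)]) (simp_all only: conj_zy_def T)
  ultimately show ?thesis by (simp only: energies_def)
qed

lemma chirality_invariant:
  assumes "iso_sys S T"
  shows "chirality m S = chirality m T"
proof -
  obtain \<alpha> \<beta> \<gamma> where *: "bij \<alpha>" "bij \<beta>" "bij \<gamma>"
    and T: "\<And>x y z. T (\<alpha> x) (\<beta> y) (\<gamma> z) = S x y z"
    using assms unfolding iso_sys_def by blast
  show ?thesis by (rule chirality_iso[OF *, where T = T and S = S, OF T, symmetric])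
qed

lemma block_energies_invariant:
  assumes "ds_iso_sys S T"
  shows "block_energies S = block_energies T"
proof -
  obtain \<alpha> \<beta> \<gamma> where "blockwise \<alpha>" "blockwise \<beta>" "blockwise \<gamma>"
    and T: "\<And>x y z. T (\<alpha> x) (\<beta> y) (\<gamma> z) = S x y z"
    using assms unfolding ds_iso_sys_def by blast
  then have *: "bij \<alpha>" "bij \<beta>" "bij \<gamma>"
    and R: "sameblock (\<alpha> a) (\<alpha> b) = sameblock a b" "sameblock (\<beta> a) (\<beta> b) = sameblock a b"
      "sameblock (\<gamma> a) (\<gamma> b) = sameblock a b" for a b
    unfolding blockwise_def by blast+
  have "energy sameblock T = energy sameblock S"
    by (rule energy_iso[OF *]) (simp_all only: T R)
  moreover have "energy sameblock (conj_yx T) = energy sameblock (conj_yx S)"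
    by (rule energy_iso[OF *(2,1,3)]) (simp_all only: conj_yx_def T R)
  moreover have "energy sameblock (conj_zy T) = energy sameblock (conj_zy S)"
    by (rule energy_iso[OF *(3,2,1)]) (simp_all only: conj_zy_def T R)
  ultimately show ?thesis by (simp only: block_energies_def)
qed

section \<open>Formulas for the invariants of affine systems\<close>

text \<open>
  The functions compute the symbol, the column and the row of a triple from its other two entries.
\<close>

definition solved_by ::
  "system \<Rightarrow> (point \<Rightarrow> point \<Rightarrow> point) \<Rightarrow> (point \<Rightarrow> point \<Rightarrow> point) \<Rightarrow> (point \<Rightarrow> point \<Rightarrow> point) \<Rightarrow> bool"
where
  "solved_by T l r c \<longleftrightarrow>
     (\<forall>x y z. (T x y z \<longleftrightarrow> z = l x y) \<and> (T x y z \<longleftrightarrow> y = r x z) \<and> (T x y z \<longleftrightarrow> x = c y z))"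

definition swap_args :: "('a \<Rightarrow> 'b \<Rightarrow> 'c) \<Rightarrow> 'b \<Rightarrow> 'a \<Rightarrow> 'c" where
  "swap_args f x y = f y x"

lemma solved_by_conj:
  assumes "solved_by T l r c"
  shows "solved_by (conj_yx T) (swap_args l) c r"
    and "solved_by (conj_zy T) (swap_args c) (swap_args r) (swap_args l)"
  using assms unfolding solved_by_def conj_yx_def conj_zy_def swap_args_def by blast+

text \<open>
  With \<open>v = r a (l b y)\<close>, the row in column \<open>v\<close> that contains the symbol of cell \<open>(a, y)\<close>.
\<close>

definition link ::
  "(point \<Rightarrow> point \<Rightarrow> point) \<Rightarrow> (point \<Rightarrow> point \<Rightarrow> point) \<Rightarrow> (point \<Rightarrow> point \<Rightarrow> point) \<Rightarrow> point \<Rightarrow> point \<Rightarrow> point \<Rightarrow> point"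
where
  "link l r c a b y = c (r a (l b y)) (l a y)"

lemma linked_iff_link:
  assumes "solved_by T l r c"
  shows "linked T a b y d \<longleftrightarrow> link l r c a b y = d"
proof -
  have 1: "T x y z \<longleftrightarrow> z = l x y" for x y z using assms unfolding solved_by_def by blast
  have 2: "z = l x y \<longleftrightarrow> y = r x z" for x y z using assms unfolding solved_by_def by blast
  have 3: "z = l x y \<longleftrightarrow> x = c y z" for x y z using assms unfolding solved_by_def by blast
  have "linked T a b y d \<longleftrightarrow> (\<exists>v. v = r a (l b y) \<and> d = c v (l a y))"
    unfolding linked_def 1 2[symmetric] 3[symmetric] by blast
  then show ?thesis unfolding link_def by auto
qed

definition point_list :: "point list" where
  "point_list = [(Z0, Z0), (Z0, Z1), (Z0, Z2), (Z1, Z0), (Z1, Z1), (Z1, Z2), (Z2, Z0), (Z2, Z1), (Z2, Z2)]"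

lemma sum_z3: "(\<Sum>x\<in>UNIV. f x) = f Z0 + (f Z1 + f Z2)"
  by (simp add: UNIV_z3)

lemma sum_point: "(\<Sum>d\<in>UNIV. f d) = f (Z0, Z0) + (f (Z0, Z1) + f (Z0, Z2)) +
    (f (Z1, Z0) + (f (Z1, Z1) + f (Z1, Z2)) + (f (Z2, Z0) + (f (Z2, Z1) + f (Z2, Z2))))"
  for f :: "point \<Rightarrow> nat"
proof -
  have "(\<Sum>d\<in>UNIV. f d) = (\<Sum>i\<in>UNIV. \<Sum>x\<in>UNIV. f (i, x))"
    by (simp add: sum.cartesian_product flip: UNIV_Times_UNIV)
  then show ?thesis by (simp add: sum_z3)
qed

text \<open>
  One slot for each point: an array of counters, and also a table of values of a map on points.
\<close>

datatype 'a grid = Grid 'a 'a 'a 'a 'a 'a 'a 'a 'a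

fun slot :: "'a grid \<Rightarrow> point \<Rightarrow> 'a" where
  "slot (Grid a b c d e f g h i) (Z0, Z0) = a"
| "slot (Grid a b c d e f g h i) (Z0, Z1) = b"
| "slot (Grid a b c d e f g h i) (Z0, Z2) = c"
| "slot (Grid a b c d e f g h i) (Z1, Z0) = d"
| "slot (Grid a b c d e f g h i) (Z1, Z1) = e"
| "slot (Grid a b c d e f g h i) (Z1, Z2) = f"
| "slot (Grid a b c d e f g h i) (Z2, Z0) = g"
| "slot (Grid a b c d e f g h i) (Z2, Z1) = h"
| "slot (Grid a b c d e f g h i) (Z2, Z2) = i"

fun bump :: "point \<Rightarrow> nat grid \<Rightarrow> nat grid" where
  "bump (Z0, Z0) (Grid a b c d e f g h i) = Grid (Suc a) b c d e f g h i"
| "bump (Z0, Z1) (Grid a b c d e f g h i) = Grid a (Suc b) c d e f g h i"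
| "bump (Z0, Z2) (Grid a b c d e f g h i) = Grid a b (Suc c) d e f g h i"
| "bump (Z1, Z0) (Grid a b c d e f g h i) = Grid a b c (Suc d) e f g h i"
| "bump (Z1, Z1) (Grid a b c d e f g h i) = Grid a b c d (Suc e) f g h i"
| "bump (Z1, Z2) (Grid a b c d e f g h i) = Grid a b c d e (Suc f) g h i"
| "bump (Z2, Z0) (Grid a b c d e f g h i) = Grid a b c d e f (Suc g) h i"
| "bump (Z2, Z1) (Grid a b c d e f g h i) = Grid a b c d e f g (Suc h) i"
| "bump (Z2, Z2) (Grid a b c d e f g h i) = Grid a b c d e f g h (Suc i)"

definition pow4 :: "nat \<Rightarrow> nat" where "pow4 n = n ^ 4"

text \<open>
  No count exceeds nine, the number of columns. Counters are unary, so that incrementing one is a single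
  rewrite step.
\<close>

lemma pow4_simps:
  "pow4 0 = 0" "pow4 (Suc 0) = 1" "pow4 (Suc (Suc 0)) = 16" "pow4 (Suc (Suc (Suc 0))) = 81"
  "pow4 (Suc (Suc (Suc (Suc 0)))) = 256" "pow4 (Suc (Suc (Suc (Suc (Suc 0))))) = 625"
  "pow4 (Suc (Suc (Suc (Suc (Suc (Suc 0)))))) = 1296"
  "pow4 (Suc (Suc (Suc (Suc (Suc (Suc (Suc 0))))))) = 2401"
  "pow4 (Suc (Suc (Suc (Suc (Suc (Suc (Suc (Suc 0)))))))) = 4096"
  "pow4 (Suc (Suc (Suc (Suc (Suc (Suc (Suc (Suc (Suc 0))))))))) = 6561"
  by (simp_all add: pow4_def power4_eq_xxxx)

fun total :: "nat grid \<Rightarrow> nat" where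
  "total (Grid a b c d e f g h i) = pow4 a + (pow4 b + pow4 c) +
    (pow4 d + (pow4 e + pow4 f) + (pow4 g + (pow4 h + pow4 i)))"

fun fill :: "point list \<Rightarrow> nat grid" where
  "fill [] = Grid 0 0 0 0 0 0 0 0 0"
| "fill (y # ys) = bump y (fill ys)"

lemma slot_bump: "slot (bump y g) d = slot g d + (if y = d then 1 else 0)"
proof -
  obtain i x j z where "y = (i, x)" "d = (j, z)" by (metis surj_pair)
  then show ?thesis by (cases g; cases i; cases x; cases j; cases z; simp)
qed

lemma slot_fill: "slot (fill ys) d = count_list ys d"
proof (induction ys)
  case Nil
  obtain i x where "d = (i, x)" by (metis surj_pair)
  then show ?case by (cases i; cases x; simp)
qed (simp add: slot_bump)

text \<open>
  The number of \<open>y\<close> with a given value of \<open>D\<close> is the counter of that value after all values have been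
  entered.
\<close>

lemma total_fill:
  "total (fill (map D point_list)) = (\<Sum>d\<in>UNIV. card {y. D y = d} ^ 4)"
proof -
  have "total g = (\<Sum>d\<in>UNIV. slot g d ^ 4)" for g
    by (cases g) (simp add: sum_point pow4_def)
  moreover have "card {y. D y = d} = (\<Sum>y\<in>UNIV. if D y = d then 1 else 0)" for d
    by (simp add: sum.If_cases)
  then have "card {y. D y = d} = count_list (map D point_list) d" for d
    by (simp add: sum_point point_list_def)
  ultimately show ?thesis by (simp add: slot_fill)
qed

definition row_value where
  "row_value l r c a b = total (fill (map (link l r c a b) point_list))"

definition row_sum where
  "row_sum l r c a = row_value l r c a (Z0, Z0) + (row_value l r c a (Z0, Z1) + row_value l r c a (Z0, Z2)) +
     (row_value l r c a (Z1, Z0) + (row_value l r c a (Z1, Z1) + row_value l r c a (Z1, Z2)) +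
     (row_value l r c a (Z2, Z0) + (row_value l r c a (Z2, Z1) + row_value l r c a (Z2, Z2))))"

definition grand_sum where
  "grand_sum l r c = 3 * (row_sum l r c (Z0, Z0) + (row_sum l r c (Z1, Z0) + row_sum l r c (Z2, Z0)))"

definition block_sum where
  "block_sum l r c i = row_value l r c (i, Z0) (i, Z0) +
     (row_value l r c (i, Z0) (i, Z1) + row_value l r c (i, Z0) (i, Z2))"

definition grand_block_sum where
  "grand_block_sum l r c = 3 * (block_sum l r c Z0 + (block_sum l r c Z1 + block_sum l r c Z2))"

text \<open>
  Moving all positions by one is an autotopism of every affine system. It cuts the number of rows that
  need to be examined by three.
\<close>

definition translation :: "point \<Rightarrow> point" where
  "translation = (\<lambda>(i, x). (i, x + Z1))"

lemma bij_translation: "bij translation"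
proof -
  have "inj translation" by (auto simp: translation_def inj_def)
  then show ?thesis by (simp add: bij_def finite_UNIV_inj_surj)
qed

definition translation_invariant :: "system \<Rightarrow> bool" where
  "translation_invariant T \<longleftrightarrow>
     (\<forall>x y z. T (translation x) (translation y) (translation z) = T x y z)"

lemma energy_transversal:
  assumes "translation_invariant T" and R: "\<And>a b. R (translation a) (translation b) = R a b"
  shows "energy R T = 3 * (weight R T (Z0, Z0) + (weight R T (Z1, Z0) + weight R T (Z2, Z0)))"
proof -
  have *: "weight R T (translation a) = weight R T a" for a
    using assms(1) by (intro weight_iso[OF bij_translation bij_translation bij_translation] R)
      (simp add: translation_invariant_def del: split_paired_All)
  have "weight R T (i, Z1) = weight R T (i, Z0)" "weight R T (i, Z2) = weight R T (i, Z1)" for i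
    using *[of "(i, Z0)"] *[of "(i, Z1)"] by (simp_all add: translation_def)
  then show ?thesis by (simp add: energy_def sum_point)
qed

lemma weight_eq_row_values:
  assumes "solved_by T l r c"
  shows "weight R T a = (\<Sum>b\<in>UNIV. if R a b then row_value l r c a b else 0)"
  unfolding weight_def row_value_def total_fill linked_iff_link[OF assms] ..

lemma energy_eq_grand_sum:
  assumes "translation_invariant T" and "solved_by T l r c"
  shows "energy anyrel T = grand_sum l r c"
  by (simp add: energy_transversal[OF assms(1)] weight_eq_row_values[OF assms(2)] sum_point
      grand_sum_def row_sum_def)

lemma energy_eq_grand_block_sum:
  assumes "translation_invariant T" and "solved_by T l r c"
  shows "energy sameblock T = grand_block_sum l r c"
proof -
  have "sameblock (translation a) (translation b) = sameblock a b" for a b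
    by (simp add: translation_def split: prod.splits)
  then show ?thesis
    by (simp add: energy_transversal[OF assms(1)] weight_eq_row_values[OF assms(2)] sum_point
        grand_block_sum_def block_sum_def)
qed

text \<open>
  Solving \<open>y = x + (e i j * k + p i j)\<close> for the pile \<open>k\<close>, and similarly for the stack and the band; a
  sign is its own inverse.
\<close>

definition symbol_at :: "table \<Rightarrow> table \<Rightarrow> table \<Rightarrow> table \<Rightarrow> point \<Rightarrow> point \<Rightarrow> point" where
  "symbol_at e f p q = (\<lambda>(i, x) (j, y). let k = e i j * ((y - x) - p i j) in (k, x + (f i k * j + q i k)))"

definition column_at :: "table \<Rightarrow> table \<Rightarrow> table \<Rightarrow> table \<Rightarrow> point \<Rightarrow> point \<Rightarrow> point" where
  "column_at e f p q = (\<lambda>(i, x) (k, z). let j = f i k * ((z - x) - q i k) in (j, x + (e i j * k + p i j)))"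

definition row_at :: "table \<Rightarrow> table \<Rightarrow> table \<Rightarrow> table \<Rightarrow> point \<Rightarrow> point \<Rightarrow> point" where
  "row_at e g p r = (\<lambda>(j, y) (k, z). let i = g j k * ((z - y) - r j k) in (i, y - (e i j * k + p i j)))"

lemma solved_by_affine_sys:
  assumes "coherent e f g p q r"
  shows "solved_by (affine_sys e f p q) (symbol_at e f p q) (column_at e f p q) (row_at e g p r)"
proof -
  have nz: "e i j \<noteq> 0" "f i j \<noteq> 0" "g i j \<noteq> 0"
    and coh: "f i k * j + q i k = (e i j * k + p i j) + (g j k * i + r j k)" for i j k
    using assms unfolding coherent_def by blast+
  have solve: "u = v + (s * w + t) \<longleftrightarrow> w = s * ((u - v) - t)" if "s \<noteq> 0" for s t u v w :: z3
    using sign_mult_eq_iff[OF that, of w "(u - v) - t"] by (auto simp: algebra_simps)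
  have "(affine_sys e f p q (i, x) (j, y) (k, z) \<longleftrightarrow> (k, z) = symbol_at e f p q (i, x) (j, y))
    \<and> (affine_sys e f p q (i, x) (j, y) (k, z) \<longleftrightarrow> (j, y) = column_at e f p q (i, x) (k, z))
    \<and> (affine_sys e f p q (i, x) (j, y) (k, z) \<longleftrightarrow> (i, x) = row_at e g p r (j, y) (k, z))" for i x j y k z
  proof (intro conjI)
    show "affine_sys e f p q (i, x) (j, y) (k, z) \<longleftrightarrow> (k, z) = symbol_at e f p q (i, x) (j, y)"
      unfolding affine_sys_def symbol_at_def Let_def prod.case solve[OF nz(1)] by auto
    show "affine_sys e f p q (i, x) (j, y) (k, z) \<longleftrightarrow> (j, y) = column_at e f p q (i, x) (k, z)"
      unfolding affine_sys_def column_at_def Let_def prod.case solve[OF nz(2)] by auto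
    have "affine_sys e f p q (i, x) (j, y) (k, z)
      \<longleftrightarrow> y = x + (e i j * k + p i j) \<and> z = y + (g j k * i + r j k)"
      unfolding affine_sys_def prod.case coh by (auto simp: algebra_simps)
    also have "\<dots> \<longleftrightarrow> i = g j k * ((z - y) - r j k) \<and> x = y - (e i j * k + p i j)"
      unfolding solve[OF nz(3)] by (auto simp: algebra_simps)
    also have "\<dots> \<longleftrightarrow> (i, x) = row_at e g p r (j, y) (k, z)"
      unfolding row_at_def Let_def prod.case by auto
    finally show "affine_sys e f p q (i, x) (j, y) (k, z) \<longleftrightarrow> (i, x) = row_at e g p r (j, y) (k, z)" .
  qed
  then show ?thesis unfolding solved_by_def by (metis surj_pair)
qed

lemma translation_invariant_affine_sys:
  "translation_invariant (affine_sys e f p q)"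
  unfolding translation_invariant_def translation_def affine_sys_def by (auto simp: algebra_simps)

lemma translation_invariant_conj:
  assumes "translation_invariant T"
  shows "translation_invariant (conj_yx T)" and "translation_invariant (conj_zy T)"
  using assms unfolding translation_invariant_def conj_yx_def conj_zy_def by blast+

section \<open>Evaluation of the invariants\<close>

fun walk ::
  "nat \<Rightarrow> (point \<Rightarrow> point \<Rightarrow> point) \<Rightarrow> (point \<Rightarrow> point \<Rightarrow> point) \<Rightarrow> point \<Rightarrow> point \<Rightarrow> point \<Rightarrow> point"
where
  "walk 0 l r a b v = v"
| "walk (Suc m) l r a b v = walk m l r a b (r a (l b v))"

definition return_indicator where
  "return_indicator m l r a y b = (if walk m l r a b y = y then 1 else 0 :: nat)"

definition recur_value where
  "recur_value m l r a y = return_indicator m l r a y (Z0, Z0) + (return_indicator m l r a y (Z0, Z1) + return_indicator m l r a y (Z0, Z2)) +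
     (return_indicator m l r a y (Z1, Z0) + (return_indicator m l r a y (Z1, Z1) + return_indicator m l r a y (Z1, Z2)) +
     (return_indicator m l r a y (Z2, Z0) + (return_indicator m l r a y (Z2, Z1) + return_indicator m l r a y (Z2, Z2))))"

definition cell_value where
  "cell_value m l r c a y =
     recur_value m l r a y * (recur_value m l r a y * recur_value m (swap_args l) c y a)"

definition chirality_row where
  "chirality_row m l r c a = cell_value m l r c a (Z0, Z0) +
       (cell_value m l r c a (Z0, Z1) + cell_value m l r c a (Z0, Z2)) +
     (cell_value m l r c a (Z1, Z0) + (cell_value m l r c a (Z1, Z1) + cell_value m l r c a (Z1, Z2)) +
     (cell_value m l r c a (Z2, Z0) + (cell_value m l r c a (Z2, Z1) + cell_value m l r c a (Z2, Z2))))"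

definition chirality_value where
  "chirality_value m l r c =
     3 * (chirality_row m l r c (Z0, Z0) + (chirality_row m l r c (Z1, Z0) + chirality_row m l r c (Z2, Z0)))"

lemma recur_eq_recur_value:
  assumes "solved_by T l r c"
  shows "recur m T a y = recur_value m l r a y"
proof -
  have 1: "T x y z \<longleftrightarrow> z = l x y" for x y z using assms unfolding solved_by_def by blast
  have 2: "z = l x y \<longleftrightarrow> y = r x z" for x y z using assms unfolding solved_by_def by blast
  have s: "shift T a b u v \<longleftrightarrow> v = r a (l b u)" for b u v
    unfolding shift_def 1 2[symmetric] by blast
  have "(shift T a b ^^ m) u v \<longleftrightarrow> walk m l r a b u = v" for b u v
  proof (induction m arbitrary: u)
    case (Suc m)
    have "(shift T a b ^^ Suc m) u v \<longleftrightarrow> (\<exists>w. shift T a b u w \<and> (shift T a b ^^ m) w v)"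
      by (metis relpowp_Suc_D2 relpowp_Suc_I2)
    also have "\<dots> \<longleftrightarrow> (\<exists>w. w = r a (l b u) \<and> walk m l r a b w = v)"
      by (simp only: s Suc)
    finally show ?case by simp
  qed simp
  moreover have "card {b. P b} = (\<Sum>b\<in>UNIV. if P b then 1 else 0)" for P :: "point \<Rightarrow> bool"
    by (simp add: sum.If_cases)
  ultimately show ?thesis
    by (simp only: recur_def sum_point recur_value_def return_indicator_def)
qed

lemma chirality_eq_chirality_value:
  assumes "translation_invariant T" and "solved_by T l r c"
  shows "chirality m T = chirality_value m l r c"
proof -
  have *: "twisted_recur m T (translation a) = twisted_recur m T a" for a
    using assms(1) by (intro twisted_recur_iso[OF bij_translation bij_translation bij_translation])
      (simp add: translation_invariant_def del: split_paired_All)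
  have "twisted_recur m T (i, Z1) = twisted_recur m T (i, Z0)"
    "twisted_recur m T (i, Z2) = twisted_recur m T (i, Z1)" for i
    using *[of "(i, Z0)"] *[of "(i, Z1)"] by (simp_all add: translation_def)
  moreover have "twisted_recur m T a = chirality_row m l r c a" for a
    by (simp add: twisted_recur_def recur_eq_recur_value[OF assms(2)]
        recur_eq_recur_value[OF solved_by_conj(1)[OF assms(2)]] sum_point
        chirality_row_def cell_value_def power2_eq_square mult.assoc)
  ultimately show ?thesis by (simp add: chirality_def sum_point chirality_value_def)
qed

text \<open>
  The energies fail to separate two groups of squares that are not isotopic; the cycle counts for
  \<open>m = 3\<close> and \<open>m = 5\<close> do. Restricting them to these groups avoids evaluating them elsewhere.
\<close>

definition key :: "system \<Rightarrow> (nat \<times> nat \<times> nat) \<times> nat" where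
  "key T = (energies T,
     if energies T = (190269, 190269, 190269) then chirality 3 T
     else if energies T = (73581, 73581, 73581) then chirality 5 T
     else 0)"

lemma key_invariant: "iso_sys S T \<Longrightarrow> key S = key T"
  by (simp add: key_def energies_invariant[of S T] chirality_invariant[of S T])

definition energy_values where
  "energy_values e f g p q r =
    (grand_sum (symbol_at e f p q) (column_at e f p q) (row_at e g p r),
     grand_sum (swap_args (symbol_at e f p q)) (row_at e g p r) (column_at e f p q),
     grand_sum (swap_args (row_at e g p r)) (swap_args (column_at e f p q)) (swap_args (symbol_at e f p q)))"

definition block_energy_values where
  "block_energy_values e f g p q r =
    (grand_block_sum (symbol_at e f p q) (column_at e f p q) (row_at e g p r),
     grand_block_sum (swap_args (symbol_at e f p q)) (row_at e g p r) (column_at e f p q),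
     grand_block_sum (swap_args (row_at e g p r)) (swap_args (column_at e f p q)) (swap_args (symbol_at e f p q)))"

text \<open>
  A separate function, so that the energies \<open>v\<close> are numerals by the time the conditions are evaluated.
\<close>

definition append_chirality where
  "append_chirality v e f g p q r = (v,
     if v = (190269, 190269, 190269) then chirality_value 3 (symbol_at e f p q) (column_at e f p q) (row_at e g p r)
     else if v = (73581, 73581, 73581) then chirality_value 5 (symbol_at e f p q) (column_at e f p q) (row_at e g p r)
     else 0)"

definition key_value where
  "key_value e f g p q r = append_chirality (energy_values e f g p q r) e f g p q r"

text \<open>
  Reading a table from equations about an opaque function \<open>t\<close> keeps the terms to be rewritten small,
  whereas the matrices themselves would be copied into every step.
\<close>

definition listed :: "table \<Rightarrow> table \<Rightarrow> bool" where
  "listed t u \<longleftrightarrow> t Z0 Z0 = u Z0 Z0 \<and> t Z0 Z1 = u Z0 Z1 \<and> t Z0 Z2 = u Z0 Z2 \<and>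
     t Z1 Z0 = u Z1 Z0 \<and> t Z1 Z1 = u Z1 Z1 \<and> t Z1 Z2 = u Z1 Z2 \<and>
     t Z2 Z0 = u Z2 Z0 \<and> t Z2 Z1 = u Z2 Z1 \<and> t Z2 Z2 = u Z2 Z2"

definition tabulated where
  "tabulated e f g p q r E F G \<longleftrightarrow> listed e (entry E) \<and> listed f (entry F) \<and> listed g (entry G) \<and>
     listed p (canon_p (entry F) (entry G)) \<and> listed q (canon_q (entry E) (entry G)) \<and>
     listed r (canon_r (entry E) (entry F))"

lemma tabulated_refl:
  "tabulated (entry E) (entry F) (entry G) (canon_p (entry F) (entry G)) (canon_q (entry E) (entry G))
     (canon_r (entry E) (entry F)) E F G"
  by (simp add: tabulated_def listed_def)

lemma values_of_sys:
  assumes "admissible_signs (E, F, G)"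
  defines "p \<equiv> canon_p (entry F) (entry G)" and "q \<equiv> canon_q (entry E) (entry G)" and "r \<equiv> canon_r (entry E) (entry F)"
  shows "key (sys (E, F, G)) = key_value (entry E) (entry F) (entry G) p q r"
    and "block_energies (sys (E, F, G)) = block_energy_values (entry E) (entry F) (entry G) p q r"
proof -
  let ?T = "sys (E, F, G)"
  have s: "solved_by ?T (symbol_at (entry E) (entry F) p q) (column_at (entry E) (entry F) p q) (row_at (entry E) (entry G) p r)"
    using solved_by_affine_sys assms(1)
    by (simp add: sys_def admissible_signs_def admissible_def p_def q_def r_def)
  have t: "translation_invariant ?T"
    by (simp add: sys_def translation_invariant_affine_sys)
  have en: "energies ?T = energy_values (entry E) (entry F) (entry G) p q r"
    unfolding energies_def energy_values_def energy_eq_grand_sum[OF t s]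
      energy_eq_grand_sum[OF translation_invariant_conj(1)[OF t] solved_by_conj(1)[OF s]]
      energy_eq_grand_sum[OF translation_invariant_conj(2)[OF t] solved_by_conj(2)[OF s]] ..
  show "key ?T = key_value (entry E) (entry F) (entry G) p q r"
    unfolding key_def key_value_def append_chirality_def en chirality_eq_chirality_value[OF t s] ..
  show "block_energies ?T = block_energy_values (entry E) (entry F) (entry G) p q r"
    unfolding block_energies_def block_energy_values_def energy_eq_grand_block_sum[OF t s]
      energy_eq_grand_block_sum[OF translation_invariant_conj(1)[OF t] solved_by_conj(1)[OF s]]
      energy_eq_grand_block_sum[OF translation_invariant_conj(2)[OF t] solved_by_conj(2)[OF s]] ..
qed

text \<open>
  Reduces an evaluation to a goal in which the six tables are variables and their values are premises.
\<close>

lemma key_sysI: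
  assumes "admissible_signs (E, F, G)"
    and "\<And>e f g p q r. tabulated e f g p q r E F G \<Longrightarrow> key_value e f g p q r = v"
  shows "key (sys (E, F, G)) = v"
  unfolding values_of_sys(1)[OF assms(1)] by (rule assms(2)) (rule tabulated_refl)

lemma block_energies_sysI:
  assumes "admissible_signs (E, F, G)"
    and "\<And>e f g p q r. tabulated e f g p q r E F G \<Longrightarrow> block_energy_values e f g p q r = v"
  shows "block_energies (sys (E, F, G)) = v"
  unfolding values_of_sys(2)[OF assms(1)] by (rule assms(2)) (rule tabulated_refl)

text \<open>
  The mixed second difference, which annihilates functions of one index and thereby the intercepts.
\<close>

definition mixed_diff :: "table \<Rightarrow> z3 \<Rightarrow> z3 \<Rightarrow> z3" where
  "mixed_diff t i j = (t i j - t Z0 j) - (t i Z0 - t Z0 Z0)"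

text \<open>
  Taking mixed differences eliminates the intercepts from the coherence equation and leaves a linear
  condition on the signs.
\<close>

lemma admissible_signs_iff:
  "admissible_signs (E, F, G) \<longleftrightarrow>
     (\<forall>i j k. mixed_diff (entry F) i k * j = mixed_diff (entry E) i j * k + mixed_diff (entry G) j k * i)"
proof -
  have "entry F i k * j + canon_q (entry E) (entry G) i k =
      (entry E i j * k + canon_p (entry F) (entry G) i j) + (entry G j k * i + canon_r (entry E) (entry F) j k)
    \<longleftrightarrow> mixed_diff (entry F) i k * j = mixed_diff (entry E) i j * k + mixed_diff (entry G) j k * i" for i j k
  proof -
    have "(entry F i k * j + canon_q (entry E) (entry G) i k)
      - ((entry E i j * k + canon_p (entry F) (entry G) i j) + (entry G j k * i + canon_r (entry E) (entry F) j k))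
      = mixed_diff (entry F) i k * j - (mixed_diff (entry E) i j * k + mixed_diff (entry G) j k * i)"
      unfolding mixed_diff_def canon_p_def canon_q_def canon_r_def zero_z3_def[symmetric]
      by (simp add: algebra_simps)
    then show ?thesis by (metis right_minus_eq)
  qed
  then show ?thesis
    by (simp add: admissible_signs_def admissible_def coherent_def entry_nonzero)
qed

lemma mixed_diff_Z0: "mixed_diff t Z0 j = Z0" "mixed_diff t i Z0 = Z0"
  by (simp_all add: mixed_diff_def zero_z3_def)

text \<open>
  If one of the indices is \<open>Z0\<close>, both sides of the condition vanish.
\<close>

lemma admissible_signs_check:
  "admissible_signs (E, F, G) \<longleftrightarrow>
     mixed_diff (entry F) Z1 Z1 * Z1 = mixed_diff (entry E) Z1 Z1 * Z1 + mixed_diff (entry G) Z1 Z1 * Z1 \<and>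
     mixed_diff (entry F) Z1 Z2 * Z1 = mixed_diff (entry E) Z1 Z1 * Z2 + mixed_diff (entry G) Z1 Z2 * Z1 \<and>
     mixed_diff (entry F) Z1 Z1 * Z2 = mixed_diff (entry E) Z1 Z2 * Z1 + mixed_diff (entry G) Z2 Z1 * Z1 \<and>
     mixed_diff (entry F) Z1 Z2 * Z2 = mixed_diff (entry E) Z1 Z2 * Z2 + mixed_diff (entry G) Z2 Z2 * Z1 \<and>
     mixed_diff (entry F) Z2 Z1 * Z1 = mixed_diff (entry E) Z2 Z1 * Z1 + mixed_diff (entry G) Z1 Z1 * Z2 \<and>
     mixed_diff (entry F) Z2 Z2 * Z1 = mixed_diff (entry E) Z2 Z1 * Z2 + mixed_diff (entry G) Z1 Z2 * Z2 \<and>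
     mixed_diff (entry F) Z2 Z1 * Z2 = mixed_diff (entry E) Z2 Z2 * Z1 + mixed_diff (entry G) Z2 Z1 * Z2 \<and>
     mixed_diff (entry F) Z2 Z2 * Z2 = mixed_diff (entry E) Z2 Z2 * Z2 + mixed_diff (entry G) Z2 Z2 * Z2"
  unfolding admissible_signs_iff all_z3
  by (simp add: mixed_diff_Z0 mult_zero_left[where ?'a = z3, unfolded zero_z3_def]
      mult_zero_right[where ?'a = z3, unfolded zero_z3_def] add_0_left[where ?'a = z3, unfolded zero_z3_def]
      add_0_right[where ?'a = z3, unfolded zero_z3_def])

section \<open>The representatives\<close>

text \<open>
  A first matrix \<open>e\<close> together with the second matrices \<open>f\<close>, each with its list of third matrices \<open>g\<close>.
  The entries are orbit representatives at each of the three stages.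
\<close>

type_synonym branch = "sign_mat \<times> (sign_mat \<times> sign_mat list) list"

definition branch1 :: branch where
  "branch1 = (Mat PPP PPP PPP, [
    (Mat PPP PPP PPP,
      [Mat PPP PPP MMM, Mat PPM PPM PPM, Mat PPP PPP PPP]),
    (Mat PPP PPP MMM,
      [Mat PPP PPP PPP, Mat PPP PPP MMM, Mat PPM PPM PPM]),
    (Mat PPM PPM PPM,
      [Mat PPP PPP PPP, Mat PPP PPP MMM, Mat PPM PPM PPM, Mat PMP PMP PMP]),
    (Mat PPP PPM MMP,
      [Mat PPP PPM MMP]),
    (Mat PPM PMP MPP,
      [Mat PPM PMP MPP, Mat PMM MPM MMP])])"

definition branch2 :: branch where
  "branch2 = (Mat PPP PPP MMM, [
    (Mat PPP PPP PPP,
      [Mat PPP PPP PPP, Mat PPP PPP MMM, Mat PPM PPM PPM]),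
    (Mat PPP PPP MMM,
      [Mat PPP PPP PPP, Mat PPP PPP MMM, Mat PPM PPM PPM]),
    (Mat PPP PPM MMP,
      [Mat PPP PPM MMP]),
    (Mat PPP PMM MPP,
      [Mat PPP PMM MPP]),
    (Mat PPP MMM PPP,
      [Mat PPP PPP PPP, Mat PPP PPP MMM, Mat PPM PPM PPM]),
    (Mat PPM PPM PPM,
      [Mat PPP PPP PPP, Mat PPP PPP MMM, Mat PPM PPM PPM, Mat PMP PMP PMP]),
    (Mat PPM PMP MPP,
      [Mat PPM PMP MPP, Mat PMM MPM MMP]),
    (Mat PPM MMP PPP,
      [Mat PPP PPM MMP])])"

definition branch3 :: branch where
  "branch3 = (Mat PPM PPM PPM, [
    (Mat PPP PPP PPP,
      [Mat PPP PPP PPP, Mat PPP PPP MMM, Mat PPP MMM PPP, Mat PPM PPM PPM]),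
    (Mat PPP PPP MMM,
      [Mat PPP PPP PPP, Mat PPP PPP MMM, Mat PPP MMM PPP, Mat PPM PPM PPM]),
    (Mat PPP PPM MMP,
      [Mat PPP PPM MMP, Mat PPM MMP PPP, Mat MMP PPP PPM]),
    (Mat PPM PPM PPM,
      [Mat PPP PPP PPP, Mat PPP PPP MMM, Mat PPP MMM PPP, Mat PPM PPM PPM, Mat PMP PMP PMP]),
    (Mat PPM PMP MPP,
      [Mat PPM PMP MPP, Mat PMM MPM MMP])])"

definition branch4 :: branch where
  "branch4 = (Mat PPP PPM PMM, [
    (Mat PPP PPM PMM,
      [Mat PPP PPM MPM, Mat PMP PMM PPP, Mat PMP PMM MMM, Mat MMP PPP MPP, Mat MMP MMM MPP,
       Mat MMM PPM MPM]),
    (Mat PPP PMM PPM,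
      [Mat PPP PMM PMP, Mat MPP PPP MMP, Mat MPP MMM MMP, Mat MPM PPM PPP, Mat MPM PPM MMM,
       Mat MMM PMM PMP]),
    (Mat PPM PPP PMM,
      [Mat PPP MMP MPP, Mat PPM PPP MPM, Mat PPM MMM MPM, Mat PMM PMP PPP, Mat PMM PMP MMM,
       Mat MMM MMP MPP]),
    (Mat PPM PPM PMP,
      [Mat PPM PPM MPP, Mat PMP PMP PPM, Mat PMM PMM MMP, Mat MPP MPP PMP, Mat MPM MPM PMM,
       Mat MMP MMP MPM]),
    (Mat PPM PMP PPM,
      [Mat PPM PMP PMP, Mat PMP MPP MPP, Mat PMM MPM MPM, Mat MPP PPM PPM, Mat MPM MMP MMP,
       Mat MMP PMM PMM]),
    (Mat PPM PMM PPP,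
      [Mat PPP PMP PMM, Mat MPP MMP PPP, Mat MPP MMP MMM, Mat MPM PPP PPM, Mat MPM MMM PPM,
       Mat MMM PMP PMM]),
    (Mat PPM PMM MMM,
      [Mat PPP PMP PMM, Mat MPP MMP PPP, Mat MPP MMP MMM, Mat MPM PPP PPM, Mat MPM MMM PPM,
       Mat MMM PMP PMM]),
    (Mat PPM MPP MPP,
      [Mat PPM MPP PPM, Mat PMP PPM PMP, Mat PMM MMP PMM, Mat MPP PMP MPP, Mat MPM PMM MPM,
       Mat MMP MPM MMP]),
    (Mat PPM MMM PMM,
      [Mat PPP MMP MPP, Mat PPM PPP MPM, Mat PPM MMM MPM, Mat PMM PMP PPP, Mat PMM PMP MMM,
       Mat MMM MMP MPP])])"

definition branch5 :: branch where
  "branch5 = (Mat PPP PPM MMP, [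
    (Mat PPP PPP PPP,
      [Mat PPM PPM MPP]),
    (Mat PPP PPP MMM,
      [Mat PPM PPM MPP]),
    (Mat PPP PPM MMP,
      [Mat PPP PPM MPM, Mat PMP PMM PPP, Mat MMP PPP MPP]),
    (Mat PPP PMM MPP,
      [Mat PPP PMM PMP, Mat MPP PPP MMP, Mat MPM PPM PPP]),
    (Mat PPP MMM PPP,
      [Mat PPM PPM MPP]),
    (Mat PPP MMM MMM,
      [Mat PPM PPM MPP]),
    (Mat PPM PPP MMP,
      [Mat PPP MMP MPP, Mat PPM PPP MPM, Mat PMM PMP PPP]),
    (Mat PPM PPM PPM,
      [Mat PPM PPM MPP, Mat PMP PMP PPM, Mat MPP MPP PMP]),
    (Mat PPM PMP MPP,
      [Mat PPM PMP PMP, Mat PMP MPP MPP, Mat PMM MPM MPM, Mat MPP PPM PPM, Mat MPM MMP MMP,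
       Mat MMP PMM PMM]),
    (Mat PPM MMP PPP,
      [Mat PPP PPM MPM, Mat PMP PMM PPP, Mat MMP PPP MPP]),
    (Mat PPM MMP MMM,
      [Mat PPP PPM MPM, Mat PMP PMM PPP, Mat MMP PPP MPP]),
    (Mat PPM MMM MMP,
      [Mat PPP MMP MPP, Mat PPM PPP MPM, Mat PMM PMP PPP])])"

definition branch6 :: branch where
  "branch6 = (Mat PPM PPM PMP, [
    (Mat PPP PPM PMM,
      [Mat PPP PPM MMP, Mat PPM MMP PPP, Mat PPM MMP MMM, Mat MMP PPP PPM, Mat MMP MMM PPM,
       Mat MMM PPM MMP]),
    (Mat PPP PMM PPM,
      [Mat PPP PMM MPP, Mat PMM MPP PPP, Mat PMM MPP MMM, Mat MPP PPP PMM, Mat MPP MMM PMM,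
       Mat MMM PMM MPP]),
    (Mat PPM PPM PMP,
      [Mat PPP PPP PPP, Mat PPP PPP MMM, Mat PPP MMM PPP, Mat PPP MMM MMM, Mat PPM PPM PPM,
       Mat PMP PMP PMP, Mat PMM PMM PMM]),
    (Mat PPM PMP PPM,
      [Mat PPM PMP MPP, Mat PMP MPP PPM, Mat PMM MPM MMP, Mat MPP PPM PMP, Mat MPM MMP PMM,
       Mat MMP PMM MPM]),
    (Mat PPM PMM PPP,
      [Mat PPP PMP MPM, Mat PMP MPM PPP, Mat PMP MPM MMM, Mat MPM PPP PMP, Mat MPM MMM PMP,
       Mat MMM PMP MPM])])"

definition branch7 :: branch where
  "branch7 = (Mat PPM PMP MPP, [
    (Mat PPP PPP PPP,
      [Mat PPM MPP PMP, Mat PMM MMP MPM]),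
    (Mat PPP PPP MMM,
      [Mat PPM MPP PMP, Mat PMM MMP MPM]),
    (Mat PPP PPM MMP,
      [Mat PPP MPP PMM, Mat PMM PPP MPP, Mat PMM MMM MPP, Mat MPP PMM PPP, Mat MPP PMM MMM,
       Mat MMM MPP PMM]),
    (Mat PPM PPM PPM,
      [Mat PPM MPP PMP, Mat PMM MMP MPM]),
    (Mat PPM PMP MPP,
      [Mat PPP PPP PPP, Mat PPP PPP MMM, Mat PPP MMM MMM, Mat PPM PPM PPM, Mat PMM PMM PMM,
       Mat MMM MMM MMM]),
    (Mat PPM MPP PMP,
      [Mat PPM PMP MPP, Mat PMP MPP PPM, Mat PMM MPM MMP])])"

fun signs_of_branch :: "branch \<Rightarrow> signs list" where
  "signs_of_branch (e, brs) = concat (map (\<lambda>(f, gs). map (\<lambda>g. (e, f, g)) gs) brs)"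

definition tree :: "branch list" where
  "tree = [branch1, branch2, branch3, branch4, branch5, branch6, branch7]"

text \<open>
  The sign matrices of the six named squares.
\<close>

definition signs18 :: signs where "signs18 = (Mat PPP PPP PPP, Mat PPP PPP MMM, Mat PPP PPP PPP)"
definition signs19 :: signs where "signs19 = (Mat PPP PPP MMM, Mat PPP PPP PPP, Mat PPP PPP PPP)"
definition signs21 :: signs where "signs21 = (Mat PPP PPP PPP, Mat PPP PPP PPP, Mat PPP PPP MMM)"
definition signs60 :: signs where "signs60 = (Mat PPM PPM PPM, Mat PPP PPP PPP, Mat PPP PPP PPP)"
definition signs33 :: signs where "signs33 = (Mat PPP PPP PPP, Mat PPP PPP PPP, Mat PPM PPM PPM)"
definition signs117 :: signs where "signs117 = (Mat PPP PPP PPP, Mat PPM PPM PPM, Mat PPP PPP PPP)"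

text \<open>
  Of each exceptional pair one member is set aside.
\<close>

definition principal :: "signs \<Rightarrow> bool" where
  "principal s \<longleftrightarrow> s \<noteq> signs19 \<and> s \<noteq> signs60 \<and> s \<noteq> signs117"

section \<open>The keys of the representatives\<close>

text \<open>
  These functions take the computed block index as a last argument, so that it is evaluated before it is
  used several times.
\<close>

definition column_at_stack where "column_at_stack e p i x k j = (j, x + (e i j * k + p i j))"
definition symbol_at_pile where "symbol_at_pile f q i x j k = (k, x + (f i k * j + q i k))"
definition row_at_band where "row_at_band e p j y k i = (i, y - (e i j * k + p i j))"

lemma symbol_at_step: "symbol_at e f p q (i, x) (j, y) = symbol_at_pile f q i x j (e i j * ((y - x) - p i j))"
  by (simp add: symbol_at_def symbol_at_pile_def Let_def)

lemma column_at_step: "column_at e f p q (i, x) (k, z) = column_at_stack e p i x k (f i k * ((z - x) - q i k))"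
  by (simp add: column_at_def column_at_stack_def Let_def)

lemma row_at_step: "row_at e g p r (j, y) (k, z) = row_at_band e p j y k (g j k * ((z - y) - r j k))"
  by (simp add: row_at_def row_at_band_def Let_def)

lemma canon_z3:
  "canon_p f g i j = (f i Z0 - f Z0 Z0) * j + (g Z0 Z0 - g j Z0) * i"
  "canon_q e g i k = (e i Z0 - e Z0 Z0) * k + g Z0 k * i"
  "canon_r e f j k = f Z0 k * j - e Z0 j * k"
  by (simp_all add: canon_p_def canon_q_def canon_r_def zero_z3_def)

lemma row_value_unfold:
  "row_value l r c a b = total (fill [link l r c a b (Z0, Z0), link l r c a b (Z0, Z1), link l r c a b (Z0, Z2),
     link l r c a b (Z1, Z0), link l r c a b (Z1, Z1), link l r c a b (Z1, Z2),
     link l r c a b (Z2, Z0), link l r c a b (Z2, Z1), link l r c a b (Z2, Z2)])"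
  by (simp add: row_value_def point_list_def)

lemma walk_numeral:
  "walk 3 l r a b v = r a (l b (r a (l b (r a (l b v)))))"
  "walk 5 l r a b v = r a (l b (r a (l b (r a (l b (r a (l b (r a (l b v)))))))))"
  by (simp_all add: numeral_eq_Suc)

lemmas nat_arith = numeral_plus_numeral numeral_plus_one one_plus_numeral one_add_one
  add_0_left add_0_right add_num_simps numeral_times_numeral mult_num_simps
  mult_1_left mult_1_right mult_zero_left mult_zero_right numeral_eq_iff eq_num_simps

lemmas decide_rules = prod.inject z3.distinct simp_thms if_True if_False

lemmas table_rules = tabulated_def listed_def canon_z3 entry.simps row_entry.simps z3_arith

lemmas step_rules = symbol_at_step column_at_step row_at_step symbol_at_pile_def column_at_stack_def row_at_band_def swap_args_def z3_arith

lemmas energy_rules = key_value_def energy_values_def grand_sum_def row_sum_def row_value_unfold link_def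
  fill.simps bump.simps total.simps pow4_simps append_chirality_def

lemmas block_energy_rules = block_energy_values_def grand_block_sum_def block_sum_def row_value_unfold
  link_def fill.simps bump.simps total.simps pow4_simps

lemmas chirality_rules = chirality_value_def chirality_row_def cell_value_def
  recur_value_def return_indicator_def walk_numeral

lemmas admissible_rules = admissible_signs_check mixed_diff_def entry.simps row_entry.simps z3_arith simp_thms

lemmas branch_rules = branch1_def branch2_def branch3_def branch4_def branch5_def branch6_def branch7_def
  signs_of_branch.simps concat.simps append.simps list.map prod.case filter.simps
  principal_def signs18_def signs19_def signs21_def signs33_def signs60_def signs117_def
  prod.inject sign_mat.inject sign_row.distinct simp_thms if_True if_False

text \<open>
  The list equation splits into one goal for each representative; \<open>key_sysI\<close> then leaves its admissibility
  and the evaluation with the tables as premises.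
\<close>

lemma keys_branch1:
  "map (key \<circ> sys) (filter principal (signs_of_branch branch1)) = [
    ((344817, 303993, 344817), 0), ((344817, 344817, 303993), 0), ((531441, 531441, 531441), 0),
    ((303993, 344817, 344817), 0), ((269001, 269001, 305649), 0), ((201465, 199089, 141669), 0),
    ((199089, 201465, 141669), 0), ((190269, 190269, 190269), 2187), ((231093, 231093, 190269), 0),
    ((120009, 120009, 89409), 0), ((68805, 70209, 69453), 0), ((70209, 68805, 69453), 0)]"
  by (simp only: branch_rules comp_apply list.inject cong: if_weak_cong)
    (intro conjI TrueI refl key_sysI; (simp only: admissible_rules)?;
    (simp only: table_rules energy_rules step_rules chirality_rules nat_arith decide_rules cong: if_weak_cong)?)

lemma keys_branch2:
  "map (key \<circ> sys) (filter principal (signs_of_branch branch2)) = [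
    ((201465, 141669, 199089), 0), ((269001, 305649, 269001), 0), ((190269, 190269, 190269), 19683),
    ((196929, 128061, 187389), 0), ((196929, 187389, 128061), 0), ((115653, 78357, 75861), 0),
    ((109725, 78321, 77781), 0), ((190269, 231093, 231093), 0), ((198333, 117369, 190017), 0),
    ((198333, 190017, 117369), 0), ((141669, 199089, 201465), 0), ((73581, 73581, 73581), 2727),
    ((128061, 187389, 196929), 0), ((117369, 190017, 198333), 0), ((81477, 73653, 73521), 0),
    ((82905, 72165, 73221), 0), ((122793, 86961, 85461), 0)]"
  by (simp only: branch_rules comp_apply list.inject cong: if_weak_cong)
    (intro conjI TrueI refl key_sysI; (simp only: admissible_rules)?;
    (simp only: table_rules energy_rules step_rules chirality_rules nat_arith decide_rules cong: if_weak_cong)?)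

lemma keys_branch3:
  "map (key \<circ> sys) (filter principal (signs_of_branch branch3)) = [
    ((190269, 190269, 190269), 6561), ((231093, 190269, 231093), 0), ((199089, 141669, 201465), 0),
    ((141669, 201465, 199089), 0), ((128061, 196929, 187389), 0), ((117369, 198333, 190017), 0),
    ((73581, 73581, 73581), 2691), ((78357, 115653, 75861), 0), ((86961, 122793, 85461), 0),
    ((78321, 109725, 77781), 0), ((305649, 269001, 269001), 0), ((187389, 196929, 128061), 0),
    ((190017, 198333, 117369), 0), ((187389, 128061, 196929), 0), ((190017, 117369, 198333), 0),
    ((72165, 82905, 73221), 0), ((73653, 81477, 73521), 0)]"
  by (simp only: branch_rules comp_apply list.inject cong: if_weak_cong)
    (intro conjI TrueI refl key_sysI; (simp only: admissible_rules)?;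
    (simp only: table_rules energy_rules step_rules chirality_rules nat_arith decide_rules cong: if_weak_cong)?)

lemma keys_branch4:
  "map (key \<circ> sys) (filter principal (signs_of_branch branch4)) = [
    ((114729, 114729, 91221), 0), ((116625, 93417, 118149), 0), ((106581, 75993, 78777), 0),
    ((106581, 78777, 75993), 0), ((114729, 91221, 114729), 0), ((116625, 118149, 93417), 0),
    ((129189, 129189, 129189), 0), ((106641, 81333, 80397), 0), ((118149, 93417, 116625), 0),
    ((106641, 80397, 81333), 0), ((106089, 82425, 82425), 0), ((118149, 116625, 93417), 0),
    ((81333, 106641, 80397), 0), ((68121, 68121, 68121), 0), ((68145, 67329, 70053), 0),
    ((81333, 80397, 106641), 0), ((68145, 70053, 67329), 0), ((91221, 114729, 114729), 0),
    ((69297, 69297, 86517), 0), ((83481, 83481, 110781), 0), ((69333, 72357, 77553), 0),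
    ((72357, 72357, 71493), 0), ((72357, 69333, 77553), 0), ((80505, 80505, 109977), 0),
    ((88701, 82749, 115269), 0), ((68913, 67653, 71133), 0), ((76401, 67821, 76461), 0),
    ((74673, 68037, 83205), 0), ((88317, 80337, 111429), 0), ((67569, 67785, 85041), 0),
    ((93417, 116625, 118149), 0), ((67245, 67245, 65517), 0), ((78777, 75993, 106581), 0),
    ((67329, 70053, 68145), 0), ((70053, 68145, 67329), 0), ((82425, 106089, 82425), 0),
    ((75993, 106581, 78777), 0), ((75993, 78777, 106581), 0), ((66717, 66717, 66717), 0),
    ((65517, 67245, 67245), 0), ((80397, 81333, 106641), 0), ((80397, 106641, 81333), 0),
    ((82749, 88701, 115269), 0), ((67653, 68913, 71133), 0), ((80337, 88317, 111429), 0),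
    ((68037, 74673, 83205), 0), ((67821, 76401, 76461), 0), ((67785, 67569, 85041), 0),
    ((93417, 118149, 116625), 0), ((67329, 68145, 70053), 0), ((82425, 82425, 106089), 0),
    ((67245, 65517, 67245), 0), ((70053, 67329, 68145), 0), ((78777, 106581, 75993), 0)]"
  by (simp only: branch_rules comp_apply list.inject cong: if_weak_cong)
    (intro conjI TrueI refl key_sysI; (simp only: admissible_rules)?;
    (simp only: table_rules energy_rules step_rules chirality_rules nat_arith decide_rules cong: if_weak_cong)?)

lemma keys_branch5:
  "map (key \<circ> sys) (filter principal (signs_of_branch branch5)) = [
    ((120009, 89409, 120009), 0), ((115653, 75861, 78357), 0), ((109977, 80505, 80505), 0),
    ((111429, 80337, 88317), 0), ((111429, 88317, 80337), 0), ((115269, 88701, 82749), 0),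
    ((110781, 83481, 83481), 0), ((115269, 82749, 88701), 0), ((109725, 77781, 78321), 0),
    ((122793, 85461, 86961), 0), ((83205, 74673, 68037), 0), ((86517, 69297, 69297), 0),
    ((83205, 68037, 74673), 0), ((78357, 75861, 115653), 0), ((78321, 77781, 109725), 0),
    ((86961, 85461, 122793), 0), ((85125, 74781, 78921), 0), ((83229, 74925, 83229), 0),
    ((84405, 75525, 84405), 0), ((78921, 74781, 85125), 0), ((86001, 72993, 86001), 0),
    ((77997, 73161, 77997), 0), ((77553, 72357, 69333), 0), ((85041, 67785, 67569), 0),
    ((76461, 76401, 67821), 0), ((71493, 72357, 72357), 0), ((71133, 67653, 68913), 0),
    ((71133, 68913, 67653), 0), ((85041, 67569, 67785), 0), ((77553, 69333, 72357), 0),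
    ((76461, 67821, 76401), 0)]"
  by (simp only: branch_rules comp_apply list.inject cong: if_weak_cong)
    (intro conjI TrueI refl key_sysI; (simp only: admissible_rules)?;
    (simp only: table_rules energy_rules step_rules chirality_rules nat_arith decide_rules cong: if_weak_cong)?)

lemma keys_branch6:
  "map (key \<circ> sys) (filter principal (signs_of_branch branch6)) = [
    ((80505, 109977, 80505), 0), ((72357, 77553, 69333), 0), ((72357, 71493, 72357), 0),
    ((69333, 77553, 72357), 0), ((69297, 86517, 69297), 0), ((83481, 110781, 83481), 0),
    ((88701, 115269, 82749), 0), ((68913, 71133, 67653), 0), ((76401, 76461, 67821), 0),
    ((74673, 83205, 68037), 0), ((67569, 85041, 67785), 0), ((88317, 111429, 80337), 0),
    ((89409, 120009, 120009), 0), ((75861, 115653, 78357), 0), ((77781, 109725, 78321), 0),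
    ((85461, 122793, 86961), 0), ((75861, 78357, 115653), 0), ((77781, 78321, 109725), 0),
    ((85461, 86961, 122793), 0), ((72993, 86001, 86001), 0), ((73161, 77997, 77997), 0),
    ((74925, 83229, 83229), 0), ((75525, 84405, 84405), 0), ((74781, 85125, 78921), 0),
    ((74781, 78921, 85125), 0), ((80337, 111429, 88317), 0), ((67785, 85041, 67569), 0),
    ((67653, 71133, 68913), 0), ((67821, 76461, 76401), 0), ((68037, 83205, 74673), 0),
    ((82749, 115269, 88701), 0)]"
  by (simp only: branch_rules comp_apply list.inject cong: if_weak_cong)
    (intro conjI TrueI refl key_sysI; (simp only: admissible_rules)?;
    (simp only: table_rules energy_rules step_rules chirality_rules nat_arith decide_rules cong: if_weak_cong)?)

lemma keys_branch7:
  "map (key \<circ> sys) (filter principal (signs_of_branch branch7)) = [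
    ((70209, 69453, 68805), 0), ((68805, 69453, 70209), 0), ((82905, 73221, 72165), 0),
    ((81477, 73521, 73653), 0), ((86001, 86001, 72993), 0), ((77997, 77997, 73161), 0),
    ((78921, 85125, 74781), 0), ((84405, 84405, 75525), 0), ((83229, 83229, 74925), 0),
    ((85125, 78921, 74781), 0), ((73653, 73521, 81477), 0), ((72165, 73221, 82905), 0),
    ((69453, 70209, 68805), 0), ((73221, 82905, 72165), 0), ((73521, 81477, 73653), 0),
    ((73521, 73653, 81477), 0), ((73221, 72165, 82905), 0), ((69453, 68805, 70209), 0),
    ((74817, 74817, 74817), 0), ((77841, 77841, 77841), 0), ((75453, 75453, 75453), 0)]"
  by (simp only: branch_rules comp_apply list.inject cong: if_weak_cong)
    (intro conjI TrueI refl key_sysI; (simp only: admissible_rules)?;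
    (simp only: table_rules energy_rules step_rules chirality_rules nat_arith decide_rules cong: if_weak_cong)?)

text \<open>
  The three coordinates count within bands, within stacks and within piles.
\<close>

lemma block_energies_exceptional:
  "block_energies (sys signs18) = (177147, 177147, 83835)"
  "block_energies (sys signs19) = (177147, 83835, 177147)"
  "block_energies (sys signs21) = (177147, 177147, 83835)"
  "block_energies (sys signs60) = (83835, 177147, 177147)"
  "block_energies (sys signs33) = (177147, 83835, 177147)"
  "block_energies (sys signs117) = (83835, 177147, 177147)"
  unfolding signs18_def signs19_def signs21_def signs33_def signs60_def signs117_def
  by (rule block_energies_sysI,
      simp only: admissible_rules,
      simp only: table_rules block_energy_rules step_rules nat_arith)+

section \<open>Every admissible triple of sign matrices reduces to a representative\<close>

text \<open>
  Adding the conditions for \<open>i = 1\<close> and \<open>i = -1\<close> eliminates \<open>G\<close>, and adding the results for \<open>j = 1\<close> and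
  \<open>j = -1\<close> eliminates \<open>F\<close> too. These conditions prune the search for \<open>F\<close> and for \<open>E\<close>.
\<close>

lemma admissible_signs_necessary:
  assumes "admissible_signs (E, F, G)"
  shows "mixed_diff (entry E) Z1 Z1 + mixed_diff (entry E) Z1 Z2 + (mixed_diff (entry E) Z2 Z1 + mixed_diff (entry E) Z2 Z2) = Z0"
    and "j \<in> {Z1, Z2} \<Longrightarrow> k \<in> {Z1, Z2} \<Longrightarrow>
      (mixed_diff (entry F) Z1 k + mixed_diff (entry F) Z2 k) * j = (mixed_diff (entry E) Z1 j + mixed_diff (entry E) Z2 j) * k"
proof -
  have *: "mixed_diff (entry F) i k * j = mixed_diff (entry E) i j * k + mixed_diff (entry G) j k * i" for i j k
    using assms unfolding admissible_signs_iff by blast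
  have "mixed_diff (entry G) j k * Z1 + mixed_diff (entry G) j k * Z2 = Z0" for j k
    by (cases "mixed_diff (entry G) j k") simp_all
  then have fe: "(mixed_diff (entry F) Z1 k + mixed_diff (entry F) Z2 k) * j = (mixed_diff (entry E) Z1 j + mixed_diff (entry E) Z2 j) * k" for j k
    using *[of Z1 k j] *[of Z2 k j]
    by (simp add: distrib_right) (metis (no_types) add.assoc add.commute add.left_commute add_0_right zero_z3_def)
  then show "j \<in> {Z1, Z2} \<Longrightarrow> k \<in> {Z1, Z2} \<Longrightarrow>
      (mixed_diff (entry F) Z1 k + mixed_diff (entry F) Z2 k) * j = (mixed_diff (entry E) Z1 j + mixed_diff (entry E) Z2 j) * k" .
  have "u + v = Z0" if "x * Z1 = u * Z1" "x * Z2 = v * Z1" for x u v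
    using that by (cases x; cases u; cases v; simp)
  from this[OF fe[of Z1 Z1] fe[of Z1 Z2]]
  show "mixed_diff (entry E) Z1 Z1 + mixed_diff (entry E) Z1 Z2 + (mixed_diff (entry E) Z2 Z1 + mixed_diff (entry E) Z2 Z2) = Z0"
    by (simp only: add_ac)
qed

text \<open>
  Bounded quantifiers that stop at the first decisive element, provided that conditionals are evaluated
  lazily.
\<close>

fun exists_in :: "('a \<Rightarrow> bool) \<Rightarrow> 'a list \<Rightarrow> bool" where
  "exists_in P [] \<longleftrightarrow> False"
| "exists_in P (x # xs) \<longleftrightarrow> (if P x then True else exists_in P xs)"

lemma exists_in_iff: "exists_in P xs \<longleftrightarrow> (\<exists>x\<in>set xs. P x)"
  by (induction xs) auto

fun occurs_in :: "sign_mat \<Rightarrow> sign_mat list \<Rightarrow> bool" where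
  "occurs_in x [] \<longleftrightarrow> False"
| "occurs_in x (y # ys) \<longleftrightarrow> (if x = y then True else occurs_in x ys)"

lemma occurs_in_iff: "occurs_in x xs \<longleftrightarrow> x \<in> set xs"
  by (induction xs) auto

definition affine_maps :: "(z3 \<times> z3) list" where
  "affine_maps = [(Z1, Z0), (Z1, Z1), (Z1, Z2), (Z2, Z0), (Z2, Z1), (Z2, Z2)]"

definition sign_list :: "z3 list" where "sign_list = [Z1, Z2]"

definition sign_rows :: "sign_row list" where "sign_rows = [PPP, PPM, PMP, PMM, MPP, MPM, MMP, MMM]"

lemma set_sign_rows: "set sign_rows = UNIV"
proof -
  have "a \<in> set sign_rows" for a by (cases a) (simp_all add: sign_rows_def)
  then show ?thesis by blast
qed

fun forall_in :: "('a \<Rightarrow> bool) \<Rightarrow> 'a list \<Rightarrow> bool" where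
  "forall_in P [] \<longleftrightarrow> True"
| "forall_in P (x # xs) \<longleftrightarrow> (if P x then forall_in P xs else False)"

lemma forall_in_iff: "forall_in P xs \<longleftrightarrow> (\<forall>x\<in>set xs. P x)"
  by (induction xs) auto

definition forall_row3 :: "(sign_mat \<Rightarrow> bool) \<Rightarrow> sign_row \<Rightarrow> sign_row \<Rightarrow> sign_row \<Rightarrow> bool" where "forall_row3 P a b c \<longleftrightarrow> P (Mat a b c)"
definition forall_row2 where "forall_row2 P a b \<longleftrightarrow> forall_in (forall_row3 P a b) sign_rows"
definition forall_row1 where "forall_row1 P a \<longleftrightarrow> forall_in (forall_row2 P a) sign_rows"
definition forall_mat where "forall_mat P \<longleftrightarrow> forall_in (forall_row1 P) sign_rows"

lemma forall_mat_iff: "forall_mat P \<longleftrightarrow> (\<forall>m. P m)"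
  unfolding forall_mat_def forall_row1_def forall_row2_def forall_row3_def forall_in_iff set_sign_rows
  by (metis UNIV_I sign_mat.exhaust)

text \<open>
  First stage: some relabelling moves \<open>E\<close> into the list \<open>firsts\<close>. The nested loops are separate functions
  applied to atomic arguments, since abstractions would be rewritten again in each round.
\<close>

definition hitE where "hitE firsts E s a b \<longleftrightarrow> occurs_in (twist s a b E) firsts"
definition hitE2 where "hitE2 firsts E s a \<longleftrightarrow> exists_in (hitE firsts E s a) affine_maps"
definition hitE3 where "hitE3 firsts E s \<longleftrightarrow> exists_in (hitE2 firsts E s) affine_maps"
definition coverE where
  "coverE firsts E \<longleftrightarrow>
    (if mixed_diff (entry E) Z1 Z1 + mixed_diff (entry E) Z1 Z2 +
       (mixed_diff (entry E) Z2 Z1 + mixed_diff (entry E) Z2 Z2) = Z0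
     then exists_in (hitE3 firsts E) sign_list else True)"

text \<open>
  Second stage: \<open>F\<close> moves into the list \<open>fs\<close> under a relabelling that fixes \<open>E\<close>. The search runs over the
  relabelling of \<open>i\<close> and \<open>k\<close> and the sign \<open>t\<close> acting on \<open>F\<close>; only after a success is a relabelling of \<open>j\<close>
  sought. As \<open>t\<close> is the global sign times the sign of \<open>j\<close>, the sign acting on \<open>E\<close> is \<open>t * fst b * fst c\<close>.
\<close>

definition fixE where
  "fixE E t a c b \<longleftrightarrow> twist (t * fst b * fst c) a b E = E"
definition hitF where
  "hitF E fs F t a c \<longleftrightarrow>
    (if occurs_in (twist t a c F) fs then exists_in (fixE E t a c) affine_maps else False)"
definition hitF2 where "hitF2 E fs F t a \<longleftrightarrow> exists_in (hitF E fs F t a) affine_maps"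
definition hitF3 where "hitF3 E fs F t \<longleftrightarrow> exists_in (hitF2 E fs F t) affine_maps"

definition agree where
  "agree E F j k \<longleftrightarrow>
    (mixed_diff (entry F) Z1 k + mixed_diff (entry F) Z2 k) * j = (mixed_diff (entry E) Z1 j + mixed_diff (entry E) Z2 j) * k"
definition coverF where
  "coverF E fs F \<longleftrightarrow>
    (if agree E F Z1 Z1 then if agree E F Z1 Z2 then if agree E F Z2 Z1 then if agree E F Z2 Z2
     then exists_in (hitF3 E fs F) sign_list else True else True else True else True)"

text \<open>
  Third stage: \<open>G\<close> moves into the list \<open>gs\<close> under a relabelling that fixes \<open>E\<close> and \<open>F\<close>; the sign \<open>u\<close> acting
  on \<open>G\<close> is the global sign times the sign of \<open>i\<close>.
\<close>

definition fixEF where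
  "fixEF E F u b c a \<longleftrightarrow>
    (if twist (u * fst a * fst c) a b E = E then twist (u * fst a * fst b) a c F = F else False)"
definition hitG where
  "hitG E F gs G u b c \<longleftrightarrow>
    (if occurs_in (twist u b c G) gs then exists_in (fixEF E F u b c) affine_maps else False)"
definition hitG2 where "hitG2 E F gs G u b \<longleftrightarrow> exists_in (hitG E F gs G u b) affine_maps"
definition hitG3 where "hitG3 E F gs G u \<longleftrightarrow> exists_in (hitG2 E F gs G u) affine_maps"

text \<open>
  The candidates for \<open>G\<close> are built row by row. The admissibility condition for \<open>i = 1\<close> prescribes the mixed
  differences of \<open>G\<close>, collected in \<open>t1\<close> for \<open>j = 1\<close> and in \<open>t2\<close> for \<open>j = 2\<close>.
\<close>

definition coverG3 where
  "coverG3 E F gs t1 t2 a b c \<longleftrightarrow>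
    (if (row_entry c Z1 - row_entry a Z1) - (row_entry c Z0 - row_entry a Z0) = fst t2
     then if (row_entry c Z2 - row_entry a Z2) - (row_entry c Z0 - row_entry a Z0) = snd t2
     then exists_in (hitG3 E F gs (Mat a b c)) sign_list else True else True)"
definition coverG2 where
  "coverG2 E F gs t1 t2 a b \<longleftrightarrow>
    (if (row_entry b Z1 - row_entry a Z1) - (row_entry b Z0 - row_entry a Z0) = fst t1
     then if (row_entry b Z2 - row_entry a Z2) - (row_entry b Z0 - row_entry a Z0) = snd t1
     then forall_in (coverG3 E F gs t1 t2 a b) sign_rows else True else True)"
definition coverG1 where
  "coverG1 E F gs t1 t2 a \<longleftrightarrow> forall_in (coverG2 E F gs t1 t2 a) sign_rows"
definition coverG where
  "coverG E F gs \<longleftrightarrow> forall_in (coverG1 E F gs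
     (mixed_diff (entry F) Z1 Z1 * Z1 - mixed_diff (entry E) Z1 Z1 * Z1,
      mixed_diff (entry F) Z1 Z2 * Z1 - mixed_diff (entry E) Z1 Z1 * Z2)
     (mixed_diff (entry F) Z1 Z1 * Z2 - mixed_diff (entry E) Z1 Z2 * Z1,
      mixed_diff (entry F) Z1 Z2 * Z2 - mixed_diff (entry E) Z1 Z2 * Z2)) sign_rows"

fun coverGs where
  "coverGs E [] \<longleftrightarrow> True"
| "coverGs E ((F, gs) # br) \<longleftrightarrow> (if coverG E F gs then coverGs E br else False)"

fun cover_branch :: "branch \<Rightarrow> bool" where
  "cover_branch (E, br) \<longleftrightarrow> (if forall_mat (coverF E (map fst br)) then coverGs E br else False)"

lemmas cover_rules = exists_in.simps occurs_in.simps affine_maps_def sign_list_def sign_rows_def forall_in.simps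
  hitE_def hitE2_def hitE3_def coverE_def fixE_def hitF_def hitF2_def hitF3_def coverF_def agree_def
  fixEF_def hitG_def hitG2_def hitG3_def coverG3_def coverG2_def coverG1_def coverG_def
  coverGs.simps cover_branch.simps forall_mat_def forall_row1_def forall_row2_def forall_row3_def
  twist.simps mat_of_def row_of.simps mixed_diff_def entry.simps row_entry.simps z3_arith z3.distinct fst_conv snd_conv
  list.map sign_mat.inject sign_row.distinct simp_thms if_True if_False

lemma affine_maps_nonzero: "a \<in> set affine_maps \<Longrightarrow> fst a \<noteq> 0"
  by (auto simp: affine_maps_def zero_z3_def)

lemma sign_list_nonzero: "s \<in> set sign_list \<Longrightarrow> s \<noteq> 0"
  by (auto simp: sign_list_def zero_z3_def)

lemma twist_ds_iso:
  assumes "admissible_signs (E, F, G)" and "s \<noteq> 0" "fst a \<noteq> 0" "fst b \<noteq> 0" "fst c \<noteq> 0"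
  shows "admissible_signs (twist (s * fst c) a b E, twist (s * fst b) a c F, twist (s * fst a) b c G)"
    and "ds_iso_sys (sys (E, F, G))
      (sys (twist (s * fst c) a b E, twist (s * fst b) a c F, twist (s * fst a) b c G))"
proof -
  have p: "proper (s, a, b, c)" using assms by (cases a; cases b; cases c) simp
  have "relabel (s, a, b, c) (E, F, G)
      = (twist (s * fst c) a b E, twist (s * fst b) a c F, twist (s * fst a) b c G)"
    by (cases a; cases b; cases c) simp
  with relabel_ds_iso[OF assms(1) p]
  show "admissible_signs (twist (s * fst c) a b E, twist (s * fst b) a c F, twist (s * fst a) b c G)"
    and "ds_iso_sys (sys (E, F, G))
      (sys (twist (s * fst c) a b E, twist (s * fst b) a c F, twist (s * fst a) b c G))"
    by simp_all
qed

lemma coverE_sound: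
  assumes "coverE firsts E" and "admissible_signs (E, F, G)"
  obtains E' F' G' where "E' \<in> set firsts" "admissible_signs (E', F', G')"
    "ds_iso_sys (sys (E, F, G)) (sys (E', F', G'))"
proof -
  have "exists_in (hitE3 firsts E) sign_list"
    using assms(1) unfolding coverE_def admissible_signs_necessary(1)[OF assms(2)] by simp
  then obtain s a b where h: "s \<in> set sign_list" "a \<in> set affine_maps" "b \<in> set affine_maps" "twist s a b E \<in> set firsts"
    unfolding exists_in_iff hitE3_def hitE2_def hitE_def occurs_in_iff by blast
  have "s * Z1 = s" by (cases s) simp_all
  with h(4) have "twist (s * fst (Z1, Z0)) a b E \<in> set firsts" by simp
  then show thesis
    using twist_ds_iso[OF assms(2) sign_list_nonzero[OF h(1)] affine_maps_nonzero[OF h(2)] affine_maps_nonzero[OF h(3)],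
        of "(Z1, Z0)"] that by (simp add: zero_z3_def)
qed

lemma coverF_sound:
  assumes "coverF E fs F" and "admissible_signs (E, F, G)"
  obtains F' G' where "F' \<in> set fs" "admissible_signs (E, F', G')" "ds_iso_sys (sys (E, F, G)) (sys (E, F', G'))"
proof -
  have "exists_in (hitF3 E fs F) sign_list"
    using assms(1) admissible_signs_necessary(2)[OF assms(2)] unfolding coverF_def agree_def by simp
  then obtain t a c b where h: "t \<in> set sign_list" "a \<in> set affine_maps" "c \<in> set affine_maps" "b \<in> set affine_maps"
    "twist t a c F \<in> set fs" "twist (t * fst b * fst c) a b E = E"
    unfolding exists_in_iff hitF3_def hitF2_def hitF_def fixE_def occurs_in_iff by (metis (full_types))
  have nz: "t * fst b \<noteq> 0" "fst a \<noteq> 0" "fst b \<noteq> 0" "fst c \<noteq> 0"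
    using h sign_list_nonzero affine_maps_nonzero by (simp_all add: sign_mult_eq_0)
  have "t * fst b * fst b = t" using nz(3) by (simp add: mult.assoc sign_square)
  then show thesis
    using twist_ds_iso[OF assms(2) nz] that h by simp
qed

lemma coverG_sound:
  assumes "coverG E F gs" and "admissible_signs (E, F, G)"
  obtains G' where "G' \<in> set gs" "ds_iso_sys (sys (E, F, G)) (sys (E, F, G'))"
proof -
  obtain a b c where G: "G = Mat a b c" by (cases G)
  have *: "mixed_diff (entry G) j k = mixed_diff (entry F) Z1 k * j - mixed_diff (entry E) Z1 j * k" for j k
  proof -
    have "mixed_diff (entry F) Z1 k * j = mixed_diff (entry E) Z1 j * k + mixed_diff (entry G) j k * Z1"
      using assms(2) unfolding admissible_signs_iff by blast
    moreover have "x * Z1 = x" for x by (cases x) simp_all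
    ultimately show ?thesis by simp
  qed
  define t1 where "t1 = (mixed_diff (entry F) Z1 Z1 * Z1 - mixed_diff (entry E) Z1 Z1 * Z1,
    mixed_diff (entry F) Z1 Z2 * Z1 - mixed_diff (entry E) Z1 Z1 * Z2)"
  define t2 where "t2 = (mixed_diff (entry F) Z1 Z1 * Z2 - mixed_diff (entry E) Z1 Z2 * Z1,
    mixed_diff (entry F) Z1 Z2 * Z2 - mixed_diff (entry E) Z1 Z2 * Z2)"
  have t: "fst t1 = mixed_diff (entry G) Z1 Z1" "snd t1 = mixed_diff (entry G) Z1 Z2"
    "fst t2 = mixed_diff (entry G) Z2 Z1" "snd t2 = mixed_diff (entry G) Z2 Z2"
    unfolding t1_def t2_def fst_conv snd_conv * by (rule refl)+
  have cG: "mixed_diff (entry G) Z1 k = (row_entry b k - row_entry a k) - (row_entry b Z0 - row_entry a Z0)"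
    "mixed_diff (entry G) Z2 k = (row_entry c k - row_entry a k) - (row_entry c Z0 - row_entry a Z0)" for k
    by (simp_all add: mixed_diff_def G)
  have "coverG2 E F gs t1 t2 a b"
    using assms(1) unfolding coverG_def coverG1_def forall_in_iff set_sign_rows t1_def t2_def by blast
  then have "coverG3 E F gs t1 t2 a b c"
    unfolding coverG2_def t cG forall_in_iff set_sign_rows by simp
  then have "exists_in (hitG3 E F gs G) sign_list"
    unfolding coverG3_def t cG by (simp add: G)
  then obtain u b c a where h: "u \<in> set sign_list" "b \<in> set affine_maps" "c \<in> set affine_maps" "a \<in> set affine_maps"
    "twist u b c G \<in> set gs" "twist (u * fst a * fst c) a b E = E" "twist (u * fst a * fst b) a c F = F"
    unfolding exists_in_iff hitG3_def hitG2_def hitG_def fixEF_def occurs_in_iff by (metis (full_types))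
  have nz: "u * fst a \<noteq> 0" "fst a \<noteq> 0" "fst b \<noteq> 0" "fst c \<noteq> 0"
    using h sign_list_nonzero affine_maps_nonzero by (simp_all add: sign_mult_eq_0)
  have "u * fst a * fst a = u" using nz(2) by (simp add: mult.assoc sign_square)
  then show thesis
    using twist_ds_iso[OF assms(2) nz] that h by simp
qed

lemma coverGs_iff: "coverGs E br \<longleftrightarrow> (\<forall>(F, gs)\<in>set br. coverG E F gs)"
  by (induction br) (auto split: if_splits)

lemma cover_branch_sound:
  assumes "cover_branch (E, br)" and "admissible_signs (E, F, G)"
  obtains s where "s \<in> set (signs_of_branch (E, br))" "ds_iso_sys (sys (E, F, G)) (sys s)"
proof -
  have c: "coverF E (map fst br) F" "coverGs E br"
    using assms(1) by (auto simp: forall_mat_iff split: if_splits)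
  obtain F' G' where F': "F' \<in> set (map fst br)" and a: "admissible_signs (E, F', G')"
    and i: "ds_iso_sys (sys (E, F, G)) (sys (E, F', G'))"
    by (rule coverF_sound[OF c(1) assms(2)])
  then obtain gs where gs: "(F', gs) \<in> set br" by auto
  then have "coverG E F' gs" using c(2) by (auto simp: coverGs_iff)
  then obtain G'' where "G'' \<in> set gs" "ds_iso_sys (sys (E, F', G')) (sys (E, F', G''))"
    using a by (rule coverG_sound)
  moreover from this gs have "(E, F', G'') \<in> set (signs_of_branch (E, br))" by force
  ultimately show thesis using that ds_iso_sys_trans[OF i] by blast
qed

lemma coverE_tree: "forall_mat (coverE (map fst tree))"
  by (simp only: cover_rules tree_def branch1_def branch2_def branch3_def branch4_def branch5_def
      branch6_def branch7_def cong: if_weak_cong)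

lemma cover_branch1: "cover_branch branch1"
  by (simp only: cover_rules branch1_def cong: if_weak_cong)

lemma cover_branch2: "cover_branch branch2"
  by (simp only: cover_rules branch2_def cong: if_weak_cong)

lemma cover_branch3: "cover_branch branch3"
  by (simp only: cover_rules branch3_def cong: if_weak_cong)

lemma cover_branch4: "cover_branch branch4"
  by (simp only: cover_rules branch4_def cong: if_weak_cong)

lemma cover_branch5: "cover_branch branch5"
  by (simp only: cover_rules branch5_def cong: if_weak_cong)

lemma cover_branch6: "cover_branch branch6"
  by (simp only: cover_rules branch6_def cong: if_weak_cong)

lemma cover_branch7: "cover_branch branch7"
  by (simp only: cover_rules branch7_def cong: if_weak_cong)

definition representatives :: "signs list" where
  "representatives = concat (map signs_of_branch tree)"

lemma admissible_signs_classified: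
  assumes "admissible_signs s"
  obtains s' where "s' \<in> set representatives" "ds_iso_sys (sys s) (sys s')"
proof -
  obtain E F G where s: "s = (E, F, G)" by (cases s)
  have "coverE (map fst tree) E" using coverE_tree by (simp add: forall_mat_iff)
  then obtain E' F' G' where E': "E' \<in> set (map fst tree)" and a: "admissible_signs (E', F', G')"
    and i: "ds_iso_sys (sys (E, F, G)) (sys (E', F', G'))"
    using assms unfolding s by (rule coverE_sound)
  from E' obtain br where br: "(E', br) \<in> set tree" by auto
  then have "cover_branch (E', br)"
    using cover_branch1 cover_branch2 cover_branch3 cover_branch4 cover_branch5 cover_branch6 cover_branch7
    by (auto simp: tree_def simp del: cover_branch.simps)
  then obtain s' where "s' \<in> set (signs_of_branch (E', br))" "ds_iso_sys (sys (E', F', G')) (sys s')"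
    using a by (rule cover_branch_sound)
  moreover from this(1) br have "s' \<in> set representatives"
    unfolding representatives_def by (simp only: set_concat set_map) blast
  ultimately show thesis using that ds_iso_sys_trans[OF i] unfolding s by blast
qed

section \<open>Squares and systems\<close>

fun residue :: "z3 \<Rightarrow> nat" where
  "residue Z0 = 0" | "residue Z1 = 1" | "residue Z2 = 2"

text \<open>
  Row, column or symbol \<open>n\<close> is position \<open>(n - 1) mod 3\<close> of block \<open>(n - 1) div 3\<close>.
\<close>

definition enc :: "point \<Rightarrow> nat" where
  "enc = (\<lambda>(i, x). 3 * residue i + residue x + 1)"

lemma symbols9_eq: "symbols9 = {1, 2, 3, 4, 5, 6, 7, 8, 9}"
  by auto

text \<open>
  Keeps the set \<open>{1..9}\<close> in the form in which the following rules match it.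
\<close>

declare One_nat_def [simp del] and atLeastAtMost_iff [simp del]

lemma bij_enc: "bij_betw enc UNIV symbols9"
proof -
  have "inj enc"
  proof (intro injI)
    fix a b assume "enc a = enc b"
    moreover obtain i x j y where "a = (i, x)" "b = (j, y)" by (metis surj_pair)
    ultimately show "a = b" by (cases i; cases x; cases j; cases y; simp add: enc_def)
  qed
  moreover have "enc ` UNIV = symbols9"
    unfolding symbols9_eq UNIV_Times_UNIV[symmetric] UNIV_z3 by (auto simp: enc_def)
  ultimately show ?thesis by (simp add: bij_betw_def)
qed

definition dec :: "nat \<Rightarrow> point" where
  "dec = inv_into UNIV enc"

lemma dec_enc [simp]: "dec (enc p) = p"
  using bij_enc by (simp add: dec_def bij_betw_def)

lemma enc_dec: "n \<in> symbols9 \<Longrightarrow> enc (dec n) = n"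
  using bij_enc by (simp only: dec_def bij_betw_def f_inv_into_f)

lemma enc_in [simp]: "enc p \<in> symbols9"
  using bij_enc unfolding bij_betw_def by blast

lemma enc_inj [simp]: "enc p = enc q \<longleftrightarrow> p = q"
  by (metis dec_enc)

lemma symbols9E:
  assumes "n \<in> symbols9"
  obtains p where "n = enc p"
  using enc_dec[OF assms] by metis

definition block :: "z3 \<Rightarrow> nat set" where
  "block i = {enc (i, x) |x. True}"

lemma enc_in_block: "enc p \<in> block i \<longleftrightarrow> fst p = i"
  by (cases p) (auto simp: block_def)

lemma sudoku_partition_eq: "sudoku_partition = range block"
proof -
  have "block i = enc ` ({i} \<times> UNIV)" for i
    unfolding block_def by auto
  then have "block Z0 = {1, 2, 3}" "block Z1 = {4, 5, 6}" "block Z2 = {7, 8, 9}"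
    by (auto simp: UNIV_z3 enc_def)
  then show ?thesis by (simp add: sudoku_partition_def UNIV_z3)
qed

definition system_of :: "(nat \<Rightarrow> nat \<Rightarrow> nat) \<Rightarrow> system" where
  "system_of L x y z \<longleftrightarrow> L (enc x) (enc y) = enc z"

definition square_of :: "(point \<Rightarrow> point \<Rightarrow> point) \<Rightarrow> nat \<Rightarrow> nat \<Rightarrow> nat" where
  "square_of l = (\<lambda>x\<in>symbols9. \<lambda>y\<in>symbols9. enc (l (dec x) (dec y)))"

lemma orthogonal_array_enc:
  assumes "latin_square symbols9 L"
  shows "(m, n, v) \<in> orthogonal_array symbols9 L \<longleftrightarrow>
    (\<exists>x y z. m = enc x \<and> n = enc y \<and> v = enc z \<and> system_of L x y z)"
proof
  assume "(m, n, v) \<in> orthogonal_array symbols9 L"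
  then have mn: "m \<in> symbols9" "n \<in> symbols9" "v = L m n"
    unfolding orthogonal_array_def by blast+
  moreover have "L m n \<in> symbols9"
    using assms mn(1,2) unfolding latin_square_def by (meson PiE_mem)
  ultimately show "\<exists>x y z. m = enc x \<and> n = enc y \<and> v = enc z \<and> system_of L x y z"
    unfolding system_of_def by (metis enc_dec)
next
  assume "\<exists>x y z. m = enc x \<and> n = enc y \<and> v = enc z \<and> system_of L x y z"
  then show "(m, n, v) \<in> orthogonal_array symbols9 L"
    unfolding orthogonal_array_def system_of_def using enc_in by (metis (mono_tags, lifting) mem_Collect_eq)
qed

lemma ball_symbols9: "(\<forall>n\<in>symbols9. P n) \<longleftrightarrow> (\<forall>p. P (enc p))"
  by (metis enc_dec enc_in)

lemma bex_symbols9: "(\<exists>n\<in>symbols9. P n) \<longleftrightarrow> (\<exists>p. P (enc p))"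
  by (metis enc_dec enc_in)

lemma latin_square_iff:
  "latin_square symbols9 L \<longleftrightarrow> L \<in> symbols9 \<rightarrow>\<^sub>E symbols9 \<rightarrow>\<^sub>E symbols9 \<and>
     (\<forall>x z. \<exists>y. system_of L x y z) \<and> (\<forall>y z. \<exists>x. system_of L x y z)"
  unfolding latin_square_def ball_symbols9 bex_symbols9 system_of_def by simp

lemma latin_sys_system_of:
  assumes "latin_square symbols9 L"
  shows "latin_sys (system_of L)"
proof -
  have L: "L (enc x) (enc y) \<in> symbols9" for x y
    using assms unfolding latin_square_def by (meson PiE_mem enc_in)
  define l where "l x y = dec (L (enc x) (enc y))" for x y
  have l: "system_of L x y z \<longleftrightarrow> z = l x y" for x y z
    unfolding l_def system_of_def by (metis L dec_enc enc_dec)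
  have "surj (l x)" for x
    using assms unfolding latin_square_iff l surj_def by blast
  then have row: "inj (l x)" for x by (simp add: finite_UNIV_surj_inj)
  have "surj (\<lambda>x. l x y)" for y
    using assms unfolding latin_square_iff l surj_def by blast
  then have col: "inj (\<lambda>x. l x y)" for y by (simp add: finite_UNIV_surj_inj)
  have "\<exists>!y. z = l x y" "\<exists>!x. z = l x y" for x y z
    using \<open>\<And>x. surj (l x)\<close> \<open>\<And>y. surj (\<lambda>x. l x y)\<close> row col
    by (metis injD surjD)+
  then show ?thesis by (simp add: latin_sys_def l)
qed

text \<open>
  Being latin is part of \<open>division_sys\<close>, and what remains of the definition of a square is its being
  extensional.
\<close>

lemma standard_division_sudoku_iff:
  "standard_division_sudoku L \<longleftrightarrow> L \<in> symbols9 \<rightarrow>\<^sub>E symbols9 \<rightarrow>\<^sub>E symbols9 \<and> division_sys (system_of L)"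
proof -
  have main: "standard_division_sudoku L \<longleftrightarrow> division_sys (system_of L)" if "latin_square symbols9 L"
  proof -
    note o = orthogonal_array_enc[OF that]
    have 1: "(\<exists>m n. (m, n, enc z) \<in> band L (block i) \<inter> stack L (block j)) \<longleftrightarrow>
        (\<exists>x y. system_of L (i, x) (j, y) z)" for i j z
    proof -
      have "(m, n, enc z) \<in> band L (block i) \<inter> stack L (block j) \<longleftrightarrow>
          (\<exists>x y. m = enc (i, x) \<and> n = enc (j, y) \<and> system_of L (i, x) (j, y) z)" for m n
        unfolding band_def stack_def by (cases z) (auto simp: o enc_in_block)
      then show ?thesis by simp
    qed
    have 2: "(\<exists>m v. (m, enc y, v) \<in> band L (block i) \<inter> pile L (block k)) \<longleftrightarrow>
        (\<exists>x z. system_of L (i, x) y (k, z))" for i k y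
    proof -
      have "(m, enc y, v) \<in> band L (block i) \<inter> pile L (block k) \<longleftrightarrow>
          (\<exists>x z. m = enc (i, x) \<and> v = enc (k, z) \<and> system_of L (i, x) y (k, z))" for m v
        unfolding band_def pile_def by (cases y) (auto simp: o enc_in_block)
      then show ?thesis by simp
    qed
    have 3: "(\<exists>n v. (enc x, n, v) \<in> stack L (block j) \<inter> pile L (block k)) \<longleftrightarrow>
        (\<exists>y z. system_of L x (j, y) (k, z))" for j k x
    proof -
      have "(enc x, n, v) \<in> stack L (block j) \<inter> pile L (block k) \<longleftrightarrow>
          (\<exists>y z. n = enc (j, y) \<and> v = enc (k, z) \<and> system_of L x (j, y) (k, z))" for n v
        unfolding stack_def pile_def by (cases x) (auto simp: o enc_in_block)
      then show ?thesis by simp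
    qed
    have ball: "(\<forall>A\<in>range block. P A) \<longleftrightarrow> (\<forall>i. P (block i))" for P
      by blast
    show ?thesis
      unfolding standard_division_sudoku_def sudoku_partition_eq ball_symbols9 division_sys_def
        ball 1 2 3
      by (simp only: that latin_sys_system_of[OF that] simp_thms) blast
  qed
  have "latin_square symbols9 L" if "L \<in> symbols9 \<rightarrow>\<^sub>E symbols9 \<rightarrow>\<^sub>E symbols9" "division_sys (system_of L)"
  proof -
    have "\<exists>!y. system_of L x y z" "\<exists>!x. system_of L x y z" for x y z
      using that(2) by (simp_all only: division_sys_def latin_sys_def)
    then show ?thesis
      unfolding latin_square_iff using that(1) by (blast dest: ex1_implies_ex)
  qed
  then show ?thesis
    using main unfolding standard_division_sudoku_def latin_square_def by blast
qed

lemma system_of_square_of: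
  assumes "\<And>x y z. T x y z \<longleftrightarrow> z = l x y"
  shows "system_of (square_of l) = T"
  by (intro ext) (auto simp: system_of_def square_of_def assms)

lemma square_of_extensional: "square_of l \<in> symbols9 \<rightarrow>\<^sub>E symbols9 \<rightarrow>\<^sub>E symbols9"
  unfolding square_of_def by (intro PiE_I) (simp_all only: restrict_apply enc_in if_True if_False)

lemma bij_of_permutes:
  assumes "\<alpha> permutes symbols9"
  shows "bij (\<lambda>p. dec (\<alpha> (enc p)))" and "enc (dec (\<alpha> (enc p))) = \<alpha> (enc p)"
proof -
  have e: "enc (dec (\<alpha> (enc p))) = \<alpha> (enc p)" for p
    using assms enc_in by (intro enc_dec) (simp only: permutes_in_image)
  show "enc (dec (\<alpha> (enc p))) = \<alpha> (enc p)" by (rule e)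
  have "inj (\<lambda>p. dec (\<alpha> (enc p)))"
    by (intro injI) (metis e enc_inj assms permutes_inj injD)
  then show "bij (\<lambda>p. dec (\<alpha> (enc p)))" by (simp add: bij_def finite_UNIV_inj_surj)
qed

definition perm_of :: "(point \<Rightarrow> point) \<Rightarrow> nat \<Rightarrow> nat" where
  "perm_of \<alpha> n = (if n \<in> symbols9 then enc (\<alpha> (dec n)) else n)"

lemma perm_of_permutes:
  assumes "bij \<alpha>"
  shows "perm_of \<alpha> permutes symbols9"
proof (rule bij_imp_permutes)
  have "inj_on (perm_of \<alpha>) symbols9"
    unfolding perm_of_def using assms
    by (intro inj_onI) (metis bij_is_inj enc_dec enc_inj injD)
  moreover have "perm_of \<alpha> ` symbols9 \<subseteq> symbols9" by (auto simp only: perm_of_def enc_in if_True)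
  ultimately show "bij_betw (perm_of \<alpha>) symbols9 symbols9"
    by (simp add: bij_betw_def endo_inj_surj)
qed (simp add: perm_of_def)

lemma perm_of_enc [simp]: "perm_of \<alpha> (enc p) = enc (\<alpha> p)"
  unfolding perm_of_def using enc_in by (simp only: dec_enc if_True)

lemma isotopism_imp_system:
  assumes "isotopism symbols9 L M \<alpha> \<beta> \<gamma>"
  shows "system_of M (dec (\<alpha> (enc x))) (dec (\<beta> (enc y))) (dec (\<gamma> (enc z))) \<longleftrightarrow> system_of L x y z"
proof -
  have p: "\<alpha> permutes symbols9" "\<beta> permutes symbols9" "\<gamma> permutes symbols9"
    and M: "M (\<alpha> (enc x)) (\<beta> (enc y)) = \<gamma> (L (enc x) (enc y))"
    using assms enc_in unfolding isotopism_def by blast+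
  show ?thesis
    unfolding system_of_def p[THEN bij_of_permutes(2)] M
    using permutes_inj[OF p(3)] by (simp add: inj_eq)
qed

lemma system_imp_isotopism:
  assumes "L \<in> symbols9 \<rightarrow>\<^sub>E symbols9 \<rightarrow>\<^sub>E symbols9" and "bij \<alpha>" "bij \<beta>" "bij \<gamma>"
    and "\<And>x y z. system_of M (\<alpha> x) (\<beta> y) (\<gamma> z) \<longleftrightarrow> system_of L x y z"
  shows "isotopism symbols9 L M (perm_of \<alpha>) (perm_of \<beta>) (perm_of \<gamma>)"
  unfolding isotopism_def ball_symbols9
proof (intro conjI perm_of_permutes assms(2-4) allI)
  fix x y
  have "L (enc x) (enc y) \<in> symbols9" using assms(1) by (meson PiE_mem enc_in)
  then obtain z where z: "L (enc x) (enc y) = enc z" by (rule symbols9E)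
  then have "system_of L x y z" unfolding system_of_def .
  then have "system_of M (\<alpha> x) (\<beta> y) (\<gamma> z)" by (simp only: assms(5))
  then show "M (perm_of \<alpha> (enc x)) (perm_of \<beta> (enc y)) = perm_of \<gamma> (L (enc x) (enc y))"
    unfolding system_of_def z perm_of_enc .
qed

lemma isotopic_iff:
  assumes "L \<in> symbols9 \<rightarrow>\<^sub>E symbols9 \<rightarrow>\<^sub>E symbols9"
  shows "isotopic L M \<longleftrightarrow> iso_sys (system_of L) (system_of M)"
proof
  assume "isotopic L M"
  then obtain \<alpha> \<beta> \<gamma> where i: "isotopism symbols9 L M \<alpha> \<beta> \<gamma>" unfolding isotopic_def by blast
  then have "\<alpha> permutes symbols9" "\<beta> permutes symbols9" "\<gamma> permutes symbols9"
    unfolding isotopism_def by blast+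
  then show "iso_sys (system_of L) (system_of M)"
    unfolding iso_sys_def using isotopism_imp_system[OF i] bij_of_permutes(1) by blast
next
  assume "iso_sys (system_of L) (system_of M)"
  then show "isotopic L M"
    unfolding iso_sys_def isotopic_def using system_imp_isotopism[OF assms] by blast
qed

lemma blockwise_of_maps_blocks:
  assumes "\<alpha> permutes symbols9" and "maps_blocks \<alpha>"
  shows "blockwise (\<lambda>p. dec (\<alpha> (enc p)))"
proof -
  let ?a = "\<lambda>p. dec (\<alpha> (enc p))"
  note b = bij_of_permutes[OF assms(1)]
  have "\<exists>j. \<alpha> ` block i = block j" for i
    using assms(2) unfolding maps_blocks_def sudoku_partition_eq by blast
  then obtain \<sigma> where \<sigma>: "\<And>i. \<alpha> ` block i = block (\<sigma> i)" by metis
  \<comment> \<open>the induced map on blocks is onto, hence injective\<close>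
  have fst: "fst (?a p) = \<sigma> (fst p)" for p
  proof -
    have "\<alpha> (enc p) \<in> block (\<sigma> (fst p))" using \<sigma> enc_in_block by blast
    then show ?thesis using enc_in_block b(2) by metis
  qed
  have "surj \<sigma>"
  proof (intro surjI)
    show "\<sigma> (fst (inv ?a (i, Z0))) = i" for i
      using fst[of "inv ?a (i, Z0)"] surj_f_inv_f[OF bij_is_surj[OF b(1)], of "(i, Z0)"] by (metis fst_conv)
  qed
  then have "inj \<sigma>" by (simp add: finite_UNIV_surj_inj)
  then show ?thesis
    unfolding blockwise_def fst using b(1) by (simp add: inj_eq)
qed

text \<open>
  A point whose image lies in the image block has the same block as the points mapped there, so the image
  of a block is a whole block.
\<close>

lemma maps_blocks_of_blockwise:
  assumes "blockwise \<alpha>"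
  shows "maps_blocks (perm_of \<alpha>)"
  unfolding maps_blocks_def sudoku_partition_eq
proof
  fix A assume "A \<in> range block"
  then obtain i where A: "A = block i" by blast
  let ?j = "fst (\<alpha> (i, Z0))"
  have eq: "fst (\<alpha> p) = ?j \<longleftrightarrow> fst p = i" for p
    using assms unfolding blockwise_def by (metis fst_conv)
  have "perm_of \<alpha> ` block i = block ?j"
  proof (intro equalityI subsetI)
    fix n assume "n \<in> perm_of \<alpha> ` block i"
    then obtain x where "n = enc (\<alpha> (i, x))" unfolding block_def by auto
    then show "n \<in> block ?j" using eq[of "(i, x)"] by (simp add: enc_in_block)
  next
    fix n assume "n \<in> block ?j"
    then obtain x where n: "n = enc (?j, x)" unfolding block_def by blast
    obtain p where p: "(?j, x) = \<alpha> p"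
      using assms unfolding blockwise_def by (metis bij_obtain)
    then have "fst p = i" using eq[of p] by (metis fst_conv)
    then have "enc p \<in> block i" by (simp add: enc_in_block)
    then show "n \<in> perm_of \<alpha> ` block i" unfolding n p by (metis imageI perm_of_enc)
  qed
  then show "perm_of \<alpha> ` A \<in> range block" unfolding A by simp
qed

lemma ds_isotopic_iff:
  assumes "L \<in> symbols9 \<rightarrow>\<^sub>E symbols9 \<rightarrow>\<^sub>E symbols9"
  shows "ds_isotopic L M \<longleftrightarrow> ds_iso_sys (system_of L) (system_of M)"
proof
  assume "ds_isotopic L M"
  then obtain \<alpha> \<beta> \<gamma> where i: "isotopism symbols9 L M \<alpha> \<beta> \<gamma>"
    and m: "maps_blocks \<alpha>" "maps_blocks \<beta>" "maps_blocks \<gamma>" unfolding ds_isotopic_def by blast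
  then have "\<alpha> permutes symbols9" "\<beta> permutes symbols9" "\<gamma> permutes symbols9"
    unfolding isotopism_def by blast+
  then show "ds_iso_sys (system_of L) (system_of M)"
    unfolding ds_iso_sys_def using isotopism_imp_system[OF i] blockwise_of_maps_blocks m by blast
next
  assume "ds_iso_sys (system_of L) (system_of M)"
  then obtain \<alpha> \<beta> \<gamma> where b: "blockwise \<alpha>" "blockwise \<beta>" "blockwise \<gamma>"
    and "\<And>x y z. system_of M (\<alpha> x) (\<beta> y) (\<gamma> z) \<longleftrightarrow> system_of L x y z"
    unfolding ds_iso_sys_def by blast
  moreover from b have "bij \<alpha>" "bij \<beta>" "bij \<gamma>" unfolding blockwise_def by blast+
  ultimately have "isotopism symbols9 L M (perm_of \<alpha>) (perm_of \<beta>) (perm_of \<gamma>)"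
    using system_imp_isotopism[OF assms] by blast
  then show "ds_isotopic L M"
    unfolding ds_isotopic_def using b[THEN maps_blocks_of_blockwise] by blast
qed

section \<open>Counting the classes\<close>

lemma latin_sys_solved:
  assumes "solved_by T l r c"
  shows "latin_sys T"
proof -
  have "T x y z \<longleftrightarrow> z = l x y" "T x y z \<longleftrightarrow> y = r x z" "T x y z \<longleftrightarrow> x = c y z" for x y z
    using assms unfolding solved_by_def by blast+
  then have "\<exists>!z. T x y z" "\<exists>!y. T x y z" "\<exists>!x. T x y z" for x y z by metis+
  then show ?thesis by (simp only: latin_sys_def simp_thms)
qed

text \<open>
  In each case the missing positions are found by solving the two equations for them.
\<close>

lemma division_sys_affine_sys:
  assumes "coherent e f g p q r"
  shows "division_sys (affine_sys e f p q)"
  unfolding division_sys_def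
proof (intro conjI allI)
  show "latin_sys (affine_sys e f p q)"
    by (rule latin_sys_solved[OF solved_by_affine_sys[OF assms]])
  fix i j k :: z3 and X Y Z :: point
  obtain i' x j' y k' z where X: "X = (i', x)" and Y: "Y = (j', y)" and Z: "Z = (k', z)" by (metis surj_pair)
  have "affine_sys e f p q (i, z - (f i k' * j + q i k')) (j, z - (f i k' * j + q i k') + (e i j * k' + p i j)) (k', z)"
    by (simp add: affine_sys_def)
  then show "\<exists>x y. affine_sys e f p q (i, x) (j, y) Z" unfolding Z by blast
  have "affine_sys e f p q (i, y - (e i j' * k + p i j')) (j', y) (k, y - (e i j' * k + p i j') + (f i k * j' + q i k))"
    by (simp add: affine_sys_def)
  then show "\<exists>x z. affine_sys e f p q (i, x) Y (k, z)" unfolding Y by blast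
  have "affine_sys e f p q (i', x) (j, x + (e i' j * k + p i' j)) (k, x + (f i' k * j + q i' k))"
    by (simp add: affine_sys_def)
  then show "\<exists>y z. affine_sys e f p q X (j, y) (k, z)" unfolding X by blast
qed

definition square :: "signs \<Rightarrow> nat \<Rightarrow> nat \<Rightarrow> nat" where
  "square = (\<lambda>(E, F, G). square_of
     (symbol_at (entry E) (entry F) (canon_p (entry F) (entry G)) (canon_q (entry E) (entry G))))"

lemma sys_iff_symbol_at:
  assumes "admissible_signs (E, F, G)"
  shows "sys (E, F, G) x y z \<longleftrightarrow>
    z = symbol_at (entry E) (entry F) (canon_p (entry F) (entry G)) (canon_q (entry E) (entry G)) x y"
  using assms solved_by_affine_sys unfolding admissible_signs_def admissible_def sys_def solved_by_def prod.case
  by blast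

lemma system_of_square: "admissible_signs s \<Longrightarrow> system_of (square s) = sys s"
  by (cases s) (simp add: square_def system_of_square_of[OF sys_iff_symbol_at])

lemma square_standard:
  assumes "admissible_signs s"
  shows "standard_division_sudoku (square s)"
proof -
  have "division_sys (sys s)"
    using assms division_sys_affine_sys by (cases s) (auto simp: sys_def admissible_signs_def admissible_def)
  then have "division_sys (system_of (square s))" by (simp only: system_of_square[OF assms])
  moreover have "square s \<in> symbols9 \<rightarrow>\<^sub>E symbols9 \<rightarrow>\<^sub>E symbols9"
    by (cases s) (simp only: square_def prod.case square_of_extensional)
  ultimately show ?thesis by (simp only: standard_division_sudoku_iff)
qed

text \<open>
  The offset \<open>1\<close> comes from list indices starting at zero.
\<close>

lemma square_of_rows_eqI:
  assumes "\<forall>i x j y. rows ! (enc (i, x) - 1) ! (enc (j, y) - 1) = enc (l (i, x) (j, y))"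
  shows "square_of_rows rows = square_of l"
proof -
  have "rows ! (m - 1) ! (n - 1) = enc (l (dec m) (dec n))" if "m \<in> symbols9" "n \<in> symbols9" for m n
    using assms that by (metis enc_dec surj_pair)
  then show ?thesis
    unfolding square_of_rows_def square_of_def by (intro restrict_ext) blast
qed

lemma enc_simps:
  "enc (Z0, Z0) = 1" "enc (Z0, Z1) = 2" "enc (Z0, Z2) = 3" "enc (Z1, Z0) = 4" "enc (Z1, Z1) = 5"
  "enc (Z1, Z2) = 6" "enc (Z2, Z0) = 7" "enc (Z2, Z1) = 8" "enc (Z2, Z2) = 9"
  by (simp_all add: enc_def)

lemmas square_rules = step_rules canon_z3 entry.simps row_entry.simps enc_simps

lemma DS_9_18_eq_square: "DS_9_18 = square signs18"
  unfolding DS_9_18_def signs18_def square_def prod.case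
  by (rule square_of_rows_eqI, unfold all_z3) (simp only: square_rules, simp add: One_nat_def)

lemma DS_9_19_eq_square: "DS_9_19 = square signs19"
  unfolding DS_9_19_def signs19_def square_def prod.case
  by (rule square_of_rows_eqI, unfold all_z3) (simp only: square_rules, simp add: One_nat_def)

lemma DS_9_21_eq_square: "DS_9_21 = square signs21"
  unfolding DS_9_21_def signs21_def square_def prod.case
  by (rule square_of_rows_eqI, unfold all_z3) (simp only: square_rules, simp add: One_nat_def)

lemma DS_9_60_eq_square: "DS_9_60 = square signs60"
  unfolding DS_9_60_def signs60_def square_def prod.case
  by (rule square_of_rows_eqI, unfold all_z3) (simp only: square_rules, simp add: One_nat_def)

lemma DS_9_33_eq_square: "DS_9_33 = square signs33"
  unfolding DS_9_33_def signs33_def square_def prod.case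
  by (rule square_of_rows_eqI, unfold all_z3) (simp only: square_rules, simp add: One_nat_def)

lemma DS_9_117_eq_square: "DS_9_117 = square signs117"
  unfolding DS_9_117_def signs117_def square_def prod.case
  by (rule square_of_rows_eqI, unfold all_z3) (simp only: square_rules, simp add: One_nat_def)

lemmas DS_9_eq_square = DS_9_18_eq_square DS_9_19_eq_square DS_9_21_eq_square DS_9_60_eq_square DS_9_33_eq_square DS_9_117_eq_square

lemma admissible_representatives: "forall_in admissible_signs representatives"
  by (simp only: representatives_def tree_def branch1_def branch2_def branch3_def branch4_def branch5_def
      branch6_def branch7_def signs_of_branch.simps concat.simps append.simps list.map prod.case
      forall_in.simps admissible_rules if_True cong: if_weak_cong)

lemma admissible_representative: "s \<in> set representatives \<Longrightarrow> admissible_signs s"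
  using admissible_representatives by (simp add: forall_in_iff)

lemma exceptional_in_representatives:
  "signs18 \<in> set representatives" "signs19 \<in> set representatives" "signs21 \<in> set representatives"
  "signs60 \<in> set representatives" "signs33 \<in> set representatives" "signs117 \<in> set representatives"
  by (simp_all add: representatives_def tree_def branch1_def branch2_def branch3_def
      signs18_def signs19_def signs21_def signs33_def signs60_def signs117_def)

lemmas admissible_exceptional = exceptional_in_representatives[THEN admissible_representative]

lemma bij_slot:
  fixes a b c d e f g h i :: point
  assumes "distinct [a, b, c, d, e, f, g, h, i]"
  shows "bij (slot (Grid a b c d e f g h i))"
proof -
  have "inj (slot (Grid a b c d e f g h i))"
  proof
    fix p q :: point
    assume eq: "slot (Grid a b c d e f g h i) p = slot (Grid a b c d e f g h i) q"
    obtain u v w x where "p = (u, v)" "q = (w, x)" by (metis surj_pair)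
    with eq assms show "p = q" by (cases u; cases v; cases w; cases x; simp)
  qed
  then show ?thesis by (simp add: bij_def finite_UNIV_inj_surj)
qed

text \<open>
  It suffices to compare the two squares cell by cell.
\<close>

lemma iso_sys_by_tables:
  fixes \<alpha> \<beta> \<gamma> :: "point \<Rightarrow> point"
  assumes "admissible_signs (E, F, G)" "admissible_signs (E', F', G')" and "bij \<alpha>" "bij \<beta>" and \<gamma>: "bij \<gamma>"
    and "\<forall>i x j y.
      symbol_at (entry E') (entry F') (canon_p (entry F') (entry G')) (canon_q (entry E') (entry G')) (\<alpha> (i, x)) (\<beta> (j, y))
      = \<gamma> (symbol_at (entry E) (entry F) (canon_p (entry F) (entry G)) (canon_q (entry E) (entry G)) (i, x) (j, y))"
  shows "iso_sys (sys (E, F, G)) (sys (E', F', G'))"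
proof -
  have "sys (E', F', G') (\<alpha> x) (\<beta> y) (\<gamma> z) \<longleftrightarrow> sys (E, F, G) x y z" for x y z
    using assms(6) bij_is_inj[OF \<gamma>]
    unfolding sys_iff_symbol_at[OF assms(1)] sys_iff_symbol_at[OF assms(2)] by (cases x; cases y) (simp add: inj_eq)
  then show ?thesis unfolding iso_sys_def using assms(3-5) by blast
qed

lemmas exceptional_rules = step_rules canon_z3 entry.simps row_entry.simps slot.simps simp_thms

text \<open>
  The three permutations are tables of the images of the nine points. Not all of
  them map blocks to blocks.
\<close>

lemma iso_sys_18_19: "iso_sys (sys signs18) (sys signs19)"
proof (rule iso_sys_by_tables[OF admissible_exceptional(1)[unfolded signs18_def] admissible_exceptional(2)[unfolded signs19_def]
      bij_slot bij_slot bij_slot, folded signs18_def signs19_def])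
  show "distinct [(Z0, Z1), (Z0, Z0), (Z0, Z2), (Z1, Z0), (Z1, Z2), (Z1, Z1), (Z2, Z0), (Z2, Z1), (Z2, Z2)]"
    "distinct [(Z2, Z1), (Z0, Z1), (Z1, Z1), (Z2, Z2), (Z0, Z2), (Z1, Z2), (Z2, Z0), (Z0, Z0), (Z1, Z0)]"
    "distinct [(Z0, Z0), (Z1, Z0), (Z2, Z0), (Z0, Z1), (Z1, Z1), (Z2, Z1), (Z0, Z2), (Z1, Z2), (Z2, Z2)]"
    by simp_all
qed (unfold all_z3, simp only: exceptional_rules)

lemma iso_sys_21_60: "iso_sys (sys signs21) (sys signs60)"
proof (rule iso_sys_by_tables[OF admissible_exceptional(3)[unfolded signs21_def] admissible_exceptional(4)[unfolded signs60_def]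
      bij_slot bij_slot bij_slot, folded signs21_def signs60_def])
  show "distinct [(Z0, Z0), (Z1, Z0), (Z2, Z0), (Z0, Z1), (Z1, Z1), (Z2, Z1), (Z0, Z2), (Z1, Z2), (Z2, Z2)]"
    "distinct [(Z0, Z2), (Z0, Z1), (Z0, Z0), (Z1, Z1), (Z1, Z0), (Z1, Z2), (Z2, Z0), (Z2, Z1), (Z2, Z2)]"
    "distinct [(Z2, Z0), (Z1, Z1), (Z0, Z2), (Z1, Z0), (Z0, Z1), (Z2, Z2), (Z0, Z0), (Z2, Z1), (Z1, Z2)]"
    by simp_all
qed (unfold all_z3, simp only: exceptional_rules)

lemma iso_sys_33_117: "iso_sys (sys signs33) (sys signs117)"
proof (rule iso_sys_by_tables[OF admissible_exceptional(5)[unfolded signs33_def] admissible_exceptional(6)[unfolded signs117_def]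
      bij_slot bij_slot bij_slot, folded signs33_def signs117_def])
  show "distinct [(Z0, Z0), (Z2, Z1), (Z1, Z2), (Z2, Z0), (Z1, Z1), (Z0, Z2), (Z1, Z0), (Z0, Z1), (Z2, Z2)]"
    "distinct [(Z2, Z0), (Z1, Z1), (Z0, Z2), (Z1, Z0), (Z0, Z1), (Z2, Z2), (Z0, Z0), (Z2, Z1), (Z1, Z2)]"
    "distinct [(Z0, Z2), (Z0, Z1), (Z0, Z0), (Z1, Z1), (Z1, Z0), (Z1, Z2), (Z2, Z0), (Z2, Z1), (Z2, Z2)]"
    by simp_all
qed (unfold all_z3, simp only: exceptional_rules)

definition principal_list :: "signs list" where
  "principal_list = filter principal representatives"

lemma principal_list_concat:
  "map (key \<circ> sys) principal_list = concat (map (\<lambda>b. map (key \<circ> sys) (filter principal (signs_of_branch b))) tree)"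
  by (simp add: principal_list_def representatives_def filter_concat map_concat comp_def)

lemma distinct_keys_principal:
  "distinct (map (key \<circ> sys) principal_list)" "length (map (key \<circ> sys) principal_list) = 183"
  unfolding principal_list_concat tree_def list.map keys_branch1 keys_branch2 keys_branch3 keys_branch4
    keys_branch5 keys_branch6 keys_branch7
  by simp_all

lemma iso_sys_refl: "iso_sys T T"
  unfolding iso_sys_def by (intro exI[of _ id]) simp

lemma ds_iso_sys_refl: "ds_iso_sys T T"
  unfolding ds_iso_sys_def blockwise_def by (intro exI[of _ id]) simp

text \<open>
  Replaces the member of an exceptional pair that is set aside by the other one.
\<close>

definition base :: "signs \<Rightarrow> signs" where
  "base s = (if s = signs19 then signs18 else if s = signs60 then signs21
     else if s = signs117 then signs33 else s)"

lemmas exceptional_signs = signs18_def signs19_def signs21_def signs60_def signs33_def signs117_def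

lemma base_principal:
  assumes "s \<in> set representatives"
  shows "base s \<in> set principal_list"
proof -
  have "principal (base s)"
    by (simp add: base_def principal_def) (simp add: exceptional_signs)
  moreover have "base s \<in> set representatives"
    using assms exceptional_in_representatives by (simp add: base_def)
  ultimately show ?thesis by (simp add: principal_list_def)
qed

lemma iso_sys_base: "iso_sys (sys s) (sys (base s))"
  using iso_sys_refl iso_sys_18_19 iso_sys_21_60 iso_sys_33_117
  by (auto simp: base_def intro: iso_sys_sym)

lemma inj_on_key: "inj_on (key \<circ> sys) (set principal_list)"
  and distinct_principal_list: "distinct principal_list"
  using distinct_keys_principal(1) by (simp_all add: distinct_map)

text \<open>
  Isotopic representatives have isotopic base members, whose keys agree and hence coincide.
\<close>

lemma iso_sys_representatives_iff:
  assumes "s \<in> set representatives" "s' \<in> set representatives"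
  shows "iso_sys (sys s) (sys s') \<longleftrightarrow> base s = base s'"
proof
  assume "iso_sys (sys s) (sys s')"
  then have "iso_sys (sys (base s)) (sys (base s'))"
    using iso_sys_base iso_sys_sym iso_sys_trans by blast
  then have "key (sys (base s)) = key (sys (base s'))" by (rule key_invariant)
  then show "base s = base s'"
    using inj_on_key base_principal[OF assms(1)] base_principal[OF assms(2)]
    unfolding inj_on_def comp_def by blast
next
  assume "base s = base s'"
  then show "iso_sys (sys s) (sys s')"
    using iso_sys_base[of s] iso_sys_base[of s'] iso_sys_sym iso_sys_trans by metis
qed

lemma base_eq_iff:
  assumes "s \<noteq> s'"
  shows "base s = base s' \<longleftrightarrow>
    (s = signs18 \<and> s' = signs19 \<or> s = signs19 \<and> s' = signs18) \<or>
    (s = signs21 \<and> s' = signs60 \<or> s = signs60 \<and> s' = signs21) \<or>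
    (s = signs33 \<and> s' = signs117 \<or> s = signs117 \<and> s' = signs33)"
proof -
  have "distinct [signs18, signs19, signs21, signs60, signs33, signs117]"
    by (simp add: exceptional_signs)
  then show ?thesis using assms unfolding base_def by auto
qed

text \<open>
  Different representatives that are ds-isotopic would form an exceptional pair, whose block energies
  differ.
\<close>

lemma ds_iso_sys_representatives_iff:
  assumes "s \<in> set representatives" "s' \<in> set representatives"
  shows "ds_iso_sys (sys s) (sys s') \<longleftrightarrow> s = s'"
proof
  assume ds: "ds_iso_sys (sys s) (sys s')"
  show "s = s'"
  proof (rule ccontr)
    assume "s \<noteq> s'"
    moreover have "base s = base s'"
      using ds_iso_sys_imp_iso_sys[OF ds] iso_sys_representatives_iff[OF assms] by blast
    moreover have "block_energies (sys s) = block_energies (sys s')"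
      by (rule block_energies_invariant[OF ds])
    ultimately show False
      by (auto simp: base_eq_iff block_energies_exceptional)
  qed
qed (simp add: ds_iso_sys_refl)

lemma card_principal_list: "card (set principal_list) = 183"
  using distinct_card[OF distinct_principal_list] distinct_keys_principal(2) by simp

lemma card_representatives: "card (set representatives) = 186"
proof -
  let ?T = "{signs19, signs60, signs117}"
  have "set representatives = set principal_list \<union> ?T"
    using exceptional_in_representatives by (auto simp: principal_list_def principal_def)
  moreover have "card (set principal_list \<union> ?T) = card (set principal_list) + card ?T"
    by (rule card_Un_disjoint) (auto simp: principal_list_def principal_def)
  moreover have "card ?T = 3"
    by (simp add: exceptional_signs)
  ultimately have "card (set representatives) = 183 + 3"
    by (simp only: card_principal_list)
  then show ?thesis by simp
qed

lemma card_quotient_transversal: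
  assumes "equiv A R" and "\<And>s. s \<in> S \<Longrightarrow> h s \<in> A" and "\<And>a. a \<in> A \<Longrightarrow> \<exists>s\<in>S. (a, h s) \<in> R"
    and "\<And>s t. s \<in> S \<Longrightarrow> t \<in> S \<Longrightarrow> (h s, h t) \<in> R \<Longrightarrow> s = t"
  shows "card (A // R) = card S"
proof -
  have "A // R = (\<lambda>s. R `` {h s}) ` S"
  proof (intro equalityI subsetI)
    fix X assume "X \<in> A // R"
    then obtain a where a: "a \<in> A" "X = R `` {a}" by (auto elim: quotientE)
    then obtain s where "s \<in> S" "(a, h s) \<in> R" using assms(3) by blast
    then show "X \<in> (\<lambda>s. R `` {h s}) ` S"
      using equiv_class_eq[OF assms(1)] a(2) by blast
  next
    fix X assume "X \<in> (\<lambda>s. R `` {h s}) ` S"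
    then show "X \<in> A // R" using assms(2) by (auto intro: quotientI)
  qed
  moreover have "inj_on (\<lambda>s. R `` {h s}) S"
  proof (rule inj_onI)
    fix s t assume "s \<in> S" "t \<in> S" "R `` {h s} = R `` {h t}"
    then show "s = t"
      using eq_equiv_class[OF _ assms(1)] assms(2,4) by blast
  qed
  ultimately show ?thesis by (simp add: card_image)
qed

lemma standard_division_sudokusD:
  assumes "L \<in> standard_division_sudokus"
  shows "L \<in> symbols9 \<rightarrow>\<^sub>E symbols9 \<rightarrow>\<^sub>E symbols9" and "division_sys (system_of L)"
  using assms by (simp_all only: standard_division_sudokus_def mem_Collect_eq standard_division_sudoku_iff)

lemma square_in_standard_division_sudokus: "s \<in> set representatives \<Longrightarrow> square s \<in> standard_division_sudokus"
  using square_standard[OF admissible_representative] by (simp add: standard_division_sudokus_def)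

lemma isotopic_square_iff:
  "L \<in> standard_division_sudokus \<Longrightarrow> s \<in> set representatives \<Longrightarrow>
    isotopic L (square s) \<longleftrightarrow> iso_sys (system_of L) (sys s)"
  by (simp only: isotopic_iff[OF standard_division_sudokusD(1)] system_of_square[OF admissible_representative])

lemma ds_isotopic_square_iff:
  "L \<in> standard_division_sudokus \<Longrightarrow> s \<in> set representatives \<Longrightarrow>
    ds_isotopic L (square s) \<longleftrightarrow> ds_iso_sys (system_of L) (sys s)"
  by (simp only: ds_isotopic_iff[OF standard_division_sudokusD(1)] system_of_square[OF admissible_representative])

lemma exists_representative:
  assumes "L \<in> standard_division_sudokus"
  obtains s where "s \<in> set representatives" "ds_iso_sys (system_of L) (sys s)"
proof -
  obtain s where "admissible_signs s" and L: "ds_iso_sys (system_of L) (sys s)"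
    by (rule division_sys_classified[OF standard_division_sudokusD(2)[OF assms]])
  obtain s' where "s' \<in> set representatives" "ds_iso_sys (sys s) (sys s')"
    by (rule admissible_signs_classified[OF \<open>admissible_signs s\<close>])
  then show thesis using that ds_iso_sys_trans[OF L] by blast
qed

lemma card_isotopism_classes: "card isotopism_classes = 183"
  unfolding isotopism_classes_def card_principal_list[symmetric]
proof (rule card_quotient_transversal[where h = square])
  let ?D = standard_division_sudokus
  let ?R = "{(L, M). L \<in> ?D \<and> M \<in> ?D \<and> isotopic L M}"
  have R: "(L, M) \<in> ?R \<longleftrightarrow> L \<in> ?D \<and> M \<in> ?D \<and> iso_sys (system_of L) (system_of M)" for L M
    using isotopic_iff[OF standard_division_sudokusD(1)] by simp blast
  show "equiv ?D ?R"
  proof (rule equivI)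
    show "?R \<subseteq> ?D \<times> ?D" by auto
    show "refl_on ?D ?R" by (rule refl_onI) (simp only: R iso_sys_refl simp_thms)
    show "sym ?R" by (rule symI) (simp only: R iso_sys_sym simp_thms)
    show "trans ?R" by (rule transI) (simp only: R, blast intro: iso_sys_trans)
  qed
  have rep: "s \<in> set representatives" if "s \<in> set principal_list" for s
    using that by (simp add: principal_list_def)
  show "square s \<in> ?D" if "s \<in> set principal_list" for s
    using square_in_standard_division_sudokus rep that by blast
  show "\<exists>s\<in>set principal_list. (L, square s) \<in> ?R" if "L \<in> ?D" for L
  proof -
    obtain s where s: "s \<in> set representatives" "ds_iso_sys (system_of L) (sys s)"
      by (rule exists_representative[OF \<open>L \<in> ?D\<close>])
    then have "iso_sys (system_of L) (sys (base s))"
      using ds_iso_sys_imp_iso_sys iso_sys_base iso_sys_trans by blast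
    then have "isotopic L (square (base s))"
      using isotopic_square_iff[OF that rep[OF base_principal[OF s(1)]]] by blast
    then have "(L, square (base s)) \<in> ?R"
      using that square_in_standard_division_sudokus[OF rep[OF base_principal[OF s(1)]]] by simp
    then show ?thesis using base_principal[OF s(1)] by (rule rev_bexI[rotated])
  qed
  show "s = t" if "s \<in> set principal_list" "t \<in> set principal_list" "(square s, square t) \<in> ?R" for s t
  proof -
    have "iso_sys (sys s) (sys t)"
      using that(3) unfolding R
        system_of_square[OF admissible_representative[OF rep[OF that(1)]]]
        system_of_square[OF admissible_representative[OF rep[OF that(2)]]] by blast
    then have "key (sys s) = key (sys t)" by (rule key_invariant)
    then show ?thesis using inj_on_key that(1,2) unfolding inj_on_def comp_def by blast
  qed
qed

lemma card_ds_isotopism_classes: "card ds_isotopism_classes = 186"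
  unfolding ds_isotopism_classes_def card_representatives[symmetric]
proof (rule card_quotient_transversal[where h = square])
  let ?D = standard_division_sudokus
  let ?R = "{(L, M). L \<in> ?D \<and> M \<in> ?D \<and> ds_isotopic L M}"
  have R: "(L, M) \<in> ?R \<longleftrightarrow> L \<in> ?D \<and> M \<in> ?D \<and> ds_iso_sys (system_of L) (system_of M)" for L M
    using ds_isotopic_iff[OF standard_division_sudokusD(1)] by simp blast
  show "equiv ?D ?R"
  proof (rule equivI)
    show "?R \<subseteq> ?D \<times> ?D" by auto
    show "refl_on ?D ?R" by (rule refl_onI) (simp only: R ds_iso_sys_refl simp_thms)
    show "sym ?R" by (rule symI) (simp only: R ds_iso_sys_sym simp_thms)
    show "trans ?R" by (rule transI) (simp only: R, blast intro: ds_iso_sys_trans)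
  qed
  show "square s \<in> ?D" if "s \<in> set representatives" for s
    using square_in_standard_division_sudokus that .
  show "\<exists>s\<in>set representatives. (L, square s) \<in> ?R" if L: "L \<in> ?D" for L
  proof -
    obtain s where s: "s \<in> set representatives" "ds_iso_sys (system_of L) (sys s)"
      by (rule exists_representative[OF L])
    then have "ds_isotopic L (square s)"
      using ds_isotopic_square_iff[OF L s(1)] by blast
    then have "(L, square s) \<in> ?R" using L square_in_standard_division_sudokus[OF s(1)] by simp
    then show ?thesis using s(1) by (rule rev_bexI[rotated])
  qed
  show "s = t" if "s \<in> set representatives" "t \<in> set representatives" "(square s, square t) \<in> ?R" for s t
  proof -
    have "ds_iso_sys (sys s) (sys t)"
      using that(3) unfolding R
        system_of_square[OF admissible_representative[OF that(1)]]
        system_of_square[OF admissible_representative[OF that(2)]] by blast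
    then show ?thesis using ds_iso_sys_representatives_iff[OF that(1,2)] by blast
  qed
qed

lemma ds_class_square_inj:
  assumes "s \<in> set representatives" "t \<in> set representatives" "ds_class (square s) = ds_class (square t)"
  shows "s = t"
proof -
  have "square s \<in> ds_class (square s)"
    using square_in_standard_division_sudokus[OF assms(1)] ds_isotopic_square_iff[OF square_in_standard_division_sudokus assms(1)] assms(1)
    by (simp add: ds_class_def system_of_square admissible_representative ds_iso_sys_refl)
  then have "ds_isotopic (square t) (square s)"
    unfolding assms(3) by (simp add: ds_class_def)
  then show ?thesis
    using assms(1,2) ds_isotopic_square_iff[OF square_in_standard_division_sudokus[OF assms(2)] assms(1)]
    by (simp add: system_of_square admissible_representative ds_iso_sys_representatives_iff)
qed

theorem proposition4p9:
  shows "card isotopism_classes = 183 \<and>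
    card ds_isotopism_classes = 186 \<and>
    {DS_9_18, DS_9_19, DS_9_21, DS_9_60, DS_9_33, DS_9_117} \<subseteq> standard_division_sudokus \<and>
    distinct (map ds_class [DS_9_18, DS_9_19, DS_9_21, DS_9_60, DS_9_33, DS_9_117]) \<and>
    (\<forall>L\<in>standard_division_sudokus. \<forall>M\<in>standard_division_sudokus. \<not> ds_isotopic L M \<longrightarrow>
       (isotopic L M \<longleftrightarrow>
          (\<exists>(A, B)\<in>exceptional_pairs.
             (ds_isotopic L A \<and> ds_isotopic M B) \<or> (ds_isotopic L B \<and> ds_isotopic M A))))"
proof (intro conjI ballI impI)
  show "card isotopism_classes = 183" by (rule card_isotopism_classes)
  show "card ds_isotopism_classes = 186" by (rule card_ds_isotopism_classes)
  show "{DS_9_18, DS_9_19, DS_9_21, DS_9_60, DS_9_33, DS_9_117} \<subseteq> standard_division_sudokus"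
    unfolding DS_9_eq_square using square_in_standard_division_sudokus exceptional_in_representatives by blast
  have "distinct [signs18, signs19, signs21, signs60, signs33, signs117]"
    by (simp add: exceptional_signs)
  moreover have "inj_on (ds_class \<circ> square) (set [signs18, signs19, signs21, signs60, signs33, signs117])"
    using ds_class_square_inj exceptional_in_representatives unfolding inj_on_def comp_def by auto
  ultimately have "distinct (map (ds_class \<circ> square) [signs18, signs19, signs21, signs60, signs33, signs117])"
    unfolding distinct_map by blast
  then show "distinct (map ds_class [DS_9_18, DS_9_19, DS_9_21, DS_9_60, DS_9_33, DS_9_117])"
    by (simp only: DS_9_eq_square list.map comp_apply)
next
  fix L M
  assume L: "L \<in> standard_division_sudokus" and M: "M \<in> standard_division_sudokus"
    and nds: "\<not> ds_isotopic L M"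
  obtain s where s: "s \<in> set representatives" and Ls: "ds_iso_sys (system_of L) (sys s)"
    by (rule exists_representative[OF L])
  obtain t where t: "t \<in> set representatives" and Mt: "ds_iso_sys (system_of M) (sys t)"
    by (rule exists_representative[OF M])
  have "s \<noteq> t"
    using nds Ls Mt ds_iso_sys_sym ds_iso_sys_trans
    unfolding ds_isotopic_iff[OF standard_division_sudokusD(1)[OF L]] by blast
  have ds: "ds_isotopic L (square u) \<longleftrightarrow> s = u" "ds_isotopic M (square u) \<longleftrightarrow> t = u"
    if "u \<in> set representatives" for u
    using ds_isotopic_square_iff[OF L that] ds_isotopic_square_iff[OF M that]
      ds_iso_sys_representatives_iff[OF s that] ds_iso_sys_representatives_iff[OF t that]
      Ls Mt ds_iso_sys_sym ds_iso_sys_trans by blast+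
  have "isotopic L M \<longleftrightarrow> iso_sys (sys s) (sys t)"
    unfolding isotopic_iff[OF standard_division_sudokusD(1)[OF L]]
    using Ls[THEN ds_iso_sys_imp_iso_sys] Mt[THEN ds_iso_sys_imp_iso_sys] iso_sys_sym iso_sys_trans
    by blast
  also have "\<dots> \<longleftrightarrow> base s = base t"
    by (rule iso_sys_representatives_iff[OF s t])
  also have "\<dots> \<longleftrightarrow> (\<exists>(A, B)\<in>exceptional_pairs.
      (ds_isotopic L A \<and> ds_isotopic M B) \<or> (ds_isotopic L B \<and> ds_isotopic M A))"
    unfolding base_eq_iff[OF \<open>s \<noteq> t\<close>] exceptional_pairs_def DS_9_eq_square
    by (simp add: ds exceptional_in_representatives)
  finally show "isotopic L M \<longleftrightarrow> (\<exists>(A, B)\<in>exceptional_pairs.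
      (ds_isotopic L A \<and> ds_isotopic M B) \<or> (ds_isotopic L B \<and> ds_isotopic M A))" .
qed

end
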